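(* Let $k$ be a field, $<$ a monomial preorder on $k[X]=k[x_1,\dots,x_n]$, and $I$ a homogeneous ideal in $k[X]$. Let $\mathfrak{m}=(x_1,\dots,x_n)$. Then $$\dim_kH_{\mathfrak{m}}^i(k[X]/I)_j\le\dim_kH_{\mathfrak{m}}^i(k[X]/L_<(I))_j$$ for all $i\in\mathbb{N}$, $j\in\mathbb{Z}$.
   Context: "Homogeneous" is with respect to the standard grading $\deg x_i=1$. For $a\in\mathbb{N}^n$ write $x^a=x_1^{\alpha_1}\cdots x_n^{\alpha_n}$. A weak order on a set is a strict partial order for which incomparability is an equivalence relation. A monomial preorder on $k[X]$ is a weak order $<$ on the monomials such that for all $a,b,c\in\mathbb{N}^n$: $x^a<x^b$ if and only if $x^ax^c<x^bx^c$. For $f=\sum c_ax^a\in k[X]$, the leading part $L_<(f)$ is the sum of those terms $c_ax^a$ ($c_a\ne0$) such that no monomial $x^b$ occurring in $f$ satisfies $x^a<x^b$. For $I\subseteq k[X]$, $L_<(I)$ is the ideal of $k[X]$ generated by all $L_<(f)$, $f\in I$; for homogeneous $I$ it is again homogeneous. For a finitely generated graded $k[X]$-module $E$, $H_{\mathfrak{m}}^i(E)$ is the $i$-th local cohomology module with respect to $\mathfrak{m}$, with its natural $\mathbb{Z}$-grading, and $H_{\mathfrak{m}}^i(E)_j$ is its component of degree $j$. *)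

theory Defs
  imports "HOL-Algebra.Ideal" "HOL-Algebra.Module" "HOL-Library.Poly_Mapping" "HOL-Library.Extended_Nat"
begin

section \<open>The polynomial ring\<close>

text \<open>
  A monomial is identified with its exponent vector, so the product of monomials is the sum of
  exponent vectors. The variables of \<open>k[x\<^sub>1,\<dots>,x\<^sub>n]\<close> are indexed by \<open>{1..n}\<close>.
\<close>

type_synonym expo = "nat \<Rightarrow>\<^sub>0 nat"
type_synonym 'k poly = "expo \<Rightarrow>\<^sub>0 'k"

definition monomials :: "nat \<Rightarrow> expo set" where
  "monomials n = {a. Poly_Mapping.keys a \<subseteq> {1..n}}"

definition expo_deg :: "expo \<Rightarrow> nat" where
  "expo_deg a = (\<Sum>i\<in>Poly_Mapping.keys a. Poly_Mapping.lookup a i)"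

definition Var :: "nat \<Rightarrow> 'k::field poly" where
  "Var i = Poly_Mapping.single (Poly_Mapping.single i 1) 1"

definition Const :: "'k \<Rightarrow> 'k::field poly" where
  "Const c = Poly_Mapping.single 0 c"

text \<open>
  The zero polynomial lies in every \<open>homogeneous_polys n j\<close>, and is the only element for \<open>j < 0\<close>.
\<close>

definition homogeneous_polys :: "nat \<Rightarrow> int \<Rightarrow> 'k::field poly set" where
  "homogeneous_polys n j =
     {f. Poly_Mapping.keys f \<subseteq> monomials n \<and> (\<forall>a\<in>Poly_Mapping.keys f. int (expo_deg a) = j)}"

definition homogeneous_part :: "int \<Rightarrow> 'k::field poly \<Rightarrow> 'k poly" where
  "homogeneous_part j f =
     (\<Sum>a\<in>{a\<in>Poly_Mapping.keys f. int (expo_deg a) = j}. Poly_Mapping.single a (Poly_Mapping.lookup f a))"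

text \<open>
  A \<open>\<int>\<close>-graded \<open>k[X]\<close>-module is a module record (whose fields \<open>mult\<close> and \<open>one\<close> play no role)
  together with its family of homogeneous components.
\<close>

record ('a, 'b) graded_module = "('a, 'b) module" +
  component :: "int \<Rightarrow> 'b set"

definition poly_ring :: "nat \<Rightarrow> ('k::field poly, 'k poly) graded_module" where
  "poly_ring n =
     \<lparr>carrier = {f. Poly_Mapping.keys f \<subseteq> monomials n}, mult = (*), one = 1, zero = 0, add = (+),
      smult = (*), component = homogeneous_polys n\<rparr>"

definition homogeneous_ideal :: "nat \<Rightarrow> 'k::field poly set \<Rightarrow> bool" where
  "homogeneous_ideal n I \<longleftrightarrow>
     ideal I (poly_ring n) \<and> (\<forall>f\<in>I. \<forall>j. homogeneous_part j f \<in> I)"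

section \<open>Monomial preorders and leading ideals\<close>

definition weak_order_on :: "'a set \<Rightarrow> ('a \<Rightarrow> 'a \<Rightarrow> bool) \<Rightarrow> bool" where
  "weak_order_on A lt \<longleftrightarrow>
     irreflp_on A lt \<and> transp_on A lt \<and>
     equiv A {(a, b). a \<in> A \<and> b \<in> A \<and> \<not> lt a b \<and> \<not> lt b a}"

definition monomial_preorder :: "nat \<Rightarrow> (expo \<Rightarrow> expo \<Rightarrow> bool) \<Rightarrow> bool" where
  "monomial_preorder n lt \<longleftrightarrow>
     weak_order_on (monomials n) lt \<and>
     (\<forall>a\<in>monomials n. \<forall>b\<in>monomials n. \<forall>c\<in>monomials n. lt a b \<longleftrightarrow> lt (a + c) (b + c))"

definition leading_part :: "(expo \<Rightarrow> expo \<Rightarrow> bool) \<Rightarrow> 'k::field poly \<Rightarrow> 'k poly" where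
  "leading_part lt f =
     (\<Sum>a\<in>{a\<in>Poly_Mapping.keys f. \<not> (\<exists>b\<in>Poly_Mapping.keys f. lt a b)}.
        Poly_Mapping.single a (Poly_Mapping.lookup f a))"

definition leading_ideal ::
    "nat \<Rightarrow> (expo \<Rightarrow> expo \<Rightarrow> bool) \<Rightarrow> 'k::field poly set \<Rightarrow> 'k poly set" where
  "leading_ideal n lt I = Idl\<^bsub>poly_ring n\<^esub> (leading_part lt ` I)"

section \<open>Constructions on graded modules\<close>

definition quotient_module ::
    "('k::field poly, 'b) graded_module \<Rightarrow> 'b set \<Rightarrow> ('k poly, 'b set) graded_module" where
  "quotient_module M N =
     \<lparr>carrier = a_rcosets\<^bsub>M\<^esub> N, mult = (\<lambda>_ _. undefined), one = undefined,
      zero = N, add = (\<lambda>A B. A <+>\<^bsub>M\<^esub> B),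
      smult = (\<lambda>r A. \<Union>m\<in>A. N +>\<^bsub>M\<^esub> (r \<odot>\<^bsub>M\<^esub> m)),
      component = (\<lambda>j. {N +>\<^bsub>M\<^esub> m | m. m \<in> component M j})\<rparr>"

text \<open>
  Localization of \<open>M\<close> at the powers of a homogeneous element \<open>x\<close> of degree \<open>d\<close>; the pair \<open>(m, s)\<close>
  stands for the fraction \<open>m / x\<^sup>s\<close>, which has degree \<open>deg m - s d\<close>.
\<close>

definition fraction_rel ::
    "('k::field poly, 'b) graded_module \<Rightarrow> 'k poly \<Rightarrow> (('b \<times> nat) \<times> ('b \<times> nat)) set" where
  "fraction_rel M x =
     {((m, s), (m', s')). m \<in> carrier M \<and> m' \<in> carrier M \<and>
        (\<exists>u. x ^ (u + s') \<odot>\<^bsub>M\<^esub> m = x ^ (u + s) \<odot>\<^bsub>M\<^esub> m')}"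

definition fraction ::
    "('k::field poly, 'b) graded_module \<Rightarrow> 'k poly \<Rightarrow> 'b \<Rightarrow> nat \<Rightarrow> ('b \<times> nat) set" where
  "fraction M x m s = fraction_rel M x `` {(m, s)}"

definition localization ::
    "('k::field poly, 'b) graded_module \<Rightarrow> 'k poly \<Rightarrow> nat \<Rightarrow> ('k poly, ('b \<times> nat) set) graded_module"
  where
  "localization M x d =
     \<lparr>carrier = {fraction M x m s | m s. m \<in> carrier M}, mult = (\<lambda>_ _. undefined), one = undefined,
      zero = fraction M x \<zero>\<^bsub>M\<^esub> 0,
      add = (\<lambda>A B. \<Union>(m, s)\<in>A. \<Union>(m', s')\<in>B.
               fraction M x (x ^ s' \<odot>\<^bsub>M\<^esub> m \<oplus>\<^bsub>M\<^esub> x ^ s \<odot>\<^bsub>M\<^esub> m') (s + s')),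
      smult = (\<lambda>r A. \<Union>(m, s)\<in>A. fraction M x (r \<odot>\<^bsub>M\<^esub> m) s),
      component = (\<lambda>j. {fraction M x m s | m s. m \<in> component M (j + int s * int d)})\<rparr>"

text \<open>The canonical map from the localization at \<open>x\<close> to the one at \<open>x y\<close>: \<open>m / x\<^sup>s = y\<^sup>s m / (x y)\<^sup>s\<close>.\<close>

definition localization_map ::
    "('k::field poly, 'b) graded_module \<Rightarrow> 'k poly \<Rightarrow> 'k poly \<Rightarrow> ('b \<times> nat) set \<Rightarrow> ('b \<times> nat) set" where
  "localization_map M x y A = (\<Union>(m, s)\<in>A. fraction M (x * y) (y ^ s \<odot>\<^bsub>M\<^esub> m) s)"

section \<open>Local cohomology with respect to the maximal ideal \<open>(x\<^sub>1,\<dots>,x\<^sub>n)\<close>\<close>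

text \<open>
  Local cohomology is the cohomology of the \<open>\<int>\<close>-graded Cech complex on \<open>x\<^sub>1,\<dots>,x\<^sub>n\<close>
  \[ 0 \to M \to \bigoplus_i M_{x_i} \to \bigoplus_{i<j} M_{x_i x_j} \to \cdots \to M_{x_1 \cdots x_n} \to 0. \]
  The term in cohomological degree \<open>p\<close> is the direct sum of the localizations \<open>M\<^sub>S\<close> at
  \<open>\<Prod>\<^sub>i\<^sub>\<in>\<^sub>S x\<^sub>i\<close> over the \<open>p\<close>-element subsets \<open>S\<close> of \<open>{1..n}\<close>. It vanishes for \<open>p > n\<close>.
\<close>

definition var_prod :: "nat set \<Rightarrow> 'k::field poly" where
  "var_prod S = (\<Prod>i\<in>S. Var i)"

abbreviation loc_at ::
    "('k::field poly, 'b) graded_module \<Rightarrow> nat set \<Rightarrow> ('k poly, ('b \<times> nat) set) graded_module" where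
  "loc_at M S \<equiv> localization M (var_prod S) (card S)"

definition cech_index :: "nat \<Rightarrow> nat \<Rightarrow> nat set set" where
  "cech_index n p = {S. S \<subseteq> {1..n} \<and> card S = p}"

definition cech_module ::
    "nat \<Rightarrow> ('k::field poly, 'b) graded_module \<Rightarrow> nat \<Rightarrow>
     ('k poly, nat set \<Rightarrow> ('b \<times> nat) set) graded_module" where
  "cech_module n M p =
     \<lparr>carrier = (\<Pi>\<^sub>E S\<in>cech_index n p. carrier (loc_at M S)),
      mult = (\<lambda>_ _. undefined), one = undefined,
      zero = (\<lambda>S\<in>cech_index n p. \<zero>\<^bsub>loc_at M S\<^esub>),
      add = (\<lambda>c c'. \<lambda>S\<in>cech_index n p. c S \<oplus>\<^bsub>loc_at M S\<^esub> c' S),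
      smult = (\<lambda>r c. \<lambda>S\<in>cech_index n p. r \<odot>\<^bsub>loc_at M S\<^esub> c S),
      component = (\<lambda>j. \<Pi>\<^sub>E S\<in>cech_index n p. component (loc_at M S) j)\<rparr>"

definition cech_diff ::
    "nat \<Rightarrow> ('k::field poly, 'b) graded_module \<Rightarrow> nat \<Rightarrow>
     (nat set \<Rightarrow> ('b \<times> nat) set) \<Rightarrow> (nat set \<Rightarrow> ('b \<times> nat) set)" where
  "cech_diff n M p c =
     (\<lambda>T\<in>cech_index n (Suc p).
        \<Oplus>\<^bsub>loc_at M T\<^esub>i\<in>T. ((-1) ^ card {l\<in>T. l < i}) \<odot>\<^bsub>loc_at M T\<^esub>
           localization_map M (var_prod (T - {i})) (Var i) (c (T - {i})))"

definition cech_cocycles ::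
    "nat \<Rightarrow> ('k::field poly, 'b) graded_module \<Rightarrow> nat \<Rightarrow> (nat set \<Rightarrow> ('b \<times> nat) set) set" where
  "cech_cocycles n M p =
     {c \<in> carrier (cech_module n M p). cech_diff n M p c = \<zero>\<^bsub>cech_module n M (Suc p)\<^esub>}"

definition cech_coboundaries ::
    "nat \<Rightarrow> ('k::field poly, 'b) graded_module \<Rightarrow> nat \<Rightarrow> (nat set \<Rightarrow> ('b \<times> nat) set) set" where
  "cech_coboundaries n M p =
     (case p of 0 \<Rightarrow> {\<zero>\<^bsub>cech_module n M 0\<^esub>}
      | Suc q \<Rightarrow> cech_diff n M q ` carrier (cech_module n M q))"

definition cech_cocycle_module ::
    "nat \<Rightarrow> ('k::field poly, 'b) graded_module \<Rightarrow> nat \<Rightarrow>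
     ('k poly, nat set \<Rightarrow> ('b \<times> nat) set) graded_module" where
  "cech_cocycle_module n M p =
     (cech_module n M p)
       \<lparr>carrier := cech_cocycles n M p,
        component := (\<lambda>j. component (cech_module n M p) j \<inter> cech_cocycles n M p)\<rparr>"

definition local_cohomology ::
    "nat \<Rightarrow> nat \<Rightarrow> ('k::field poly, 'b) graded_module \<Rightarrow>
     ('k poly, (nat set \<Rightarrow> ('b \<times> nat) set) set) graded_module" where
  "local_cohomology n i M =
     quotient_module (cech_cocycle_module n M i) (cech_coboundaries n M i)"

section \<open>Dimension of homogeneous components\<close>

definition lin_independent ::
    "('k::field poly, 'b) graded_module \<Rightarrow> 'b set \<Rightarrow> bool" where
  "lin_independent M X \<longleftrightarrow>
     (\<forall>a :: 'b \<Rightarrow> 'k. (\<Oplus>\<^bsub>M\<^esub>v\<in>X. Const (a v) \<odot>\<^bsub>M\<^esub> v) = \<zero>\<^bsub>M\<^esub> \<longrightarrow> (\<forall>v\<in>X. a v = 0))"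

text \<open>The \<open>k\<close>-dimension of the degree \<open>j\<close> component, with value \<open>\<infinity>\<close> if it is not finite-dimensional.\<close>

definition component_dim :: "('k::field poly, 'b) graded_module \<Rightarrow> int \<Rightarrow> enat" where
  "component_dim M j =
     (SUP X\<in>{X. finite X \<and> X \<subseteq> component M j \<and> lin_independent M X}. enat (card X))"

end

theory Submission
  imports Defs
begin

text \<open>
  The degree \<open>j\<close> part of the local cohomology of \<open>k[X]/I\<close> is the direct limit over \<open>s\<close> of the degree
  \<open>j\<close> part of the cohomology of the Koszul complex on \<open>x\<^sub>1\<^sup>s, \<dots>, x\<^sub>n\<^sup>s\<close> modulo \<open>I\<close>, and each of these is the
  cohomology of a complex of finite-dimensional spaces. The preorder filters this complex, hence
  passing from \<open>I\<close> to \<open>L\<^sub><(I)\<close> can only enlarge the cycles and shrink the boundaries, for every \<open>s\<close>. It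
  remains to see that for the ideal \<open>L\<^sub><(I)\<close> the Koszul cohomology injects into the limit when \<open>s\<close> is
  large. The cone of the transition map that raises the exponent of one variable \<open>x\<^sub>l\<close> is again a Koszul
  complex, in degree \<open>j + s\<close>, so it is enough that Koszul cohomology vanishes in all sufficiently high
  degrees, uniformly in the exponents. By the same semicontinuity this only needs to be checked for
  monomial ideals, where the complex splits into multigraded pieces, each of which is contractible along
  a variable with large exponent.
\<close>

text \<open>With two or more variables the Cech complex of the polynomial ring is
  infinite-dimensional in a fixed degree, so leading terms cannot be counted there; this forces the
  detour through Koszul complexes, whose graded pieces have finite monomial bases. The two ideals
  enter asymmetrically. For \<open>I\<close>, independent classes of the limit come from independent
  classes at every large stage. For \<open>L_<(I)\<close>, a stage must inject into the limit, and
  this is where vanishing in high degrees enters. A monomial preorder may have ties and infinite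
  chains in both directions, so there is no division algorithm to rely on. Ties are kept together
  when a leading part is taken, and are broken only in the ranking of a finite basis that serves for
  counting. The preorder extends to Laurent monomials by clearing denominators. In terms of Laurent
  monomials the Koszul differential has coefficients 1 and -1 only, which is why projecting to a tie
  class commutes with it. Semicontinuity is used twice: for the given preorder, and for the
  lexicographic order applied to \<open>L_<(I)\<close>.\<close>

abbreviation "coef \<equiv> Poly_Mapping.lookup"
abbreviation "keys \<equiv> Poly_Mapping.keys"
abbreviation "single \<equiv> Poly_Mapping.single"

section \<open>Polynomials, monomial multiples and restriction to sets of monomials\<close>

definition polys :: "nat \<Rightarrow> 'k::field poly set" where
  "polys n = {f. keys f \<subseteq> monomials n}"

definition monom :: "expo \<Rightarrow> 'k::field poly" where
  "monom c = single c 1"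

text \<open>Homogeneous parts, leading parts and projections to tie classes of a preorder all have
  this form; the predicate may depend on \<open>f\<close>.\<close>

definition restr :: "(expo \<Rightarrow> bool) \<Rightarrow> 'k::field poly \<Rightarrow> 'k poly" where
  "restr Q f = (\<Sum>a\<in>{a\<in>keys f. Q a}. single a (coef f a))"

lemma coef_restr: "coef (restr Q f) a = (if Q a then coef f a else 0)"
proof -
  have "coef (restr Q f) a = (\<Sum>b\<in>{b\<in>keys f. Q b}. coef f b when b = a)"
    unfolding restr_def by (simp add: lookup_sum lookup_single)
  also have "\<dots> = (\<Sum>b\<in>{b\<in>keys f. Q b}. if a = b then coef f b else 0)"
    by (rule sum.cong) (auto simp: when_def)
  also have "\<dots> = (if a \<in> {b\<in>keys f. Q b} then coef f a else 0)"
    by (rule sum.delta') auto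
  finally show ?thesis by (auto simp: in_keys_iff)
qed

lemma keys_restr: "keys (restr Q f) = {a\<in>keys f. Q a}"
  by (auto simp: in_keys_iff coef_restr split: if_splits)

lemma restr_add: "restr Q (f + g) = restr Q f + restr Q g"
  by (rule poly_mapping_eqI) (simp add: coef_restr lookup_add)

lemma restr_zero [simp]: "restr Q 0 = 0"
  by (rule poly_mapping_eqI) (simp add: coef_restr)

lemma restr_diff: "restr Q (f - g) = restr Q f - restr Q g"
  by (rule poly_mapping_eqI) (simp add: coef_restr lookup_minus)

lemma restr_uminus: "restr Q (- f) = - restr Q f"
  by (rule poly_mapping_eqI) (simp add: coef_restr)

lemma restr_sum: "restr Q (sum f A) = (\<Sum>x\<in>A. restr Q (f x))"
  by (induction A rule: infinite_finite_induct) (auto simp: restr_add)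

lemma restr_cong: "(\<And>a. a \<in> keys f \<Longrightarrow> Q a = Q' a) \<Longrightarrow> restr Q f = restr Q' f"
  by (rule poly_mapping_eqI) (auto simp: coef_restr in_keys_iff)

lemma restr_eq_self: "(\<And>a. a \<in> keys f \<Longrightarrow> Q a) \<Longrightarrow> restr Q f = f"
  by (rule poly_mapping_eqI) (auto simp: coef_restr in_keys_iff)

lemma restr_eq_zero: "(\<And>a. a \<in> keys f \<Longrightarrow> \<not> Q a) \<Longrightarrow> restr Q f = 0"
  by (rule poly_mapping_eqI) (auto simp: coef_restr in_keys_iff)

lemma restr_restr: "restr Q (restr Q' f) = restr (\<lambda>a. Q a \<and> Q' a) f"
  by (rule poly_mapping_eqI) (auto simp: coef_restr)

lemma homogeneous_part_eq: "homogeneous_part j f = restr (\<lambda>a. int (expo_deg a) = j) f"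
  by (simp add: homogeneous_part_def restr_def)

lemma leading_part_eq:
  "leading_part lt f = restr (\<lambda>a. \<not> (\<exists>b\<in>keys f. lt a b)) f"
  by (simp add: leading_part_def restr_def)

lemma coef_monom_mult_shift [simp]: "coef (monom c * f) (c + a) = coef f a"
  by (simp add: lookup_mult monom_def lookup_single when_mult)

lemma coef_monom_mult_nz:
  assumes "coef (monom c * f) b \<noteq> 0"
  shows "\<exists>a. b = c + a \<and> coef f a \<noteq> 0"
proof (rule ccontr)
  assume neg: "\<not> ?thesis"
  have "coef (monom c * f) b = (\<Sum>q. coef f q when b = c + q)"
    by (simp add: lookup_mult monom_def lookup_single when_mult)
  also have "(\<lambda>q. coef f q when b = c + q) = (\<lambda>_. 0)"
    using neg by (auto simp: when_def fun_eq_iff)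
  finally show False using assms by simp
qed

lemma keys_monom_mult: "keys (monom c * f) = (+) c ` keys f"
proof (intro Set.set_eqI iffI)
  fix b assume "b \<in> keys (monom c * f)"
  then show "b \<in> (+) c ` keys f"
    using coef_monom_mult_nz[of c f b] by (auto simp: in_keys_iff)
next
  fix b assume "b \<in> (+) c ` keys f"
  then show "b \<in> keys (monom c * f)"
    by (auto simp: in_keys_iff)
qed

lemma restr_monom_mult: "restr Q (monom c * f) = monom c * restr (\<lambda>a. Q (c + a)) f"
proof (rule poly_mapping_eqI)
  fix b
  show "coef (restr Q (monom c * f)) b = coef (monom c * restr (\<lambda>a. Q (c + a)) f) b"
  proof (cases "\<exists>a. b = c + a")
    case True
    then show ?thesis by (auto simp: coef_restr)
  next
    case False
    then have "coef (monom c * g) b = 0" for g :: "'a poly" using coef_monom_mult_nz by blast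
    then show ?thesis by (simp add: coef_restr)
  qed
qed

lemma monom_mult_cancel: "monom c * f = monom c * g \<longleftrightarrow> f = g"
  by (metis coef_monom_mult_shift poly_mapping_eqI)

lemma monom_add: "monom (a + b) = monom a * monom b"
  by (simp add: monom_def mult_single)

lemma monom_0 [simp]: "monom 0 = 1"
  by (simp add: monom_def)

lemma Var_power: "(Var i :: 'k::field poly) ^ m = monom (single i m)"
proof (induction m)
  case (Suc m)
  have "(Var i :: 'k poly) = monom (single i 1)" by (simp add: monom_def Var_def)
  then have "(Var i :: 'k poly) ^ Suc m = monom (single i 1) * monom (single i m)"
    by (metis power_Suc Suc)
  also have "\<dots> = monom (single i 1 + single i m)"
    by (rule monom_add[symmetric])
  also have "single i 1 + single i m = single i (Suc m)"
    by (simp flip: single_add)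
  finally show ?case .
qed simp

lemma Const_mult: "coef (Const c * f) a = c * coef f a"
  by (simp add: Const_def mult_map_scale_conv_mult[symmetric] map.rep_eq when_def)

lemma Const_0 [simp]: "Const 0 = 0" by (simp add: Const_def)
lemma Const_1 [simp]: "Const 1 = 1" by (simp add: Const_def)
lemma Const_times: "Const (a * b) = Const a * Const b" by (simp add: Const_def mult_single)

lemma keys_Const_mult: "keys (Const c * f) \<subseteq> keys f"
  by (auto simp: in_keys_iff Const_mult)

lemma restr_Const_mult: "restr Q (Const c * f) = Const c * restr Q f"
  by (rule poly_mapping_eqI) (simp add: coef_restr Const_mult)

lemma restr_sign: "restr Q ((-1) ^ m * f) = (-1) ^ m * restr Q f"
  by (cases "even m") (auto simp: restr_uminus)

lemma poly_eq_sum_monom: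
  "f = (\<Sum>a\<in>keys f. Const (coef f a) * monom a)"
proof -
  have "f = restr (\<lambda>_. True) f" by (simp add: restr_eq_self)
  then show ?thesis by (simp add: restr_def Const_def monom_def mult_single)
qed

section \<open>Monomials and degrees\<close>

lemma keys_add_nat: "keys (a + b :: 'a \<Rightarrow>\<^sub>0 nat) = keys a \<union> keys b"
  by (auto simp: in_keys_iff lookup_add)

lemma monomials_add_iff: "a + b \<in> monomials n \<longleftrightarrow> a \<in> monomials n \<and> b \<in> monomials n"
  by (simp add: monomials_def keys_add_nat)

lemma monomials_0 [simp]: "0 \<in> monomials n"
  by (simp add: monomials_def)

lemma single_in_monomials: "i \<in> {1..n} \<Longrightarrow> single i m \<in> monomials n"
  by (simp add: monomials_def)

lemma monomials_sum: "(\<And>x. x \<in> A \<Longrightarrow> f x \<in> monomials n) \<Longrightarrow> sum f A \<in> monomials n"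
  by (induction A rule: infinite_finite_induct) (auto simp: monomials_add_iff)

lemma expo_deg_superset: "finite A \<Longrightarrow> keys a \<subseteq> A \<Longrightarrow> expo_deg a = (\<Sum>i\<in>A. coef a i)"
  unfolding expo_deg_def by (rule sum.mono_neutral_left) (auto simp: in_keys_iff)

lemma expo_deg_add: "expo_deg (a + b) = expo_deg a + expo_deg b"
proof -
  let ?A = "keys a \<union> keys b"
  have "expo_deg (a + b) = (\<Sum>i\<in>?A. coef (a + b) i)"
    by (rule expo_deg_superset) (auto simp: keys_add_nat)
  moreover have "expo_deg a = (\<Sum>i\<in>?A. coef a i)" "expo_deg b = (\<Sum>i\<in>?A. coef b i)"
    by (auto intro: expo_deg_superset)
  ultimately show ?thesis by (simp add: lookup_add sum.distrib)
qed

lemma expo_deg_0 [simp]: "expo_deg 0 = 0" by (simp add: expo_deg_def)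

lemma expo_deg_single [simp]: "expo_deg (single i m) = m"
  by (cases "m = 0") (auto simp: expo_deg_def)

lemma expo_deg_sum: "expo_deg (sum f A) = (\<Sum>x\<in>A. expo_deg (f x))"
  by (induction A rule: infinite_finite_induct) (auto simp: expo_deg_add)

text \<open>Exponent vectors of bounded degree embed into a finite box. This makes every Koszul
  space of fixed degree finite-dimensional.\<close>

lemma finite_monomials_deg: "finite {a \<in> monomials n. expo_deg a \<le> e}"
proof -
  let ?A = "{a \<in> monomials n. expo_deg a \<le> e}"
  have "inj_on (\<lambda>a. restrict (coef a) {1..n}) ?A"
  proof (rule inj_onI)
    fix a b assume *: "a \<in> ?A" "b \<in> ?A" "restrict (coef a) {1..n} = restrict (coef b) {1..n}"
    show "a = b"
    proof (rule poly_mapping_eqI)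
      fix i
      show "coef a i = coef b i"
      proof (cases "i \<in> {1..n}")
        case True
        then show ?thesis using *(3) by (metis restrict_apply')
      next
        case False
        then have "i \<notin> keys a" "i \<notin> keys b"
          using *(1,2) by (auto simp: monomials_def)
        then show ?thesis by (simp add: in_keys_iff)
      qed
    qed
  qed
  moreover have "(\<lambda>a. restrict (coef a) {1..n}) ` ?A \<subseteq> (\<Pi>\<^sub>E i\<in>{1..n}. {0..e})"
  proof clarify
    fix a assume a: "a \<in> monomials n" "expo_deg a \<le> e"
    have "coef a i \<le> e" if "i \<in> {1..n}" for i
    proof -
      have "coef a i \<le> (\<Sum>i\<in>{1..n}. coef a i)" using that by (intro member_le_sum) auto
      also have "\<dots> = expo_deg a" using a by (intro expo_deg_superset[symmetric]) (auto simp: monomials_def)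
      finally show ?thesis using a by simp
    qed
    then show "restrict (coef a) {1..n} \<in> (\<Pi>\<^sub>E i\<in>{1..n}. {0..e})" by auto
  qed
  ultimately show ?thesis
    by (meson finite_PiE finite_atLeastAtMost finite_imageD finite_subset)
qed

section \<open>Polynomials in \<open>n\<close> variables\<close>

lemma polys_0 [simp]: "0 \<in> polys n" and polys_1 [simp]: "1 \<in> polys n"
  by (auto simp: polys_def)

lemma polys_add: "f \<in> polys n \<Longrightarrow> g \<in> polys n \<Longrightarrow> f + g \<in> polys n"
  using keys_add[of f g] by (auto simp: polys_def)

lemma polys_uminus: "f \<in> polys n \<Longrightarrow> - f \<in> polys n"
  by (auto simp: polys_def)

lemma polys_diff: "f \<in> polys n \<Longrightarrow> g \<in> polys n \<Longrightarrow> f - g \<in> polys n"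
  using polys_add[of f n "- g"] polys_uminus[of g n] by simp

lemma polys_mult: "f \<in> polys n \<Longrightarrow> g \<in> polys n \<Longrightarrow> f * g \<in> polys n"
  using keys_mult[of f g] by (fastforce simp: polys_def monomials_add_iff)

lemma polys_power: "f \<in> polys n \<Longrightarrow> f ^ m \<in> polys n"
  by (induction m) (auto simp: polys_mult)

lemma polys_prod: "(\<And>x. x \<in> A \<Longrightarrow> f x \<in> polys n) \<Longrightarrow> prod f A \<in> polys n"
  by (induction A rule: infinite_finite_induct) (auto simp: polys_mult)

lemma polys_sum: "(\<And>x. x \<in> A \<Longrightarrow> f x \<in> polys n) \<Longrightarrow> sum f A \<in> polys n"
  by (induction A rule: infinite_finite_induct) (auto simp: polys_add)

lemma polys_monom: "c \<in> monomials n \<Longrightarrow> monom c \<in> polys n"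
  by (simp add: polys_def monom_def)

lemma polys_Const: "Const c \<in> polys n"
  by (cases "c = 0") (auto simp: polys_def Const_def)

lemma polys_restr: "f \<in> polys n \<Longrightarrow> restr Q f \<in> polys n"
  by (auto simp: polys_def keys_restr)

lemma polys_Var: "i \<in> {1..n} \<Longrightarrow> Var i \<in> polys n"
  using polys_monom[OF single_in_monomials, of i n 1] by (simp flip: Var_power)

lemma hom_iff:
  "f \<in> homogeneous_polys n d \<longleftrightarrow> f \<in> polys n \<and> (\<forall>a\<in>keys f. int (expo_deg a) = d)"
  by (auto simp: homogeneous_polys_def polys_def)

lemma hom_0 [simp]: "0 \<in> homogeneous_polys n d"
  by (simp add: hom_iff)

lemma hom_add:
  "f \<in> homogeneous_polys n d \<Longrightarrow> g \<in> homogeneous_polys n d \<Longrightarrow> f + g \<in> homogeneous_polys n d"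
  using keys_add[of f g] by (auto simp: hom_iff polys_add)

lemma hom_uminus:
  "f \<in> homogeneous_polys n d \<Longrightarrow> - f \<in> homogeneous_polys n d"
  by (auto simp: hom_iff polys_uminus)

lemma hom_diff:
  "f \<in> homogeneous_polys n d \<Longrightarrow> g \<in> homogeneous_polys n d \<Longrightarrow> f - g \<in> homogeneous_polys n d"
  using hom_add[of f n d "- g"] hom_uminus[of g n d] by simp

lemma hom_sum:
  "(\<And>x. x \<in> A \<Longrightarrow> f x \<in> homogeneous_polys n d) \<Longrightarrow> sum f A \<in> homogeneous_polys n d"
  by (induction A rule: infinite_finite_induct) (auto simp: hom_add)

lemma hom_Const:
  "f \<in> homogeneous_polys n d \<Longrightarrow> Const c * f \<in> homogeneous_polys n d"
  using keys_Const_mult[of c f] by (auto simp: hom_iff polys_mult polys_Const)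

lemma hom_sign:
  "f \<in> homogeneous_polys n d \<Longrightarrow> (-1) ^ m * f \<in> homogeneous_polys n d"
  by (cases "even m") (auto simp: hom_uminus)

lemma hom_monom_mult:
  "f \<in> homogeneous_polys n d \<Longrightarrow> c \<in> monomials n \<Longrightarrow> e = d + int (expo_deg c) \<Longrightarrow>
    monom c * f \<in> homogeneous_polys n e"
  by (auto simp: hom_iff polys_mult polys_monom keys_monom_mult expo_deg_add)

lemma hom_restr:
  "f \<in> homogeneous_polys n d \<Longrightarrow> restr Q f \<in> homogeneous_polys n d"
  by (auto simp: hom_iff polys_restr keys_restr)

lemma homogeneous_part_in:
  "f \<in> polys n \<Longrightarrow> homogeneous_part d f \<in> homogeneous_polys n d"
  by (auto simp: homogeneous_part_eq hom_iff polys_restr keys_restr)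

lemma homogeneous_part_homogeneous:
  "f \<in> homogeneous_polys n d \<Longrightarrow> homogeneous_part e f = (if e = d then f else 0)"
  by (auto simp: homogeneous_part_eq hom_iff intro: restr_eq_self restr_eq_zero)

lemma sum_homogeneous_parts:
  "f = (\<Sum>d\<in>(\<lambda>a. int (expo_deg a)) ` keys f. homogeneous_part d f)"
proof (rule poly_mapping_eqI)
  fix a
  let ?D = "(\<lambda>a. int (expo_deg a)) ` keys f"
  have "coef (\<Sum>d\<in>?D. homogeneous_part d f) a = (\<Sum>d\<in>?D. if int (expo_deg a) = d then coef f a else 0)"
    by (simp add: lookup_sum homogeneous_part_eq coef_restr)
  also have "\<dots> = (if int (expo_deg a) \<in> ?D then coef f a else 0)"
    by (rule sum.delta') simp
  also have "\<dots> = coef f a" by (auto simp: in_keys_iff)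
  finally show "coef f a = coef (\<Sum>d\<in>?D. homogeneous_part d f) a" by simp
qed

section \<open>Homogeneous ideals\<close>

lemma poly_ring_simps [simp]:
  "carrier (poly_ring n) = polys n" "mult (poly_ring n) = (*)" "one (poly_ring n) = 1"
  "zero (poly_ring n) = 0" "add (poly_ring n) = (+)" "smult (poly_ring n) = (*)"
  "component (poly_ring n) = homogeneous_polys n"
  by (simp_all add: poly_ring_def polys_def)

lemma poly_ring_cring: "cring (poly_ring n :: ('k::field poly, 'k poly) graded_module)"
proof (rule cringI)
  show "abelian_group (poly_ring n :: ('k poly, 'k poly) graded_module)"
  proof (rule abelian_groupI)
    fix x :: "'k poly" assume "x \<in> carrier (poly_ring n)"
    then show "\<exists>y\<in>carrier (poly_ring n). y \<oplus>\<^bsub>poly_ring n\<^esub> x = \<zero>\<^bsub>poly_ring n\<^esub>"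
      by (intro bexI[of _ "- x"]) (auto simp: polys_uminus)
  qed (auto simp: polys_add)
  show "comm_monoid (poly_ring n :: ('k poly, 'k poly) graded_module)"
    by (rule comm_monoidI) (auto simp: polys_mult mult.assoc mult.commute)
qed (auto simp: distrib_right)

locale homog_ideal =
  fixes n :: nat and I :: "'k::field poly set"
  assumes hom_ideal: "homogeneous_ideal n I"
begin

sublocale ideal I "poly_ring n"
  using hom_ideal by (simp add: homogeneous_ideal_def)

lemma in_polys: "f \<in> I \<Longrightarrow> f \<in> polys n"
  using a_subset by auto

lemma zero_in [simp]: "0 \<in> I"
  using additive_subgroup.zero_closed[OF is_additive_subgroup] by simp

lemma add_in: "f \<in> I \<Longrightarrow> g \<in> I \<Longrightarrow> f + g \<in> I"
  using additive_subgroup.a_closed[OF is_additive_subgroup, of f g] by simp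

lemma mult_in: "r \<in> polys n \<Longrightarrow> f \<in> I \<Longrightarrow> r * f \<in> I"
  using I_l_closed[of f r] by simp

lemma uminus_in: "f \<in> I \<Longrightarrow> - f \<in> I"
  using mult_in[of "-1" f] polys_uminus[OF polys_1, of n] by simp

lemma diff_in: "f \<in> I \<Longrightarrow> g \<in> I \<Longrightarrow> f - g \<in> I"
  using add_in[of f "- g"] uminus_in by simp

lemma sum_in: "(\<And>x. x \<in> A \<Longrightarrow> f x \<in> I) \<Longrightarrow> sum f A \<in> I"
  by (induction A rule: infinite_finite_induct) (auto simp: add_in)

lemma sign_in: "f \<in> I \<Longrightarrow> (-1) ^ m * f \<in> I"
  by (cases "even m") (auto simp: uminus_in)

lemma Const_in: "f \<in> I \<Longrightarrow> Const c * f \<in> I"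
  by (simp add: mult_in polys_Const)

lemma monom_in: "c \<in> monomials n \<Longrightarrow> f \<in> I \<Longrightarrow> monom c * f \<in> I"
  by (simp add: mult_in polys_monom)

lemma part_in: "f \<in> I \<Longrightarrow> homogeneous_part d f \<in> I"
  using hom_ideal by (simp add: homogeneous_ideal_def)

end

lemma homogeneous_idealI:
  fixes I :: "'k::field poly set"
  assumes "I \<subseteq> polys n" "0 \<in> I" "\<And>f g. f \<in> I \<Longrightarrow> g \<in> I \<Longrightarrow> f + g \<in> I"
    and "\<And>r f. r \<in> polys n \<Longrightarrow> f \<in> I \<Longrightarrow> r * f \<in> I"
    and "\<And>f d. f \<in> I \<Longrightarrow> homogeneous_part d f \<in> I"
  shows "homogeneous_ideal n I"
proof -
  interpret R: cring "poly_ring n :: ('k poly, 'k poly) graded_module" by (rule poly_ring_cring)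
  have inv: "- f \<in> I" if "f \<in> I" for f
    using assms(4)[of "-1" f] that polys_uminus[OF polys_1, of n] by simp
  have ainv: "inv\<^bsub>add_monoid (poly_ring n)\<^esub> f = - f" if "f \<in> polys n" for f :: "'k poly"
    using R.minus_equality[of "-f" f] that polys_uminus[of f n] by (simp add: a_inv_def)
  have "subgroup I (add_monoid (poly_ring n))"
  proof (rule subgroup.intro)
    fix f assume "f \<in> I"
    then have "f \<in> polys n" using assms(1) by blast
    then show "inv\<^bsub>add_monoid (poly_ring n)\<^esub> f \<in> I" using inv[OF \<open>f \<in> I\<close>] by (simp only: ainv)
  next
    show "I \<subseteq> carrier (add_monoid (poly_ring n))" using assms(1) by simp
  next
    fix f g assume "f \<in> I" "g \<in> I"
    then show "f \<otimes>\<^bsub>add_monoid (poly_ring n)\<^esub> g \<in> I" using assms(3) by simp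
  next
    show "\<one>\<^bsub>add_monoid (poly_ring n)\<^esub> \<in> I" using assms(2) by simp
  qed
  then have "ideal I (poly_ring n)"
  proof (intro idealI)
    fix f r :: "'k poly" assume "f \<in> I" "r \<in> carrier (poly_ring n)"
    then show "r \<otimes>\<^bsub>poly_ring n\<^esub> f \<in> I" "f \<otimes>\<^bsub>poly_ring n\<^esub> r \<in> I"
      using assms(4)[of r f] by (simp_all add: mult.commute)
  qed (rule R.ring_axioms)
  then show ?thesis using assms(5) by (simp add: homogeneous_ideal_def)
qed

section \<open>Leading exponents of subspaces\<close>

definition fun_subspace :: "('x \<Rightarrow> 'k::field) set \<Rightarrow> bool" where
  "fun_subspace W \<longleftrightarrow> (\<lambda>_. 0) \<in> W \<and> (\<forall>f\<in>W. \<forall>g\<in>W. \<forall>c. (\<lambda>x. f x + c * g x) \<in> W)"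

definition lead_of :: "('x \<Rightarrow> nat) \<Rightarrow> ('x \<Rightarrow> 'k::field) \<Rightarrow> 'x \<Rightarrow> bool" where
  "lead_of r f x \<longleftrightarrow> f x \<noteq> 0 \<and> (\<forall>y. f y \<noteq> 0 \<longrightarrow> r y \<le> r x)"

text \<open>For a subspace \<open>W\<close>, the set \<open>leads r W\<close> has \<open>dim W\<close> elements; it takes the place of a basis of \<open>W\<close>.\<close>

definition leads :: "('x \<Rightarrow> nat) \<Rightarrow> ('x \<Rightarrow> 'k::field) set \<Rightarrow> 'x set" where
  "leads r W = {x. \<exists>f\<in>W. lead_of r f x}"

text \<open>Linear independence in the quotient by the subspace \<open>B\<close>, without forming
  the quotient. The family is indexed, so a repeated vector makes it dependent.\<close>

definition indep_mod :: "('x \<Rightarrow> 'k::field) set \<Rightarrow> 'i set \<Rightarrow> ('i \<Rightarrow> 'x \<Rightarrow> 'k) \<Rightarrow> bool" where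
  "indep_mod B A z \<longleftrightarrow> (\<forall>c. (\<lambda>x. \<Sum>v\<in>A. c v * z v x) \<in> B \<longrightarrow> (\<forall>v\<in>A. c v = 0))"

lemma fun_subspace_diff:
  assumes "fun_subspace W" "f \<in> W" "g \<in> W"
  shows "(\<lambda>x. f x - c * g x) \<in> W"
proof -
  have "(\<lambda>x. f x + (- c) * g x) \<in> W" using assms unfolding fun_subspace_def by blast
  then show ?thesis by simp
qed

lemma exists_lead_of:
  assumes "finite X" "\<And>x. f x \<noteq> 0 \<Longrightarrow> x \<in> X" "f \<noteq> (\<lambda>_. 0)"
  obtains x where "lead_of r f x"
proof -
  let ?S = "{x. f x \<noteq> 0}"
  have fin: "finite ?S" by (rule finite_subset[OF _ assms(1)]) (use assms(2) in auto)
  have ne: "?S \<noteq> {}" using assms(3) by auto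
  have "Max (r ` ?S) \<in> r ` ?S" using fin ne by (intro Max_in) auto
  then obtain x where x: "x \<in> ?S" "r x = Max (r ` ?S)" by auto
  have "r y \<le> r x" if "f y \<noteq> 0" for y
    unfolding x(2) using fin that by (intro Max_ge) auto
  then show ?thesis using that[of x] x(1) by (simp add: lead_of_def)
qed

locale leading_exponents =
  fixes X :: "'x set" and r :: "'x \<Rightarrow> nat"
  assumes fin: "finite X" and inj: "inj_on r X"
begin

lemma leads_mono: "B \<subseteq> Z \<Longrightarrow> leads r B \<subseteq> leads r Z"
  by (auto simp: leads_def)

lemma leads_subset: "(\<And>f x. f \<in> Z \<Longrightarrow> f x \<noteq> 0 \<Longrightarrow> x \<in> X) \<Longrightarrow> leads r Z \<subseteq> X"
  by (auto simp: leads_def lead_of_def)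

text \<open>Gaussian elimination: \<open>B\<close> has a vector with the same leading coordinate as
  \<open>f\<close>, and subtracting a multiple of it lowers the leading rank of \<open>f\<close>
  until nothing is left.\<close>

lemma leads_eq_imp_eq:
  fixes B Z :: "('x \<Rightarrow> 'k::field) set"
  assumes B: "fun_subspace B" and Z: "fun_subspace Z" and BZ: "B \<subseteq> Z" and eq: "leads r Z \<subseteq> leads r B"
    and supp: "\<And>f x. f \<in> Z \<Longrightarrow> f x \<noteq> 0 \<Longrightarrow> x \<in> X"
  shows "B = Z"
proof -
  \<comment> \<open>The successor separates the zero vector from vectors whose leading coordinate
    has rank 0.\<close>
  define height :: "('x \<Rightarrow> 'k) \<Rightarrow> nat" where
    "height f = (if f = (\<lambda>_. 0) then 0 else Suc (Max (r ` {x. f x \<noteq> 0})))" for f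
  have finf: "finite {y. f y \<noteq> 0}" if "f \<in> Z" for f
    by (rule finite_subset[OF _ fin]) (use supp[OF that] in auto)
  have "f \<in> B" if "f \<in> Z" for f
    using that
  proof (induction "height f" arbitrary: f rule: less_induct)
    case less
    show ?case
    proof (cases "f = (\<lambda>_. 0)")
      case True
      then show ?thesis using B by (auto simp: fun_subspace_def)
    next
      case False
      obtain x where x: "lead_of r f x"
        by (rule exists_lead_of[of X f r]) (use fin supp[OF less.prems] False in auto)
      have "x \<in> leads r B" using x less.prems eq by (auto simp: leads_def)
      then obtain g where g: "g \<in> B" "lead_of r g x" by (auto simp: leads_def)
      define c where "c = f x / g x"
      define h where "h = (\<lambda>y. f y - c * g y)"
      have hx: "h x = 0" using g(2) by (simp add: h_def c_def lead_of_def)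
      have hZ: "h \<in> Z" unfolding h_def by (rule fun_subspace_diff[OF Z less.prems]) (use g BZ in auto)
      have maxf: "Max (r ` {y. f y \<noteq> 0}) = r x"
        using x finf[OF less.prems] by (intro Max_eqI) (auto simp: lead_of_def)
      have lt: "r y < r x" if "h y \<noteq> 0" for y
      proof -
        have "f y \<noteq> 0 \<or> g y \<noteq> 0" using that by (auto simp: h_def)
        then have "r y \<le> r x" using x g(2) by (auto simp: lead_of_def)
        \<comment> \<open>Injectivity of \<open>r\<close> makes the descent strict: \<open>x\<close>
          is the only coordinate of its rank, and \<open>h\<close> vanishes there.\<close>
        moreover have "r y \<noteq> r x"
        proof
          assume "r y = r x"
          moreover have "y \<in> X" "x \<in> X" using supp[OF hZ that] supp[OF less.prems] x by (auto simp: lead_of_def)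
          ultimately have "y = x" using inj by (auto dest: inj_onD)
          then show False using hx that by simp
        qed
        ultimately show ?thesis by simp
      qed
      have "height h < height f"
      proof (cases "h = (\<lambda>_. 0)")
        case True
        then show ?thesis using False by (simp add: height_def)
      next
        case h: False
        then have "{x. h x \<noteq> 0} \<noteq> {}" by auto
        then have "Max (r ` {x. h x \<noteq> 0}) < r x"
          using finf[OF hZ] lt by (subst Max_less_iff) auto
        then show ?thesis using False h maxf by (simp add: height_def)
      qed
      then have "h \<in> B" using hZ by (rule less.hyps)
      from fun_subspace_diff[OF B this g(1), of "- c"] show ?thesis by (simp add: h_def)
    qed
  qed
  then show ?thesis using BZ by auto
qed

text \<open>The vectors are adjoined to \<open>B\<close> one at a time. Each one properly enlarges
  the subspace, hence by \<open>leads_eq_imp_eq\<close> its set of leading coordinates.\<close>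

lemma indep_mod_card_le:
  fixes B Z :: "('x \<Rightarrow> 'k::field) set" and z :: "'i \<Rightarrow> 'x \<Rightarrow> 'k"
  assumes Z: "fun_subspace Z" and supp: "\<And>f x. f \<in> Z \<Longrightarrow> f x \<noteq> 0 \<Longrightarrow> x \<in> X"
    and "finite A" and "fun_subspace B" and "B \<subseteq> Z" and "\<And>v. v \<in> A \<Longrightarrow> z v \<in> Z" and "indep_mod B A z"
  shows "card A + card (leads r B) \<le> card (leads r Z)"
  using assms(3-)
proof (induction A arbitrary: B rule: finite_induct)
  case empty
  have "leads r Z \<subseteq> X" by (rule leads_subset) (rule supp)
  then have "finite (leads r Z)" using fin finite_subset by blast
  then show ?case using leads_mono[OF empty(2)] by (simp add: card_mono)
next
  case (insert v A)
  note B = insert.prems(1)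
  define B' where "B' = {f. \<exists>b\<in>B. \<exists>c. f = (\<lambda>x. b x + c * z v x)}"
  have sub': "fun_subspace B'"
    unfolding fun_subspace_def
  proof (intro conjI ballI allI)
    show "(\<lambda>_. 0) \<in> B'" unfolding B'_def using B
      by (auto simp: fun_subspace_def intro!: bexI[of _ "\<lambda>_. 0"] exI[of _ 0])
  next
    fix f g c assume "f \<in> B'" "g \<in> B'"
    then obtain b1 c1 b2 c2 where *: "b1 \<in> B" "f = (\<lambda>x. b1 x + c1 * z v x)" "b2 \<in> B" "g = (\<lambda>x. b2 x + c2 * z v x)"
      by (auto simp: B'_def)
    then have "(\<lambda>x. b1 x + c * b2 x) \<in> B" using B by (auto simp: fun_subspace_def)
    moreover have "(\<lambda>x. f x + c * g x) = (\<lambda>x. (b1 x + c * b2 x) + (c1 + c * c2) * z v x)"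
      using * by (auto simp: algebra_simps)
    ultimately show "(\<lambda>x. f x + c * g x) \<in> B'"
      unfolding B'_def mem_Collect_eq by (intro bexI exI)
  qed
  have BB': "B \<subseteq> B'"
  proof
    fix f assume "f \<in> B"
    then show "f \<in> B'" unfolding B'_def by (auto intro!: bexI[of _ f] exI[of _ 0])
  qed
  have B'Z: "B' \<subseteq> Z"
  proof
    fix f assume "f \<in> B'"
    then obtain b c where "b \<in> B" "f = (\<lambda>x. b x + c * z v x)" by (auto simp: B'_def)
    then show "f \<in> Z" using Z insert.prems by (auto simp: fun_subspace_def)
  qed
  have ind': "indep_mod B' A z"
    unfolding indep_mod_def
  proof (intro allI impI)
    fix c assume "(\<lambda>x. \<Sum>v\<in>A. c v * z v x) \<in> B'"
    then obtain b e where b: "b \<in> B" "(\<lambda>x. \<Sum>v\<in>A. c v * z v x) = (\<lambda>x. b x + e * z v x)" by (auto simp: B'_def)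
    \<comment> \<open>A relation modulo \<open>B'\<close> becomes a relation modulo \<open>B\<close>
      by moving the multiple of \<open>z v\<close> to the other side.\<close>
    have "(\<lambda>x. \<Sum>w\<in>insert v A. (c(v := - e)) w * z w x) = b"
    proof
      fix x
      have "(\<Sum>w\<in>A. (c(v := - e)) w * z w x) = (\<Sum>w\<in>A. c w * z w x)"
        using insert.hyps by (intro sum.cong) auto
      also have "\<dots> = b x + e * z v x" using fun_cong[OF b(2), of x] by simp
      finally show "(\<Sum>w\<in>insert v A. (c(v := - e)) w * z w x) = b x"
        using insert.hyps by simp
    qed
    then have "\<forall>w\<in>insert v A. (c(v := - e)) w = 0"
      using insert.prems(4) b(1) unfolding indep_mod_def by blast
    then show "\<forall>v\<in>A. c v = 0" using insert.hyps by (metis fun_upd_other insertI2)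
  qed
  have zB: "z v \<notin> B"
  proof
    assume "z v \<in> B"
    moreover have "(\<Sum>w\<in>insert v A. (if w = v then 1 else 0) * z w x) = z v x" for x
    proof -
      have "(\<Sum>w\<in>A. (if w = v then 1 else 0) * z w x) = 0"
        using insert.hyps by (intro sum.neutral) auto
      then show ?thesis using insert.hyps by simp
    qed
    ultimately have "(\<lambda>x. \<Sum>w\<in>insert v A. (if w = v then 1 else 0) * z w x) \<in> B" by simp
    then have "\<forall>w\<in>insert v A. (if w = v then 1 else 0::'k) = 0"
      using insert.prems(4)[unfolded indep_mod_def, THEN spec[of _ "\<lambda>w. if w = v then 1 else 0"]] by blast
    then show False by auto
  qed
  have zB': "z v \<in> B'"
    unfolding B'_def using B by (auto simp: fun_subspace_def intro!: bexI[of _ "\<lambda>_. 0"] exI[of _ 1])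
  have "\<not> leads r B' \<subseteq> leads r B"
  proof
    assume "leads r B' \<subseteq> leads r B"
    then have "B = B'" by (rule leads_eq_imp_eq[OF B sub' BB']) (use supp B'Z in blast)
    then show False using zB zB' by simp
  qed
  then have "leads r B \<subset> leads r B'" using leads_mono[OF BB'] by auto
  moreover have "leads r B' \<subseteq> X" by (rule leads_subset) (use supp B'Z in blast)
  then have "finite (leads r B')" using fin finite_subset by blast
  ultimately have "card (leads r B) < card (leads r B')" by (simp add: psubset_card_mono)
  moreover have "card A + card (leads r B') \<le> card (leads r Z)"
    using insert.IH[OF sub' B'Z _ ind'] insert.prems(3) by blast
  ultimately show ?case using insert.hyps by simp
qed

text \<open>One vector of \<open>Z\<close> is chosen for each leading coordinate that
  \<open>B\<close> does not have. A nontrivial combination of these has its leading coordinate among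
  the chosen ones, so it cannot lie in \<open>B\<close>.\<close>

lemma indep_mod_exists:
  fixes B Z :: "('x \<Rightarrow> 'k::field) set"
  assumes supp: "\<And>f x. f \<in> Z \<Longrightarrow> f x \<noteq> 0 \<Longrightarrow> x \<in> X" and BZ: "B \<subseteq> Z"
    and m: "m + card (leads r B) \<le> card (leads r Z)"
  shows "\<exists>(A :: 'x set) z. finite A \<and> card A = m \<and> (\<forall>v\<in>A. z v \<in> Z) \<and> indep_mod B A z"
proof -
  have ZX: "leads r Z \<subseteq> X" by (rule leads_subset) (rule supp)
  then have finZ: "finite (leads r Z)" using fin finite_subset by blast
  have finB: "finite (leads r B)" using leads_mono[OF BZ] finZ finite_subset by blast
  have "m \<le> card (leads r Z - leads r B)"
    using m leads_mono[OF BZ] finB by (simp add: card_Diff_subset)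
  then obtain A where A: "A \<subseteq> leads r Z - leads r B" "card A = m" "finite A"
    by (meson obtain_subset_with_card_n)
  have "\<exists>f. f \<in> Z \<and> lead_of r f v" if "v \<in> A" for v using A that by (auto simp: leads_def)
  then obtain z where z: "\<And>v. v \<in> A \<Longrightarrow> z v \<in> Z \<and> lead_of r (z v) v" by metis
  have AX: "A \<subseteq> X" using A ZX by blast
  have "indep_mod B A z"
    unfolding indep_mod_def
  proof (intro allI impI)
    fix c let ?f = "\<lambda>x. \<Sum>v\<in>A. c v * z v x"
    assume f: "?f \<in> B"
    show "\<forall>v\<in>A. c v = 0"
    proof (rule ccontr)
      assume "\<not> (\<forall>v\<in>A. c v = 0)"
      then have ne: "{v\<in>A. c v \<noteq> 0} \<noteq> {}" by auto
      have fin': "finite {v\<in>A. c v \<noteq> 0}" using A by auto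
      have "Max (r ` {v\<in>A. c v \<noteq> 0}) \<in> r ` {v\<in>A. c v \<noteq> 0}" using fin' ne by (intro Max_in) auto
      then obtain v where v: "v \<in> A" "c v \<noteq> 0" "r v = Max (r ` {v\<in>A. c v \<noteq> 0})" by auto
      have mx: "r w \<le> r v" if "w \<in> A" "c w \<noteq> 0" for w
        unfolding v(3) using fin' that by (intro Max_ge) auto
      \<comment> \<open>Another vector that is nonzero at \<open>v\<close> leads with rank at least
        that of \<open>v\<close>, while \<open>v\<close> has the largest rank in the combination; so
        there is no cancellation at \<open>v\<close>.\<close>
      have z0: "c w * z w v = 0" if "w \<in> A - {v}" for w
      proof (rule ccontr)
        assume "c w * z w v \<noteq> 0"
        then have "r v \<le> r w" "r w \<le> r v" using z[of w] mx[of w] that by (auto simp: lead_of_def)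
        then have "v = w" using inj AX v(1) that by (auto dest: inj_onD)
        then show False using that by simp
      qed
      have "(\<Sum>w\<in>A - {v}. c w * z w v) = 0" using z0 by (rule sum.neutral[OF ballI])
      then have "(\<Sum>w\<in>A. c w * z w v) = c v * z v v"
        using v(1) A(3) by (simp add: sum.remove[of A v])
      then have "?f v \<noteq> 0" using v z[of v] by (auto simp: lead_of_def)
      moreover have "r y \<le> r v" if y: "?f y \<noteq> 0" for y
      proof -
        obtain w where "w \<in> A" "c w * z w y \<noteq> 0" using y by (meson sum.not_neutral_contains_not_neutral)
        then show ?thesis using z[of w] mx[of w] by (auto simp: lead_of_def intro: order_trans)
      qed
      ultimately have "lead_of r ?f v" by (auto simp: lead_of_def)
      then have "v \<in> leads r B" using f unfolding leads_def by blast
      then show False using A v by auto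
    qed
  qed
  then show ?thesis using A z by blast
qed

end

text \<open>A maximal element is removed and later receives a rank above all others.\<close>

lemma linear_extension_rank:
  assumes "finite X" "irreflp_on X R" "transp_on X R"
  obtains r :: "'x \<Rightarrow> nat" where "inj_on r X" "\<And>x y. x \<in> X \<Longrightarrow> y \<in> X \<Longrightarrow> R x y \<Longrightarrow> r x < r y"
proof -
  have "\<exists>r :: 'x \<Rightarrow> nat. inj_on r X \<and> (\<forall>x\<in>X. \<forall>y\<in>X. R x y \<longrightarrow> r x < r y)"
    using assms
  proof (induction "card X" arbitrary: X)
    case 0
    then show ?case by auto
  next
    case (Suc k)
    \<comment> \<open>The relation is reversed, so that a minimal element for \<open>?R\<close> is a
      maximal one for \<open>R\<close>.\<close>
    let ?R = "{(x, y). x \<in> X \<and> y \<in> X \<and> R y x}"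
    have "wf ?R"
    proof (rule finite_acyclic_wf)
      show "finite ?R" by (rule finite_subset[of _ "X \<times> X"]) (use Suc.prems in auto)
      have "trans ?R" using Suc.prems(3) by (auto simp: trans_def transp_on_def)
      then show "acyclic ?R" using Suc.prems(2) by (auto simp: acyclic_irrefl irrefl_def irreflp_on_def)
    qed
    moreover obtain x0 where "x0 \<in> X" using Suc.hyps(2) by fastforce
    ultimately obtain x where x: "x \<in> X" "\<And>y. (y, x) \<in> ?R \<Longrightarrow> y \<notin> X"
      by (rule wfE_min) blast
    have "k = card (X - {x})" using Suc.hyps(2) Suc.prems(1) x(1) by simp
    moreover have "irreflp_on (X - {x}) R" "transp_on (X - {x}) R" "finite (X - {x})"
      using Suc.prems by (auto intro: irreflp_on_subset transp_on_subset)
    ultimately obtain r :: "'x \<Rightarrow> nat" where r: "inj_on r (X - {x})"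
        "\<forall>y\<in>X-{x}. \<forall>z\<in>X-{x}. R y z \<longrightarrow> r y < r z"
      using Suc.hyps(1)[of "X - {x}"] by auto
    define M where "M = Suc (Max (insert 0 (r ` (X - {x}))))"
    have M: "r y < M" if "y \<in> X - {x}" for y
      unfolding M_def less_Suc_eq_le using Suc.prems that by (intro Max_ge) auto
    have "inj_on (r(x := M)) X"
    proof (rule inj_onI)
      fix y z assume *: "y \<in> X" "z \<in> X" "(r(x := M)) y = (r(x := M)) z"
      show "y = z"
      proof (cases "y = x \<or> z = x")
        case True
        have "r y \<noteq> M \<or> y = x" "r z \<noteq> M \<or> z = x"
          using M[of y] M[of z] *(1,2) by auto
        with True show ?thesis using *(3) by (auto split: if_splits)
      next
        case False
        then show ?thesis using * inj_onD[OF r(1), of y z] by simp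
      qed
    qed
    moreover have "(r(x := M)) y < (r(x := M)) z" if "y \<in> X" "z \<in> X" "R y z" for y z
    proof -
      have "(z, x) \<in> ?R \<Longrightarrow> False" if "z \<in> X" for z using x(2)[of z] that by blast
      then have "y \<noteq> x" using that x(1) by blast
      then show ?thesis using r(2) M that by (cases "z = x") auto
    qed
    ultimately show ?case by blast
  qed
  then show ?thesis using that by blast
qed

section \<open>Koszul complexes modulo an ideal\<close>

type_synonym 'k cochain = "nat set \<Rightarrow> 'k poly"

text \<open>The exponent vector of the denominator at position \<open>S\<close>.\<close>

definition twist :: "(nat \<Rightarrow> nat) \<Rightarrow> nat set \<Rightarrow> expo" where
  "twist t S = (\<Sum>i\<in>S. single i (t i))"

text \<open>Neither homogeneous nor confined to one cohomological degree: preimages of Cech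
  coboundaries come without any control of the internal degree.\<close>

definition cochains :: "nat \<Rightarrow> 'k::field cochain set" where
  "cochains n = {F. \<forall>S. F S \<in> polys n \<and> (F S \<noteq> 0 \<longrightarrow> S \<subseteq> {1..n})}"

text \<open>
  The degree \<open>d\<close> part of the \<open>p\<close>-th term of the Koszul complex on \<open>x\<^sub>1\<^bsup>t 1\<^esup>, \<dots>, x\<^sub>n\<^bsup>t n\<^esup>\<close>, graded such
  that \<open>F S\<close> represents the fraction with denominator \<open>\<Prod>\<^sub>i\<^sub>\<in>\<^sub>S x\<^sub>i\<^bsup>t i\<^esup>\<close>. The index \<open>p\<close> is an integer
  so that the term for \<open>p - 1\<close> makes sense, and vanishes, when \<open>p = 0\<close>.
\<close>

definition koszul :: "nat \<Rightarrow> int \<Rightarrow> (nat \<Rightarrow> nat) \<Rightarrow> int \<Rightarrow> 'k::field cochain set" where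
  "koszul n p t d = {F. \<forall>S. F S \<in> homogeneous_polys n (d + int (sum t S)) \<and>
     (F S \<noteq> 0 \<longrightarrow> S \<subseteq> {1..n} \<and> int (card S) = p)}"

definition ksign :: "nat set \<Rightarrow> nat \<Rightarrow> 'k::field poly" where
  "ksign T i = (-1) ^ card {l\<in>T. l < i}"

text \<open>A position \<open>T\<close> is an arbitrary set here; the intersection with
  \<open>{1..n}\<close> keeps the sum finite.\<close>

definition kdiff :: "nat \<Rightarrow> (nat \<Rightarrow> nat) \<Rightarrow> 'k::field cochain \<Rightarrow> 'k cochain" where
  "kdiff n t F T = (\<Sum>i\<in>T \<inter> {1..n}. ksign T i * (monom (single i (t i)) * F (T - {i})))"

definition proj :: "(nat set \<Rightarrow> expo \<Rightarrow> bool) \<Rightarrow> 'k::field cochain \<Rightarrow> 'k cochain" where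
  "proj R F S = restr (R S) (F S)"

text \<open>Cycles and boundaries modulo \<open>I\<close> are kept as spaces of polynomial
  representatives. Both contain all \<open>I\<close>-valued cochains of
  \<open>koszul n p t d\<close>, so their quotient is the cohomology modulo \<open>I\<close>, while
  for every ideal they lie in the same coordinate space and can be compared.\<close>

definition kcycles :: "nat \<Rightarrow> 'k::field poly set \<Rightarrow> int \<Rightarrow> (nat \<Rightarrow> nat) \<Rightarrow> int \<Rightarrow> 'k cochain set" where
  "kcycles n I p t d = {F \<in> koszul n p t d. \<forall>T. kdiff n t F T \<in> I}"

definition kbounds :: "nat \<Rightarrow> 'k::field poly set \<Rightarrow> int \<Rightarrow> (nat \<Rightarrow> nat) \<Rightarrow> int \<Rightarrow> 'k cochain set" where
  "kbounds n I p t d =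
     {F \<in> koszul n p t d. \<exists>u\<in>koszul n (p - 1) t d. \<forall>S. F S - kdiff n t u S \<in> I}"

lemma twist_insert: "finite S \<Longrightarrow> i \<notin> S \<Longrightarrow> twist t (insert i S) = single i (t i) + twist t S"
  by (simp add: twist_def)

lemma twist_remove: "finite S \<Longrightarrow> i \<in> S \<Longrightarrow> twist t S = single i (t i) + twist t (S - {i})"
  by (simp add: twist_def sum.remove)

lemma expo_deg_twist: "expo_deg (twist t S) = sum t S"
  by (simp add: twist_def expo_deg_sum)

lemma twist_in_monomials: "S \<subseteq> {1..n} \<Longrightarrow> twist t S \<in> monomials n"
  unfolding twist_def by (intro monomials_sum single_in_monomials) auto

lemma koszulI:
  assumes "\<And>S. S \<subseteq> {1..n} \<Longrightarrow> int (card S) = p \<Longrightarrow> F S \<in> homogeneous_polys n (d + int (sum t S))"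
    and "\<And>S. \<not> (S \<subseteq> {1..n} \<and> int (card S) = p) \<Longrightarrow> F S = 0"
  shows "F \<in> koszul n p t d"
  unfolding koszul_def
proof (intro CollectI allI conjI impI)
  fix S
  show "F S \<in> homogeneous_polys n (d + int (sum t S))"
    by (cases "S \<subseteq> {1..n} \<and> int (card S) = p") (use assms in simp_all)
  show "S \<subseteq> {1..n}" "int (card S) = p" if "F S \<noteq> 0" using assms(2) that by blast+
qed

lemma koszul_homogeneous: "F \<in> koszul n p t d \<Longrightarrow> F S \<in> homogeneous_polys n (d + int (sum t S))"
  by (simp add: koszul_def)

lemma koszul_eq_0: "F \<in> koszul n p t d \<Longrightarrow> \<not> (S \<subseteq> {1..n} \<and> int (card S) = p) \<Longrightarrow> F S = 0"
  unfolding koszul_def by blast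

lemma koszul_cochains: "F \<in> koszul n p t d \<Longrightarrow> F \<in> cochains n"
  unfolding koszul_def cochains_def hom_iff by blast

lemma cochains_polys: "F \<in> cochains n \<Longrightarrow> F S \<in> polys n"
  by (simp add: cochains_def)

lemma cochains_eq_0: "F \<in> cochains n \<Longrightarrow> \<not> S \<subseteq> {1..n} \<Longrightarrow> F S = 0"
  unfolding cochains_def by blast

lemma koszul_0: "(\<lambda>_. 0) \<in> koszul n p t d"
  by (rule koszulI) auto

lemma koszul_add:
  "F \<in> koszul n p t d \<Longrightarrow> G \<in> koszul n p t d \<Longrightarrow> (\<lambda>S. F S + G S) \<in> koszul n p t d"
  by (rule koszulI) (auto intro: hom_add koszul_homogeneous simp del: of_nat_sum simp: koszul_eq_0)

lemma koszul_diff: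
  "F \<in> koszul n p t d \<Longrightarrow> G \<in> koszul n p t d \<Longrightarrow> (\<lambda>S. F S - G S) \<in> koszul n p t d"
  by (rule koszulI) (auto intro: hom_diff koszul_homogeneous simp del: of_nat_sum simp: koszul_eq_0)

lemma koszul_Const: "F \<in> koszul n p t d \<Longrightarrow> (\<lambda>S. Const c * F S) \<in> koszul n p t d"
  by (rule koszulI) (auto intro: hom_Const koszul_homogeneous simp del: of_nat_sum simp: koszul_eq_0)

lemma koszul_proj: "F \<in> koszul n p t d \<Longrightarrow> proj R F \<in> koszul n p t d"
proof (rule koszulI)
  fix S assume "F \<in> koszul n p t d"
  then show "proj R F S \<in> homogeneous_polys n (d + int (sum t S))"
    unfolding proj_def by (intro hom_restr koszul_homogeneous)
qed (simp add: koszul_eq_0 proj_def)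

lemma koszul_restrict: "F \<in> koszul n p t d \<Longrightarrow> (\<lambda>S. if Q S then F S else 0) \<in> koszul n p t d"
proof (rule koszulI)
  fix S assume "F \<in> koszul n p t d"
  then show "(if Q S then F S else 0) \<in> homogeneous_polys n (d + int (sum t S))"
    by (cases "Q S") (simp_all only: koszul_homogeneous if_True if_False hom_0)
qed (simp add: koszul_eq_0)

section \<open>Signs and the Koszul differential\<close>

lemma finite_below [simp]: "finite {l\<in>T. l < (i::nat)}"
  by (rule finite_subset[of _ "{..<i}"]) auto

lemma ksign_ksign: "ksign T i * (ksign T i * f) = f"
  by (simp add: ksign_def mult.assoc[symmetric] power_mult_distrib[symmetric])

text \<open>Removing the smaller index \<open>i\<close> lowers the position of \<open>j\<close> in
  \<open>T\<close> by one; removing \<open>j\<close> leaves the position of \<open>i\<close>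
  unchanged.\<close>

lemma ksign_swap:
  assumes "i \<in> T" "j \<in> T" "i < j"
  shows "ksign T j * ksign (T - {j}) i = - (ksign T i * ksign (T - {i}) j :: 'k::field poly)"
proof -
  have "{l \<in> T - {j}. l < i} = {l\<in>T. l < i}" using assms by auto
  moreover have "{l\<in>T. l < j} = insert i {l\<in>T-{i}. l < j}" using assms by auto
  then have "card {l\<in>T. l < j} = Suc (card {l\<in>T-{i}. l < j})" by simp
  ultimately show ?thesis by (simp add: ksign_def)
qed

lemma keys_ksign_mult: "keys (ksign T i * f) = keys f"
  by (cases "even (card {l\<in>T. l < i})") (simp_all add: ksign_def)

lemma keys_kdiff:
  assumes "a \<in> keys (kdiff n t F T)"
  obtains i b where "i \<in> T" "i \<in> {1..n}" "b \<in> keys (F (T - {i}))" "a = single i (t i) + b"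
proof -
  have "a \<in> (\<Union>i\<in>T \<inter> {1..n}. keys (ksign T i * (monom (single i (t i)) * F (T - {i}))))"
    using assms unfolding kdiff_def by (rule subsetD[OF keys_sum])
  then show ?thesis using that by (auto simp: keys_ksign_mult keys_monom_mult)
qed

lemma kdiff_add: "kdiff n t (\<lambda>S. F S + G S) = (\<lambda>T. kdiff n t F T + kdiff n t G T)"
  by (rule ext) (simp add: kdiff_def distrib_left sum.distrib)

lemma kdiff_diff: "kdiff n t (\<lambda>S. F S - G S) = (\<lambda>T. kdiff n t F T - kdiff n t G T)"
  by (rule ext) (simp add: kdiff_def right_diff_distrib sum_subtractf)

lemma kdiff_mult: "kdiff n t (\<lambda>S. r * F S) = (\<lambda>T. r * kdiff n t F T)"
  by (rule ext) (simp add: kdiff_def sum_distrib_left mult_ac)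

lemma kdiff_0: "kdiff n t (\<lambda>_. 0) = (\<lambda>_. 0)"
  by (rule ext) (simp add: kdiff_def)

lemma kdiff_in_koszul:
  assumes F: "F \<in> koszul n p t d"
  shows "kdiff n t F \<in> koszul n (p + 1) t d"
proof (rule koszulI)
  fix T assume T: "T \<subseteq> {1..n}" "int (card T) = p + 1"
  show "kdiff n t F T \<in> homogeneous_polys n (d + int (sum t T))"
    unfolding kdiff_def
  proof (rule hom_sum)
    fix i assume i: "i \<in> T \<inter> {1..n}"
    have "sum t T = t i + sum t (T - {i})"
      using i T finite_subset[OF T(1)] by (simp add: sum.remove)
    then have "monom (single i (t i)) * F (T - {i}) \<in> homogeneous_polys n (d + int (sum t T))"
      using i by (intro hom_monom_mult[OF koszul_homogeneous[OF F]] single_in_monomials) auto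
    then show "ksign T i * (monom (single i (t i)) * F (T - {i}))
        \<in> homogeneous_polys n (d + int (sum t T))"
      unfolding ksign_def by (rule hom_sign)
  qed
next
  fix T assume T: "\<not> (T \<subseteq> {1..n} \<and> int (card T) = p + 1)"
  show "kdiff n t F T = 0"
    unfolding kdiff_def
  proof (rule sum.neutral, rule ballI)
    fix i assume i: "i \<in> T \<inter> {1..n}"
    have "\<not> (T - {i} \<subseteq> {1..n} \<and> int (card (T - {i})) = p)"
    proof
      assume *: "T - {i} \<subseteq> {1..n} \<and> int (card (T - {i})) = p"
      then have "T \<subseteq> {1..n}" using i by auto
      moreover have "card T = Suc (card (T - {i}))"
        using i finite_subset[OF calculation] by (metis IntD1 card_Suc_Diff1 finite_atLeastAtMost)
      ultimately show False using * T by simp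
    qed
    then have "F (T - {i}) = 0" by (rule koszul_eq_0[OF F])
    then show "ksign T i * (monom (single i (t i)) * F (T - {i})) = 0" by simp
  qed
qed

text \<open>The double sum runs over ordered pairs of distinct indices, and by
  \<open>ksign_swap\<close> the terms for \<open>(i, j)\<close> and \<open>(j, i)\<close>
  cancel.\<close>

lemma kdiff_kdiff: "kdiff n t (kdiff n t F) T = 0"
proof -
  define A where "A = T \<inter> {1..n}"
  have fA: "finite A" by (simp add: A_def)
  define m :: "nat \<Rightarrow> 'a poly" where "m i = monom (single i (t i))" for i
  define g where "g i j = ksign T i * (m i * (ksign (T - {i}) j * (m j * F (T - {i} - {j}))))" for i j
  have anti: "g j i = - g i j" if "i \<in> A" "j \<in> A" "i < j" for i j
  proof -
    have "T - {j} - {i} = T - {i} - {j}" by auto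
    then have "g j i = (ksign T j * ksign (T - {j}) i) * (m i * (m j * F (T - {i} - {j})))"
      by (simp add: g_def mult_ac)
    also have "\<dots> = - (ksign T i * ksign (T - {i}) j) * (m i * (m j * F (T - {i} - {j})))"
      using that by (subst ksign_swap) (auto simp: A_def)
    also have "\<dots> = - g i j" by (simp add: g_def mult_ac)
    finally show ?thesis .
  qed
  have "kdiff n t (kdiff n t F) T = (\<Sum>i\<in>A. \<Sum>j\<in>(T - {i}) \<inter> {1..n}. g i j)"
    by (simp add: kdiff_def A_def g_def m_def sum_distrib_left)
  also have "\<dots> = (\<Sum>i\<in>A. (\<Sum>j\<in>A. if j < i then g i j else 0) + (\<Sum>j\<in>A. if i < j then g i j else 0))"
  proof (rule sum.cong[OF refl])
    fix i assume "i \<in> A"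
    have "(\<Sum>j\<in>(T - {i}) \<inter> {1..n}. g i j) = (\<Sum>j\<in>A. if j \<noteq> i then g i j else 0)"
      using fA by (intro sum.mono_neutral_cong_left) (auto simp: A_def)
    also have "\<dots> = (\<Sum>j\<in>A. (if j < i then g i j else 0) + (if i < j then g i j else 0))"
      by (rule sum.cong) auto
    finally show "(\<Sum>j\<in>(T - {i}) \<inter> {1..n}. g i j) =
        (\<Sum>j\<in>A. if j < i then g i j else 0) + (\<Sum>j\<in>A. if i < j then g i j else 0)"
      by (simp add: sum.distrib)
  qed
  also have "\<dots> = (\<Sum>i\<in>A. \<Sum>j\<in>A. if j < i then g i j else 0) + (\<Sum>i\<in>A. \<Sum>j\<in>A. if i < j then g i j else 0)"
    by (rule sum.distrib)
  also have "(\<Sum>i\<in>A. \<Sum>j\<in>A. if i < j then g i j else 0) = (\<Sum>j\<in>A. \<Sum>i\<in>A. if i < j then g i j else 0)"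
    by (rule sum.swap)
  also have "\<dots> = (\<Sum>j\<in>A. \<Sum>i\<in>A. - (if i < j then g j i else 0))"
    using anti by (intro sum.cong refl) auto
  also have "\<dots> = - (\<Sum>i\<in>A. \<Sum>j\<in>A. if j < i then g i j else 0)"
    by (simp add: sum_negf)
  finally show ?thesis by simp
qed

text \<open>
  The condition on \<open>R\<close> says that it only depends on the exponent vector \<open>a - twist t S\<close> of the
  fraction represented by the monomial \<open>a\<close> at position \<open>S\<close>.
\<close>

definition twist_invariant :: "nat \<Rightarrow> (nat \<Rightarrow> nat) \<Rightarrow> (nat set \<Rightarrow> expo \<Rightarrow> bool) \<Rightarrow> bool" where
  "twist_invariant n t R \<longleftrightarrow>
     (\<forall>T\<subseteq>{1..n}. \<forall>i\<in>T. \<forall>a\<in>monomials n. R T (single i (t i) + a) \<longleftrightarrow> R (T - {i}) a)"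

text \<open>The differential of fractions is a signed sum of inclusions, so it preserves the Laurent
  exponent on which \<open>R\<close> depends.\<close>

lemma kdiff_proj:
  assumes R: "twist_invariant n t R" and F: "F \<in> cochains n"
  shows "kdiff n t (proj R F) = proj R (kdiff n t F)"
proof
  fix T
  show "kdiff n t (proj R F) T = proj R (kdiff n t F) T"
  proof (cases "T \<subseteq> {1..n}")
    case True
    have "restr (R (T - {i})) (F (T - {i})) =
        restr (\<lambda>a. R T (single i (t i) + a)) (F (T - {i}))" if "i \<in> T" for i
    proof (rule restr_cong)
      fix a assume "a \<in> keys (F (T - {i}))"
      then have "a \<in> monomials n" using cochains_polys[OF F] by (auto simp: polys_def)
      then show "R (T - {i}) a = R T (single i (t i) + a)"
        using R True that by (simp add: twist_invariant_def)
    qed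
    then show ?thesis
      by (simp add: kdiff_def proj_def restr_sum ksign_def restr_sign restr_monom_mult)
  next
    case False
    \<comment> \<open>Removing an element of \<open>{1..n}\<close> from a set not contained in
      \<open>{1..n}\<close> leaves such a set, where cochains vanish.\<close>
    have "F (T - {i}) = 0" if "i \<in> T \<inter> {1..n}" for i
      using that False by (intro cochains_eq_0[OF F]) auto
    then show ?thesis by (simp add: kdiff_def proj_def restr_sum)
  qed
qed

section \<open>Coordinates of cochains and the subspaces of cycles and boundaries\<close>

definition ccoef :: "'k::field cochain \<Rightarrow> nat set \<times> expo \<Rightarrow> 'k" where
  "ccoef F x = coef (F (fst x)) (snd x)"

text \<open>Positions of all cardinalities occur together, so one ranking of the basis serves every
  cohomological degree.\<close>

definition koszul_basis :: "nat \<Rightarrow> (nat \<Rightarrow> nat) \<Rightarrow> int \<Rightarrow> (nat set \<times> expo) set" where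
  "koszul_basis n t d =
     {(S, a). S \<subseteq> {1..n} \<and> a \<in> monomials n \<and> int (expo_deg a) = d + int (sum t S)}"

lemma finite_koszul_basis: "finite (koszul_basis n t d)"
proof (rule finite_subset)
  show "koszul_basis n t d \<subseteq> Sigma (Pow {1..n}) (\<lambda>S. {a\<in>monomials n. expo_deg a \<le> nat (d + int (sum t S))})"
    by (auto simp: koszul_basis_def)
qed (auto intro: finite_SigmaI finite_monomials_deg)

lemma ccoef_inject: "ccoef F = ccoef G \<longleftrightarrow> F = G"
proof
  assume *: "ccoef F = ccoef G"
  show "F = G"
  proof (rule ext, rule poly_mapping_eqI)
    fix S a show "coef (F S) a = coef (G S) a"
      using fun_cong[OF *, of "(S, a)"] by (simp add: ccoef_def)
  qed
qed simp

lemma koszul_supp: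
  assumes "F \<in> koszul n p t d" "ccoef F x \<noteq> 0"
  shows "x \<in> koszul_basis n t d"
proof -
  obtain S a where x: "x = (S, a)" by (cases x)
  then have a: "a \<in> keys (F S)" using assms(2) by (simp add: ccoef_def in_keys_iff)
  then have "F S \<noteq> 0" by auto
  then have "S \<subseteq> {1..n}" using koszul_eq_0[OF assms(1)] by blast
  then show ?thesis using koszul_homogeneous[OF assms(1), of S] a x
    by (auto simp: koszul_basis_def hom_iff polys_def)
qed

lemma ccoef_comb:
  "(\<lambda>x. ccoef F x + c * ccoef G x) = ccoef (\<lambda>S. F S + Const c * G S)"
  by (rule ext) (simp add: ccoef_def lookup_add Const_mult)

lemma ccoef_sum:
  "(\<lambda>x. \<Sum>v\<in>A. c v * ccoef (z v) x) = ccoef (\<lambda>S. \<Sum>v\<in>A. Const (c v) * z v S)"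
  by (rule ext) (simp add: ccoef_def lookup_sum Const_mult)

lemma ccoef_image_iff: "ccoef F \<in> ccoef ` W \<longleftrightarrow> F \<in> W"
  by (auto simp: ccoef_inject image_iff)

lemma fun_subspace_ccoef:
  assumes "(\<lambda>_. 0) \<in> W" "\<And>F G c. F \<in> W \<Longrightarrow> G \<in> W \<Longrightarrow> (\<lambda>S. F S + Const c * G S) \<in> W"
  shows "fun_subspace (ccoef ` W)"
  unfolding fun_subspace_def
proof (intro conjI ballI allI)
  have "(\<lambda>_. 0) = ccoef (\<lambda>_. 0)" by (rule ext) (simp add: ccoef_def)
  then show "(\<lambda>_. 0) \<in> ccoef ` W" using assms(1) by (rule image_eqI)
next
  fix f g c assume "f \<in> ccoef ` W" "g \<in> ccoef ` W"
  then show "(\<lambda>x. f x + c * g x) \<in> ccoef ` W"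
    using assms(2) by (auto simp: ccoef_comb ccoef_image_iff)
qed

context homog_ideal
begin

lemma kdiff_in_ideal:
  assumes "\<And>S. F S \<in> I"
  shows "kdiff n t F T \<in> I"
  unfolding kdiff_def ksign_def
  by (intro sum_in sign_in monom_in single_in_monomials assms) auto

lemma kbounds_subset_kcycles: "kbounds n I p t d \<subseteq> kcycles n I p t d"
proof
  fix F assume "F \<in> kbounds n I p t d"
  then obtain u where F: "F \<in> koszul n p t d" and u: "\<And>S. F S - kdiff n t u S \<in> I"
    by (auto simp: kbounds_def)
  have "kdiff n t (\<lambda>S. F S - kdiff n t u S) T \<in> I" for T by (rule kdiff_in_ideal) (rule u)
  then show "F \<in> kcycles n I p t d" using F by (simp add: kcycles_def kdiff_diff kdiff_kdiff)
qed

lemma kcycles_comb: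
  assumes "F \<in> kcycles n I p t d" "G \<in> kcycles n I p t d"
  shows "(\<lambda>S. F S + Const c * G S) \<in> kcycles n I p t d"
  using assms by (simp add: kcycles_def koszul_add koszul_Const kdiff_add kdiff_mult add_in Const_in)

lemma kbounds_comb:
  assumes "F \<in> kbounds n I p t d" "G \<in> kbounds n I p t d"
  shows "(\<lambda>S. F S + Const c * G S) \<in> kbounds n I p t d"
proof -
  obtain u v where u: "u \<in> koszul n (p - 1) t d" "\<And>S. F S - kdiff n t u S \<in> I"
    and v: "v \<in> koszul n (p - 1) t d" "\<And>S. G S - kdiff n t v S \<in> I"
    using assms by (auto simp: kbounds_def)
  have "(F S - kdiff n t u S) + Const c * (G S - kdiff n t v S) \<in> I" for S
    using u v by (intro add_in Const_in) auto
  then have "F S + Const c * G S - kdiff n t (\<lambda>S. u S + Const c * v S) S \<in> I" for S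
    by (simp add: kdiff_add kdiff_mult algebra_simps)
  moreover have "(\<lambda>S. u S + Const c * v S) \<in> koszul n (p - 1) t d"
    using u v by (intro koszul_add koszul_Const)
  ultimately show ?thesis using assms unfolding kbounds_def
    by (auto intro!: koszul_add koszul_Const)
qed

lemma kcycles_0: "(\<lambda>_. 0) \<in> kcycles n I p t d"
  by (simp add: kcycles_def koszul_0 kdiff_0)

lemma kbounds_0: "(\<lambda>_. 0) \<in> kbounds n I p t d"
  unfolding kbounds_def using koszul_0 by (auto simp: kdiff_0 intro!: bexI[of _ "\<lambda>_. 0"])

lemma kbounds_add:
  assumes "F \<in> kbounds n I p t d" "G \<in> kbounds n I p t d"
  shows "(\<lambda>S. F S + G S) \<in> kbounds n I p t d"
  using kbounds_comb[OF assms, of 1] by simp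

lemma kbounds_sum:
  assumes "\<And>v. v \<in> A \<Longrightarrow> z v \<in> kbounds n I p t d"
  shows "(\<lambda>S. \<Sum>v\<in>A. z v S) \<in> kbounds n I p t d"
  using assms by (induction A rule: infinite_finite_induct) (auto simp: kbounds_0 kbounds_add)

lemma kcycles_sum:
  assumes "\<And>v. v \<in> A \<Longrightarrow> z v \<in> kcycles n I p t d"
  shows "(\<lambda>S. \<Sum>v\<in>A. Const (c v) * z v S) \<in> kcycles n I p t d"
  using assms
proof (induction A rule: infinite_finite_induct)
  case (insert v A)
  have "(\<lambda>S. (\<Sum>v\<in>A. Const (c v) * z v S) + Const (c v) * z v S) \<in> kcycles n I p t d"
    using insert by (intro kcycles_comb) auto
  then show ?case using insert by (simp add: add.commute)
qed (auto simp: kcycles_0)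

lemma fun_subspace_kcycles: "fun_subspace (ccoef ` kcycles n I p t d)"
  by (rule fun_subspace_ccoef) (auto simp: kcycles_0 kcycles_comb)

lemma fun_subspace_kbounds: "fun_subspace (ccoef ` kbounds n I p t d)"
  by (rule fun_subspace_ccoef) (auto simp: kbounds_0 kbounds_comb)

end

section \<open>Leading ideals\<close>

locale preordered_monomials =
  fixes n :: nat and lt :: "expo \<Rightarrow> expo \<Rightarrow> bool"
  assumes preorder: "monomial_preorder n lt"
begin

definition sim :: "expo \<Rightarrow> expo \<Rightarrow> bool" where
  "sim a b \<longleftrightarrow> \<not> lt a b \<and> \<not> lt b a"

lemma lt_irrefl: "a \<in> monomials n \<Longrightarrow> \<not> lt a a"
  using preorder by (auto simp: monomial_preorder_def weak_order_on_def irreflp_on_def)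

lemma lt_trans: "lt a b \<Longrightarrow> lt b c \<Longrightarrow> a \<in> monomials n \<Longrightarrow> b \<in> monomials n \<Longrightarrow> c \<in> monomials n \<Longrightarrow> lt a c"
  using preorder unfolding monomial_preorder_def weak_order_on_def transp_on_def by blast

lemma lt_add: "a \<in> monomials n \<Longrightarrow> b \<in> monomials n \<Longrightarrow> c \<in> monomials n \<Longrightarrow> lt (a + c) (b + c) \<longleftrightarrow> lt a b"
  using preorder unfolding monomial_preorder_def by blast

lemma sim_add: "a \<in> monomials n \<Longrightarrow> b \<in> monomials n \<Longrightarrow> c \<in> monomials n \<Longrightarrow> sim (a + c) (b + c) \<longleftrightarrow> sim a b"
  by (simp add: sim_def lt_add)

lemma sim_sym: "sim a b \<longleftrightarrow> sim b a"
  by (auto simp: sim_def)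

lemma sim_refl: "a \<in> monomials n \<Longrightarrow> sim a a"
  by (simp add: sim_def lt_irrefl)

lemma sim_trans:
  assumes "sim a b" "sim b c" "a \<in> monomials n" "b \<in> monomials n" "c \<in> monomials n"
  shows "sim a c"
proof -
  have "trans {(a, b). a \<in> monomials n \<and> b \<in> monomials n \<and> \<not> lt a b \<and> \<not> lt b a}"
    using preorder unfolding monomial_preorder_def weak_order_on_def equiv_def by blast
  from transD[OF this, of a b c] show ?thesis using assms by (simp add: sim_def)
qed

lemma lt_sim_trans:
  assumes "lt a b" "sim b c" "a \<in> monomials n" "b \<in> monomials n" "c \<in> monomials n"
  shows "lt a c"
proof (rule ccontr)
  assume neg: "\<not> lt a c"
  show False
  proof (cases "lt c a")
    case True
    then show False using lt_trans[of c a b] assms by (simp add: sim_def)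
  next
    case False
    then have "sim a c" using neg by (simp add: sim_def)
    then have "sim a b" using sim_trans[of a c b] assms sim_sym by blast
    then show False using assms by (simp add: sim_def)
  qed
qed

lemma sim_lt_trans:
  assumes "sim a b" "lt b c" "a \<in> monomials n" "b \<in> monomials n" "c \<in> monomials n"
  shows "lt a c"
proof (rule ccontr)
  assume neg: "\<not> lt a c"
  show False
  proof (cases "lt c a")
    case True
    then show False using lt_trans[of b c a] assms by (simp add: sim_def)
  next
    case False
    then have "sim a c" using neg by (simp add: sim_def)
    then have "sim b c" using sim_trans[of b a c] assms sim_sym by blast
    then show False using assms by (simp add: sim_def)
  qed
qed

lemma polysD: "f \<in> polys n \<Longrightarrow> a \<in> keys f \<Longrightarrow> a \<in> monomials n"
  by (auto simp: polys_def)

text \<open>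
  The pair \<open>(p, q)\<close> stands for the Laurent monomial with exponent vector \<open>p - q\<close>.
\<close>

lemma restr_sim_cases:
  assumes f: "f \<in> polys n" and p: "p \<in> monomials n" and q: "q \<in> monomials n"
    and max: "\<And>b. b \<in> keys f \<Longrightarrow> \<not> lt p (b + q)"
  shows "restr (\<lambda>b. sim (b + q) p) f = 0 \<or> restr (\<lambda>b. sim (b + q) p) f = leading_part lt f"
proof (cases "\<exists>a\<in>keys f. sim (a + q) p")
  case False
  then show ?thesis by (intro disjI1 restr_eq_zero) blast
next
  case True
  then obtain a where a: "a \<in> keys f" "sim (a + q) p" by blast
  have aM: "a \<in> monomials n" "a + q \<in> monomials n" using polysD[OF f a(1)] q by (simp_all add: monomials_add_iff)
  \<comment> \<open>Nothing in \<open>f\<close> lies above the class of \<open>p - q\<close>, and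
    \<open>a\<close> lies in it. So the members of this class are exactly the maximal monomials of
    \<open>f\<close>.\<close>
  have "restr (\<lambda>b. sim (b + q) p) f = restr (\<lambda>b. \<not> (\<exists>c\<in>keys f. lt b c)) f"
  proof (rule restr_cong)
    fix b assume b: "b \<in> keys f"
    have bM: "b \<in> monomials n" "b + q \<in> monomials n" using polysD[OF f b] q by (simp_all add: monomials_add_iff)
    show "sim (b + q) p = (\<not> (\<exists>c\<in>keys f. lt b c))"
    proof
      assume s: "sim (b + q) p"
      show "\<not> (\<exists>c\<in>keys f. lt b c)"
      proof
        assume "\<exists>c\<in>keys f. lt b c"
        then obtain c where c: "c \<in> keys f" "lt b c" by blast
        have cM: "c \<in> monomials n" "c + q \<in> monomials n" using polysD[OF f c(1)] q by (simp_all add: monomials_add_iff)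
        have "lt (b + q) (c + q)" using c bM cM q lt_add by blast
        then have "lt p (c + q)" using s sim_lt_trans[of p "b + q" "c + q"] sim_sym p bM cM by blast
        then show False using max[OF c(1)] by blast
      qed
    next
      assume m: "\<not> (\<exists>c\<in>keys f. lt b c)"
      then have "\<not> lt (b + q) (a + q)" using a aM bM q lt_add by blast
      moreover have "\<not> lt p (b + q)" by (rule max[OF b])
      ultimately show "sim (b + q) p"
        unfolding sim_def using lt_sim_trans[of "b + q" p "a + q"] a(2) sim_sym p aM bM by blast
    qed
  qed
  then show ?thesis by (simp add: leading_part_eq)
qed

lemma leading_part_monom_mult:
  assumes "f \<in> polys n" "c \<in> monomials n"
  shows "leading_part lt (monom c * f) = monom c * leading_part lt f"
proof -
  have "restr (\<lambda>a. \<not> (\<exists>b\<in>(+) c ` keys f. lt (c + a) b)) f =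
      restr (\<lambda>a. \<not> (\<exists>b\<in>keys f. lt a b)) f"
  proof (rule restr_cong)
    fix a assume a: "a \<in> keys f"
    have "lt (c + a) (c + b) \<longleftrightarrow> lt a b" if "b \<in> keys f" for b
      using lt_add[of a b c] polysD[OF assms(1)] a that assms(2) by (simp add: add.commute)
    then show "(\<not> (\<exists>b\<in>(+) c ` keys f. lt (c + a) b)) = (\<not> (\<exists>b\<in>keys f. lt a b))"
      by blast
  qed
  then show ?thesis by (simp only: leading_part_eq restr_monom_mult keys_monom_mult)
qed

lemma leading_part_Const_mult:
  assumes "c \<noteq> 0"
  shows "leading_part lt (Const c * f) = Const c * leading_part lt f"
proof -
  have "keys (Const c * f) = keys f"
    using assms by (auto simp: in_keys_iff Const_mult)
  then show ?thesis by (simp only: leading_part_eq restr_Const_mult)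
qed

lemma leading_part_homogeneous: "f \<in> homogeneous_polys n d \<Longrightarrow> leading_part lt f \<in> homogeneous_polys n d"
  by (simp add: leading_part_eq hom_restr)

end

text \<open>An explicit form of the leading ideal, established in \<open>lead_eq_sums\<close>, that
  allows induction on membership. Sums suffice because a monomial multiple of a leading part is
  again a leading part; homogeneous \<open>f\<close> suffice by
  \<open>sums_leading'\<close>.\<close>

inductive_set leading_sums :: "nat \<Rightarrow> (expo \<Rightarrow> expo \<Rightarrow> bool) \<Rightarrow> 'k::field poly set \<Rightarrow> 'k poly set"
  for n lt I where
  zero: "0 \<in> leading_sums n lt I"
| add: "f \<in> I \<Longrightarrow> f \<in> homogeneous_polys n d \<Longrightarrow> g \<in> leading_sums n lt I \<Longrightarrow>
    leading_part lt f + g \<in> leading_sums n lt I"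

locale preordered_ideal = preordered_monomials n lt + homog_ideal n I for n lt and I :: "'k::field poly set"
begin

abbreviation "lsums \<equiv> leading_sums n lt I"
abbreviation "lead_id \<equiv> leading_ideal n lt I"

lemma sums_add: "f \<in> lsums \<Longrightarrow> g \<in> lsums \<Longrightarrow> f + g \<in> lsums"
  by (induction rule: leading_sums.induct) (auto simp: add.assoc intro: leading_sums.intros)

lemma sums_leading: "f \<in> I \<Longrightarrow> f \<in> homogeneous_polys n d \<Longrightarrow> leading_part lt f \<in> lsums"
  using leading_sums.add[OF _ _ leading_sums.zero, of f] by simp

lemma sums_sum: "(\<And>x. x \<in> A \<Longrightarrow> f x \<in> lsums) \<Longrightarrow> sum f A \<in> lsums"
  by (induction A rule: infinite_finite_induct) (auto simp: sums_add leading_sums.zero)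

lemma sums_polys: "f \<in> lsums \<Longrightarrow> f \<in> polys n"
proof (induction rule: leading_sums.induct)
  case (add f d g)
  then show ?case using leading_part_homogeneous[of f d] by (auto simp: hom_iff polys_add)
qed simp

lemma sums_monom: "f \<in> lsums \<Longrightarrow> c \<in> monomials n \<Longrightarrow> monom c * f \<in> lsums"
proof (induction rule: leading_sums.induct)
  case (add f d g)
  have "leading_part lt (monom c * f) + monom c * g \<in> lsums"
    by (rule leading_sums.add[where d = "d + int (expo_deg c)"])
       (use add in \<open>simp_all add: monom_in hom_monom_mult\<close>)
  then show ?case using add.prems add.hyps leading_part_monom_mult[of f c]
    by (simp add: distrib_left in_polys)
qed (simp add: leading_sums.zero)

lemma sums_Const: "f \<in> lsums \<Longrightarrow> Const c * f \<in> lsums"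
proof (induction rule: leading_sums.induct)
  case (add f d g)
  show ?case
  proof (cases "c = 0")
    case False
    have "leading_part lt (Const c * f) + Const c * g \<in> lsums"
      by (rule leading_sums.add[where d = d])
         (use add in \<open>simp_all add: Const_in hom_Const\<close>)
    then show ?thesis using leading_part_Const_mult[OF False] by (simp add: distrib_left)
  qed (simp add: leading_sums.zero)
qed (simp add: leading_sums.zero)

lemma sums_mult:
  assumes "r \<in> polys n" "f \<in> lsums"
  shows "r * f \<in> lsums"
proof -
  have "r * f = (\<Sum>a\<in>keys r. Const (coef r a) * (monom a * f))"
    by (subst poly_eq_sum_monom[of r]) (simp add: sum_distrib_right mult.assoc)
  also have "\<dots> \<in> lsums"
    using assms polysD by (intro sums_sum sums_Const sums_monom) auto
  finally show ?thesis .
qed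

lemma homogeneous_part_add: "homogeneous_part d (f + g) = homogeneous_part d f + homogeneous_part d g"
  by (simp add: homogeneous_part_eq restr_add)

lemma sums_part: "f \<in> lsums \<Longrightarrow> homogeneous_part e f \<in> lsums"
proof (induction rule: leading_sums.induct)
  case (add f d g)
  have "homogeneous_part e (leading_part lt f) \<in> lsums"
    using homogeneous_part_homogeneous[OF leading_part_homogeneous[OF add.hyps(2)], of e]
      sums_leading[OF add.hyps(1,2)] leading_sums.zero by (cases "e = d") simp_all
  then show ?case unfolding homogeneous_part_add using add.IH by (rule sums_add)
qed (simp add: leading_sums.zero homogeneous_part_eq)

text \<open>A homogeneous part of \<open>f\<close> without maximal monomials of \<open>f\<close>
  contributes nothing. If it contains one, \<open>a\<close>, then its own maximal monomials are tied
  with \<open>a\<close>, hence maximal in \<open>f\<close>, and its contribution is the leading part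
  of an element of \<open>I\<close>.\<close>

lemma sums_leading':
  assumes f: "f \<in> I"
  shows "leading_part lt f \<in> lsums"
proof -
  let ?Q = "\<lambda>a. \<not> (\<exists>b\<in>keys f. lt a b)"
  let ?D = "(\<lambda>a. int (expo_deg a)) ` keys f"
  have "restr ?Q (homogeneous_part d f) \<in> lsums" for d
  proof (cases "\<exists>a\<in>keys (homogeneous_part d f). ?Q a")
    case False
    then have "restr ?Q (homogeneous_part d f) = 0" by (intro restr_eq_zero) blast
    then show ?thesis by (simp add: leading_sums.zero)
  next
    case True
    then obtain a where a: "a \<in> keys (homogeneous_part d f)" "?Q a" by blast
    let ?g = "homogeneous_part d f"
    have sub: "keys ?g \<subseteq> keys f" by (auto simp: homogeneous_part_eq keys_restr)
    have M: "b \<in> monomials n" if "b \<in> keys f" for b using polysD[OF in_polys[OF f] that] .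
    have "restr ?Q ?g = restr (\<lambda>a. \<not> (\<exists>b\<in>keys ?g. lt a b)) ?g"
    proof (rule restr_cong)
      fix b assume b: "b \<in> keys ?g"
      show "?Q b = (\<not> (\<exists>c\<in>keys ?g. lt b c))"
      proof
        assume "?Q b" then show "\<not> (\<exists>c\<in>keys ?g. lt b c)" using sub by blast
      next
        assume m: "\<not> (\<exists>c\<in>keys ?g. lt b c)"
        then have "sim a b" using a b sub by (auto simp: sim_def)
        then show "?Q b" using a b sub M sim_lt_trans[of a b] by blast
      qed
    qed
    then have "restr ?Q ?g = leading_part lt ?g" by (simp add: leading_part_eq)
    then show ?thesis using sums_leading[OF part_in[OF f] homogeneous_part_in[OF in_polys[OF f]]] by simp
  qed
  then have "(\<Sum>d\<in>?D. restr ?Q (homogeneous_part d f)) \<in> lsums" by (intro sums_sum)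
  also have "(\<Sum>d\<in>?D. restr ?Q (homogeneous_part d f)) = restr ?Q (\<Sum>d\<in>?D. homogeneous_part d f)"
    by (simp only: restr_sum)
  also have "\<dots> = leading_part lt f"
    by (simp only: sum_homogeneous_parts[symmetric] leading_part_eq)
  finally show ?thesis .
qed

lemma homogeneous_ideal_sums: "homogeneous_ideal n lsums"
  by (rule homogeneous_idealI) (auto simp: sums_polys leading_sums.zero sums_add sums_mult sums_part)

lemma lead_eq_sums: "lead_id = lsums"
proof
  interpret S: homog_ideal n lsums by standard (rule homogeneous_ideal_sums)
  have sub: "leading_part lt ` I \<subseteq> carrier (poly_ring n)"
    using sums_leading' sums_polys by auto
  show "lead_id \<subseteq> lsums"
    unfolding leading_ideal_def by (rule genideal_minimal[OF S.ideal_axioms]) (use sums_leading' in auto)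
  have id: "ideal lead_id (poly_ring n)"
    unfolding leading_ideal_def by (rule genideal_ideal[OF sub])
  then interpret L: ideal lead_id "poly_ring n" .
  have self: "leading_part lt f \<in> lead_id" if "f \<in> I" for f
    using genideal_self[OF sub] that unfolding leading_ideal_def by blast
  show "lsums \<subseteq> lead_id"
  proof
    fix f assume "f \<in> lsums"
    then show "f \<in> lead_id"
    proof (induction rule: leading_sums.induct)
      case zero
      show ?case using additive_subgroup.zero_closed[OF L.is_additive_subgroup] by simp
    next
      case (add f d g)
      show ?case
        using additive_subgroup.a_closed[OF L.is_additive_subgroup self[OF add(1)] add.IH] by simp
    qed
  qed
qed

lemma homogeneous_ideal_lead: "homogeneous_ideal n lead_id"
  by (simp add: lead_eq_sums homogeneous_ideal_sums)

lemma leading_part_in_lead: "f \<in> I \<Longrightarrow> leading_part lt f \<in> lead_id"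
  by (simp add: lead_eq_sums sums_leading')

text \<open>The lifting property behind the comparison of boundaries: the part of \<open>g\<close>
  in one tie class is also the part in that class of an element of \<open>I\<close> that has nothing
  above it. Induction on a representation of \<open>g\<close> collects those summands whose leading
  part lies in the given degree and class.\<close>

lemma lead_component:
  assumes g: "g \<in> lead_id" "g \<in> homogeneous_polys n e" and p: "p \<in> monomials n" and q: "q \<in> monomials n"
  shows "\<exists>f\<in>I. f \<in> homogeneous_polys n e \<and> restr (\<lambda>a. sim (a + q) p) f = restr (\<lambda>a. sim (a + q) p) g \<and>
    (\<forall>a\<in>keys f. \<not> lt p (a + q))"
proof -
  let ?R = "restr (\<lambda>a. sim (a + q) p)"
  have "\<exists>f\<in>I. f \<in> homogeneous_polys n e \<and> ?R f = ?R (homogeneous_part e g) \<and>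
    (\<forall>a\<in>keys f. \<not> lt p (a + q))"
    using g(1) unfolding lead_eq_sums
  proof (induction rule: leading_sums.induct)
    case zero
    show ?case by (rule bexI[of _ 0]) (auto simp: homogeneous_part_eq)
  next
    case (add f0 d g)
    then obtain f where f: "f \<in> I" "f \<in> homogeneous_polys n e" "?R f = ?R (homogeneous_part e g)"
      "\<And>a. a \<in> keys f \<Longrightarrow> \<not> lt p (a + q)" by blast
    show ?case
    proof (cases "d = e \<and> ?R (leading_part lt f0) \<noteq> 0")
      \<comment> \<open>A summand of another degree or class contributes nothing at
        \<open>p - q\<close>, and the lift \<open>f\<close> from the induction serves again.\<close>
      case False
      then have "?R (homogeneous_part e (leading_part lt f0)) = 0"
        using homogeneous_part_homogeneous[OF leading_part_homogeneous[OF add.hyps(2)], of e] by auto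
      then have "?R (homogeneous_part e (leading_part lt f0 + g)) = ?R f"
        by (simp add: homogeneous_part_add restr_add f(3))
      then show ?thesis using f by auto
    next
      case True
      have f0M: "b \<in> monomials n" if "b \<in> keys f0" for b
        using polysD[OF in_polys[OF add.hyps(1)] that] .
      obtain a where a: "a \<in> keys (leading_part lt f0)" "sim (a + q) p"
        using True restr_eq_zero[of "leading_part lt f0" "\<lambda>a. sim (a + q) p"] by blast
      then have a': "a \<in> keys f0" "\<And>b. b \<in> keys f0 \<Longrightarrow> \<not> lt a b"
        by (auto simp: leading_part_eq keys_restr)
      have max: "\<not> lt p (b + q)" if b: "b \<in> keys f0" for b
      proof
        assume "lt p (b + q)"
        then have "lt (a + q) (b + q)"
          using a(2) sim_lt_trans[of "a + q" p "b + q"] f0M a'(1) b p q by (simp add: monomials_add_iff)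
        then have "lt a b" using lt_add f0M a'(1) b q by blast
        then show False using a'(2) b by blast
      qed
      have "?R f0 \<noteq> 0"
        using a a'(1) by (metis (mono_tags, lifting) keys_zero empty_iff keys_restr mem_Collect_eq)
      then have "?R f0 = leading_part lt f0"
        using restr_sim_cases[OF in_polys[OF add.hyps(1)] p q max] by blast
      then have "?R (leading_part lt f0) = ?R f0" by (metis (no_types, lifting) keys_restr mem_Collect_eq restr_eq_self)
      moreover have "homogeneous_part e (leading_part lt f0) = leading_part lt f0"
        using homogeneous_part_homogeneous[OF leading_part_homogeneous[OF add.hyps(2)], of e] True by simp
      ultimately have "?R (f0 + f) = ?R (homogeneous_part e (leading_part lt f0 + g))"
        using f(3) by (simp add: homogeneous_part_add restr_add)
      moreover have "\<not> lt p (a + q)" if "a \<in> keys (f0 + f)" for a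
        using that keys_add[of f0 f] max f(4) by blast
      moreover have "f0 + f \<in> homogeneous_polys n e"
        using hom_add add.hyps(2) f(2) True by blast
      ultimately show ?thesis using add_in[OF add.hyps(1) f(1)] by blast
    qed
  qed
  then show ?thesis using homogeneous_part_homogeneous[OF g(2), of e] by simp
qed

end

sublocale preordered_ideal \<subseteq> L: homog_ideal n "leading_ideal n lt I"
  by standard (rule homogeneous_ideal_lead)

section \<open>Semicontinuity of Koszul cohomology\<close>

context preordered_monomials
begin

text \<open>The preorder on the Laurent monomials \<open>a - twist t S\<close>, with both
  denominators cleared.\<close>

definition twist_lt :: "(nat \<Rightarrow> nat) \<Rightarrow> nat set \<times> expo \<Rightarrow> nat set \<times> expo \<Rightarrow> bool" where
  "twist_lt t x y \<longleftrightarrow> lt (snd x + twist t (fst y)) (snd y + twist t (fst x))"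

definition twist_sim :: "(nat \<Rightarrow> nat) \<Rightarrow> nat set \<times> expo \<Rightarrow> nat set \<Rightarrow> expo \<Rightarrow> bool" where
  "twist_sim t x S a \<longleftrightarrow> sim (a + twist t (fst x)) (snd x + twist t S)"

lemma twist_sim_refl: "x \<in> koszul_basis n t d \<Longrightarrow> twist_sim t x (fst x) (snd x)"
  by (auto simp: twist_sim_def koszul_basis_def monomials_add_iff twist_in_monomials intro: sim_refl)

text \<open>As for fractions: each inequality is multiplied by the denominator it lacks, the two are
  chained, and the middle denominator is cancelled.\<close>

lemma twist_lt_order: "irreflp_on (koszul_basis n t d) (twist_lt t)" "transp_on (koszul_basis n t d) (twist_lt t)"
proof -
  show "irreflp_on (koszul_basis n t d) (twist_lt t)"
    by (auto simp: irreflp_on_def twist_lt_def koszul_basis_def monomials_add_iff twist_in_monomials lt_irrefl)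
  show "transp_on (koszul_basis n t d) (twist_lt t)"
  proof (rule transp_onI)
    fix x y z assume in_basis: "x \<in> koszul_basis n t d" "y \<in> koszul_basis n t d" "z \<in> koszul_basis n t d"
      and xy: "twist_lt t x y" and yz: "twist_lt t y z"
    obtain S a where x: "x = (S, a)" by (cases x)
    obtain S' a' where y: "y = (S', a')" by (cases y)
    obtain S'' a'' where z: "z = (S'', a'')" by (cases z)
    have M: "a \<in> monomials n" "a' \<in> monomials n" "a'' \<in> monomials n" "twist t S \<in> monomials n"
        "twist t S' \<in> monomials n" "twist t S'' \<in> monomials n"
      using in_basis by (auto simp: x y z koszul_basis_def twist_in_monomials)
    have "lt ((a + twist t S') + twist t S'') ((a' + twist t S) + twist t S'')"
      using xy M by (subst lt_add) (simp_all add: x y twist_lt_def monomials_add_iff)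
    moreover have "lt ((a' + twist t S'') + twist t S) ((a'' + twist t S') + twist t S)"
      using yz M by (subst lt_add) (simp_all add: y z twist_lt_def monomials_add_iff)
    moreover have "(a' + twist t S'') + twist t S = (a' + twist t S) + twist t S''" by (simp add: add_ac)
    ultimately have "lt ((a + twist t S') + twist t S'') ((a'' + twist t S') + twist t S)"
      using lt_trans[of "(a + twist t S') + twist t S''" "(a' + twist t S) + twist t S''"
          "(a'' + twist t S') + twist t S"] M by (simp add: monomials_add_iff)
    then have "lt ((a + twist t S'') + twist t S') ((a'' + twist t S) + twist t S')"
      by (simp add: add_ac)
    then show "twist_lt t x z" using M by (subst (asm) lt_add) (simp_all add: x z twist_lt_def monomials_add_iff)
  qed
qed

text \<open>Passing from \<open>T - {i}\<close> to \<open>T\<close> multiplies numerator and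
  denominator by the same power of the variable \<open>i\<close>.\<close>

lemma twist_invariant_sim:
  assumes "x \<in> koszul_basis n t d"
  shows "twist_invariant n t (twist_sim t x)"
  unfolding twist_invariant_def
proof (intro allI impI ballI)
  fix T i a assume T: "T \<subseteq> {1..n}" and i: "i \<in> T" and a: "a \<in> monomials n"
  let ?m = "single i (t i)"
  have M: "snd x \<in> monomials n" "twist t (fst x) \<in> monomials n" "twist t (T - {i}) \<in> monomials n" "?m \<in> monomials n"
    using assms T i single_in_monomials[of i n "t i"] by (auto simp: koszul_basis_def intro!: twist_in_monomials)
  have "twist t T = ?m + twist t (T - {i})" using twist_remove i finite_subset[OF T] by blast
  then have "twist_sim t x T (?m + a) \<longleftrightarrow> sim ((a + twist t (fst x)) + ?m) ((snd x + twist t (T - {i})) + ?m)"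
    by (simp add: twist_sim_def add_ac)
  also have "\<dots> \<longleftrightarrow> twist_sim t x (T - {i}) a"
    using M a by (subst sim_add) (simp_all add: twist_sim_def monomials_add_iff)
  finally show "twist_sim t x T (?m + a) \<longleftrightarrow> twist_sim t x (T - {i}) a" .
qed

end

text \<open>The ranking \<open>r\<close> refines the preorder on Laurent monomials to a linear order
  of the basis. It only selects a leading coordinate; the arguments below then act on the whole tie
  class of that coordinate.\<close>

locale ranked_koszul = preordered_ideal n lt I + leading_exponents "koszul_basis n t d" r
  for n lt and I :: "'k::field poly set" and t d r +
  assumes rank: "\<And>x y. x \<in> koszul_basis n t d \<Longrightarrow> y \<in> koszul_basis n t d \<Longrightarrow> twist_lt t x y \<Longrightarrow> r x < r y"
begin

text \<open>The projection of \<open>F\<close> to the top tie class has as its differential the part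
  of \<open>kdiff n t F\<close> in that class. Nothing lies above it there, so at each position this
  part is zero or the leading part of an element of \<open>I\<close>.\<close>

lemma lead_kcycle:
  assumes F: "F \<in> kcycles n I p t d" and x: "lead_of r (ccoef F) x"
  shows "proj (twist_sim t x) F \<in> kcycles n lead_id p t d"
    and "lead_of r (ccoef (proj (twist_sim t x) F)) x"
proof -
  have Fk: "F \<in> koszul n p t d" using F by (simp add: kcycles_def)
  have xB: "x \<in> koszul_basis n t d" using koszul_supp[OF Fk] x by (auto simp: lead_of_def)
  then have xM: "snd x \<in> monomials n" "twist t (fst x) \<in> monomials n"
    by (auto simp: koszul_basis_def twist_in_monomials)
  \<comment> \<open>A monomial strictly above the class of \<open>x\<close> would have a larger rank
    than the leading coordinate.\<close>
  have max: "\<not> lt (snd x + twist t S) (a + twist t (fst x))" if a: "a \<in> keys (F S)" for S a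
  proof
    assume "lt (snd x + twist t S) (a + twist t (fst x))"
    then have "twist_lt t x (S, a)" by (simp add: twist_lt_def)
    moreover have nz: "ccoef F (S, a) \<noteq> 0" using a by (simp add: ccoef_def in_keys_iff)
    ultimately have "r x < r (S, a)" using rank xB koszul_supp[OF Fk] by blast
    moreover have "r (S, a) \<le> r x" using x nz unfolding lead_of_def by blast
    ultimately show False by simp
  qed
  have "kdiff n t (proj (twist_sim t x) F) T \<in> lead_id" for T
  proof (cases "T \<subseteq> {1..n}")
    case T: True
    let ?f = "kdiff n t F T"
    have fI: "?f \<in> I" using F by (simp add: kcycles_def)
    have TM: "twist t T \<in> monomials n" using T by (rule twist_in_monomials)
    have "\<not> lt (snd x + twist t T) (b + twist t (fst x))" if b: "b \<in> keys ?f" for b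
    proof -
      obtain i a where i: "i \<in> T" and a: "a \<in> keys (F (T - {i}))" "b = single i (t i) + a"
        using b by (rule keys_kdiff)
      have tw: "twist t T = single i (t i) + twist t (T - {i})"
        using twist_remove i finite_subset[OF T] by blast
      have aM: "a \<in> monomials n"
        using polysD[OF cochains_polys[OF koszul_cochains[OF Fk]] a(1)] .
      have "lt (snd x + twist t T) (b + twist t (fst x)) \<longleftrightarrow>
          lt ((snd x + twist t (T - {i})) + single i (t i)) ((a + twist t (fst x)) + single i (t i))"
        by (simp add: tw a(2) add_ac)
      also have "\<dots> \<longleftrightarrow> lt (snd x + twist t (T - {i})) (a + twist t (fst x))"
        using TM xM aM by (intro lt_add) (simp_all add: monomials_add_iff tw)
      finally show ?thesis using max[OF a(1)] by simp
    qed
    then have "restr (twist_sim t x T) ?f = 0 \<or> restr (twist_sim t x T) ?f = leading_part lt ?f"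
      unfolding twist_sim_def using xM TM in_polys[OF fI]
      by (intro restr_sim_cases) (auto simp: monomials_add_iff)
    then have "restr (twist_sim t x T) ?f \<in> lead_id"
      using leading_part_in_lead[OF fI] by (metis L.zero_in)
    then show ?thesis
      by (simp add: kdiff_proj[OF twist_invariant_sim[OF xB] koszul_cochains[OF Fk]] proj_def)
  next
    case False
    then have "kdiff n t (proj (twist_sim t x) F) T = 0"
      using koszul_eq_0[OF kdiff_in_koszul[OF koszul_proj[OF Fk]]] by blast
    then show ?thesis by simp
  qed
  then show "proj (twist_sim t x) F \<in> kcycles n lead_id p t d"
    using koszul_proj[OF Fk] by (simp add: kcycles_def)
  have "ccoef (proj (twist_sim t x) F) y = (if twist_sim t x (fst y) (snd y) then ccoef F y else 0)" for y
    by (simp add: ccoef_def proj_def coef_restr)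
  then show "lead_of r (ccoef (proj (twist_sim t x) F)) x"
    using x twist_sim_refl[OF xB] by (auto simp: lead_of_def)
qed

text \<open>Modulo the leading ideal, \<open>F\<close> is the differential of \<open>u\<close>. The
  class part of the error is lifted to an element of \<open>I\<close> by
  \<open>lead_component\<close>, and adding the lift to the differential of the class part of
  \<open>u\<close> gives a boundary modulo \<open>I\<close> with the same leading
  coordinate.\<close>

lemma lead_kbound:
  assumes F: "F \<in> kbounds n lead_id p t d" and x: "lead_of r (ccoef F) x"
  obtains W where "W \<in> kbounds n I p t d" "lead_of r (ccoef W) x"
proof -
  obtain u where Fk: "F \<in> koszul n p t d" and u: "u \<in> koszul n (p - 1) t d" and g: "\<And>S. F S - kdiff n t u S \<in> lead_id"
    using F by (auto simp: kbounds_def)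
  have du: "kdiff n t u \<in> koszul n p t d" using kdiff_in_koszul[OF u] by simp
  have xB: "x \<in> koszul_basis n t d" using koszul_supp[OF Fk] x by (auto simp: lead_of_def)
  then have xM: "snd x \<in> monomials n" "twist t (fst x) \<in> monomials n"
    by (auto simp: koszul_basis_def twist_in_monomials)
  let ?R = "twist_sim t x"
  have "\<exists>f. f \<in> I \<and> f \<in> homogeneous_polys n (d + int (sum t S)) \<and>
      restr (?R S) f = restr (?R S) (F S - kdiff n t u S) \<and>
      (\<forall>a\<in>keys f. \<not> lt (snd x + twist t S) (a + twist t (fst x)))" if "S \<subseteq> {1..n}" for S
    using lead_component[OF g[of S] hom_diff[OF koszul_homogeneous[OF Fk] koszul_homogeneous[OF du]],
        of "snd x + twist t S" "twist t (fst x)"] xM twist_in_monomials[OF that]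
    unfolding twist_sim_def by (auto simp: monomials_add_iff)
  then obtain f where f: "\<And>S. S \<subseteq> {1..n} \<Longrightarrow> f S \<in> I \<and> f S \<in> homogeneous_polys n (d + int (sum t S)) \<and>
      restr (?R S) (f S) = restr (?R S) (F S - kdiff n t u S) \<and>
      (\<forall>a\<in>keys (f S). \<not> lt (snd x + twist t S) (a + twist t (fst x)))"
    by metis
  \<comment> \<open>The lift is cut to cardinality \<open>p\<close>; at other positions
    \<open>F\<close> and the differential of \<open>u\<close> vanish, so the equation between class
    parts survives.\<close>
  define h where "h S = (if S \<subseteq> {1..n} \<and> int (card S) = p then f S else 0)" for S
  have hk: "h \<in> koszul n p t d"
  proof (rule koszulI)
    fix S assume "S \<subseteq> {1..n}" "int (card S) = p"
    then show "h S \<in> homogeneous_polys n (d + int (sum t S))" using f[of S] by (simp only: h_def if_True simp_thms)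
  qed (auto simp: h_def)
  have hI: "h S \<in> I" for S using f by (simp add: h_def)
  have hR: "restr (?R S) (h S) = restr (?R S) (F S - kdiff n t u S)" for S
    using f[of S] koszul_eq_0[OF Fk, of S] koszul_eq_0[OF du, of S] unfolding h_def by auto
  have hmax: "\<not> lt (snd x + twist t S) (a + twist t (fst x))" if "a \<in> keys (h S)" for S a
    using that f[of S] unfolding h_def by (auto split: if_splits)
  \<comment> \<open>On the class of \<open>x\<close> this agrees with \<open>F\<close>. Outside the
    class only \<open>h\<close> contributes, with monomials that are not above \<open>x\<close>,
    hence strictly below it.\<close>
  define W where "W S = kdiff n t (proj ?R u) S + h S" for S
  have dp: "kdiff n t (proj ?R u) S = restr (?R S) (kdiff n t u S)" for S
    by (simp add: kdiff_proj[OF twist_invariant_sim[OF xB] koszul_cochains[OF u]] proj_def)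
  have Wk: "W \<in> koszul n p t d"
    unfolding W_def using koszul_add[OF kdiff_in_koszul[OF koszul_proj[OF u]]] hk by simp
  have WB: "W \<in> kbounds n I p t d"
    unfolding kbounds_def using Wk koszul_proj[OF u, of ?R] hI by (auto simp: W_def intro!: bexI[of _ "proj ?R u"])
  have WR: "ccoef W y = ccoef F y" if "?R (fst y) (snd y)" for y
  proof -
    have "restr (?R (fst y)) (W (fst y)) = restr (?R (fst y)) (F (fst y))"
      by (simp add: W_def dp restr_add hR restr_diff restr_restr)
    then have "coef (restr (?R (fst y)) (W (fst y))) (snd y) = coef (restr (?R (fst y)) (F (fst y))) (snd y)"
      by simp
    then show ?thesis using that by (simp add: coef_restr ccoef_def)
  qed
  have "lead_of r (ccoef W) x"
    unfolding lead_of_def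
  proof (intro conjI allI impI)
    show "ccoef W x \<noteq> 0" using WR[OF twist_sim_refl[OF xB]] x by (simp add: lead_of_def)
    fix y assume y: "ccoef W y \<noteq> 0"
    show "r y \<le> r x"
    proof (cases "?R (fst y) (snd y)")
      case True
      then have "ccoef F y \<noteq> 0" using y WR by simp
      then show ?thesis using x unfolding lead_of_def by blast
    next
      case False
      then have "coef (h (fst y)) (snd y) \<noteq> 0"
        using y by (simp add: ccoef_def W_def dp lookup_add coef_restr)
      then have "\<not> lt (snd x + twist t (fst y)) (snd y + twist t (fst x))"
        by (intro hmax) (simp add: in_keys_iff)
      then have "twist_lt t y x" using False by (simp add: twist_sim_def sim_def twist_lt_def)
      then show ?thesis using rank[OF koszul_supp[OF Wk y] xB] by simp
    qed
  qed
  then show ?thesis using that WB by blast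
qed

lemma leads_kcycles_subset: "leads r (ccoef ` kcycles n I p t d) \<subseteq> leads r (ccoef ` kcycles n lead_id p t d)"
  using lead_kcycle unfolding leads_def by fast

lemma leads_kbounds_subset: "leads r (ccoef ` kbounds n lead_id p t d) \<subseteq> leads r (ccoef ` kbounds n I p t d)"
proof
  fix x assume "x \<in> leads r (ccoef ` kbounds n lead_id p t d)"
  then obtain F where "F \<in> kbounds n lead_id p t d" "lead_of r (ccoef F) x"
    by (auto simp: leads_def)
  then obtain W where "W \<in> kbounds n I p t d" "lead_of r (ccoef W) x"
    by (rule lead_kbound)
  then show "x \<in> leads r (ccoef ` kbounds n I p t d)"
    by (auto simp: leads_def)
qed

lemma finite_leads: "finite (leads r (ccoef ` kcycles n J p t d))"
proof (rule finite_subset)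
  show "leads r (ccoef ` kcycles n J p t d) \<subseteq> koszul_basis n t d"
    by (rule leads_subset) (auto simp: kcycles_def dest: koszul_supp)
qed (rule fin)

end

text \<open>A certificate that Koszul cohomology has dimension at least \<open>card A\<close>. The
  index type is free: cohomology classes index the family for \<open>I\<close>, basis coordinates
  the one for the leading ideal.\<close>

definition koszul_indep ::
    "nat \<Rightarrow> 'k::field poly set \<Rightarrow> int \<Rightarrow> (nat \<Rightarrow> nat) \<Rightarrow> int \<Rightarrow> 'i set \<Rightarrow> ('i \<Rightarrow> 'k cochain) \<Rightarrow> bool" where
  "koszul_indep n I p t d A z \<longleftrightarrow> finite A \<and> (\<forall>v\<in>A. z v \<in> kcycles n I p t d) \<and>
     (\<forall>c. (\<lambda>S. \<Sum>v\<in>A. Const (c v) * z v S) \<in> kbounds n I p t d \<longrightarrow> (\<forall>v\<in>A. c v = 0))"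

lemma indep_mod_kbounds_iff:
  "indep_mod (ccoef ` kbounds n I p t d) A (\<lambda>v. ccoef (z v)) \<longleftrightarrow>
     (\<forall>c. (\<lambda>S. \<Sum>v\<in>A. Const (c v) * z v S) \<in> kbounds n I p t d \<longrightarrow> (\<forall>v\<in>A. c v = 0))"
  by (simp add: indep_mod_def ccoef_sum ccoef_image_iff)

context preordered_ideal
begin

lemma ranked_koszul_exists: obtains r where "ranked_koszul n lt I t d r"
proof -
  obtain r where r: "inj_on r (koszul_basis n t d)"
    "\<And>x y. x \<in> koszul_basis n t d \<Longrightarrow> y \<in> koszul_basis n t d \<Longrightarrow> twist_lt t x y \<Longrightarrow> r x < (r y :: nat)"
    using linear_extension_rank[OF finite_koszul_basis twist_lt_order] by blast
  have "ranked_koszul n lt I t d r"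
    by unfold_locales (use r finite_koszul_basis in auto)
  then show ?thesis by (rule that)
qed

text \<open>The number of leading coordinates of cycles minus that of boundaries is the dimension of
  cohomology. The first number can only grow and the second only shrink on passing to the leading
  ideal.\<close>

theorem koszul_semicontinuity:
  assumes z: "koszul_indep n I p t d A z"
  obtains A' :: "(nat set \<times> expo) set" and z' where "card A' = card A" "koszul_indep n lead_id p t d A' z'"
proof -
  obtain r where "ranked_koszul n lt I t d r" by (rule ranked_koszul_exists)
  then interpret ranked_koszul n lt I t d r .
  let ?Z = "\<lambda>J. ccoef ` kcycles n J p t d" and ?B = "\<lambda>J. ccoef ` kbounds n J p t d"
  have supp: "x \<in> koszul_basis n t d" if "f \<in> ?Z J" "f x \<noteq> 0" for f x J
    using that koszul_supp[where x = x] by (auto simp: kcycles_def)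
  have "card A + card (leads r (?B I)) \<le> card (leads r (?Z I))"
    by (rule indep_mod_card_le[of "?Z I" A "?B I" "\<lambda>v. ccoef (z v)", OF fun_subspace_kcycles supp])
       (use z in \<open>auto simp: koszul_indep_def indep_mod_kbounds_iff fun_subspace_kbounds
         intro!: image_mono kbounds_subset_kcycles\<close>)
  moreover have "card (leads r (?Z I)) \<le> card (leads r (?Z lead_id))"
    by (rule card_mono[OF finite_leads leads_kcycles_subset])
  moreover have "card (leads r (?B lead_id)) \<le> card (leads r (?B I))"
    by (rule card_mono[OF finite_subset[OF leads_mono[OF image_mono[OF kbounds_subset_kcycles]] finite_leads]
          leads_kbounds_subset])
  ultimately have le: "card A + card (leads r (?B lead_id)) \<le> card (leads r (?Z lead_id))" by linarith
  obtain A' :: "(nat set \<times> expo) set" and z0 where A': "finite A'" "card A' = card A"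
      "\<forall>v\<in>A'. z0 v \<in> ?Z lead_id" "indep_mod (?B lead_id) A' z0"
    using indep_mod_exists[OF _ image_mono[OF L.kbounds_subset_kcycles] le] supp by blast
  from A'(3) have "\<forall>v\<in>A'. \<exists>F. F \<in> kcycles n lead_id p t d \<and> z0 v = ccoef F" by blast
  then obtain z' where z': "\<And>v. v \<in> A' \<Longrightarrow> z' v \<in> kcycles n lead_id p t d \<and> z0 v = ccoef (z' v)"
    by metis
  have "indep_mod (?B lead_id) A' (\<lambda>v. ccoef (z' v))"
    using A'(4) z' unfolding indep_mod_def by (simp cong: sum.cong)
  then have "koszul_indep n lead_id p t d A' z'"
    using A'(1) z' by (simp add: koszul_indep_def indep_mod_kbounds_iff)
  then show ?thesis using that A'(2) by blast
qed

text \<open>The leading coordinates of cycles modulo \<open>I\<close> lie among those for the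
  leading ideal, where they are leading coordinates of boundaries, and these lie among those of
  boundaries modulo \<open>I\<close>. Elimination then gives equality of the spaces.\<close>

theorem koszul_acyclic_semicontinuity:
  assumes "kcycles n lead_id p t d = kbounds n lead_id p t d"
  shows "kcycles n I p t d = kbounds n I p t d"
proof -
  obtain r where "ranked_koszul n lt I t d r" by (rule ranked_koszul_exists)
  then interpret ranked_koszul n lt I t d r .
  have "ccoef ` kbounds n I p t d = ccoef ` kcycles n I p t d"
  proof (rule leads_eq_imp_eq[OF fun_subspace_kbounds fun_subspace_kcycles image_mono[OF kbounds_subset_kcycles]])
    show "leads r (ccoef ` kcycles n I p t d) \<subseteq> leads r (ccoef ` kbounds n I p t d)"
      using leads_kcycles_subset[of p] leads_kbounds_subset[of p] assms by simp
  qed (use koszul_supp in \<open>auto simp: kcycles_def\<close>)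
  then show ?thesis by (metis inj_image_eq_iff injI ccoef_inject)
qed

end

section \<open>Acyclicity in high degree\<close>

text \<open>Contraction with the basis vector of index \<open>l\<close> in the exterior
  algebra.\<close>

definition slice :: "nat \<Rightarrow> 'k::field cochain \<Rightarrow> 'k cochain" where
  "slice l F S = (if l \<in> S then 0 else ksign S l * F (insert l S))"

text \<open>The slice lives on positions without \<open>l\<close>, which allows the exponent at
  \<open>l\<close> to be reset to any \<open>k\<close>. The factor of the denominator lost with
  \<open>l\<close> becomes the shift of the degree.\<close>

lemma koszul_slice:
  assumes H: "H \<in> koszul n p t d"
  shows "slice l H \<in> koszul n (p - 1) (t(l := k)) (d + int (t l))"
proof (rule koszulI)
  fix S assume S: "S \<subseteq> {1..n}" "int (card S) = p - 1"
  show "slice l H S \<in> homogeneous_polys n (d + int (t l) + int (sum (t(l := k)) S))"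
  proof (cases "l \<in> S")
    case False
    then have "sum (t(l := k)) S = sum t S" by (auto intro!: sum.cong)
    moreover have "sum t (insert l S) = t l + sum t S" using False finite_subset[OF S(1)] by simp
    ultimately have eq: "d + int (sum t (insert l S)) = d + int (t l) + int (sum (t(l := k)) S)" by linarith
    have "H (insert l S) \<in> homogeneous_polys n (d + int (t l) + int (sum (t(l := k)) S))"
      using koszul_homogeneous[OF H, of "insert l S"] unfolding eq .
    then have "ksign S l * H (insert l S) \<in> homogeneous_polys n (d + int (t l) + int (sum (t(l := k)) S))"
      unfolding ksign_def by (rule hom_sign)
    then show ?thesis using False by (simp add: slice_def del: of_nat_sum)
  qed (simp add: slice_def)
next
  fix S assume S: "\<not> (S \<subseteq> {1..n} \<and> int (card S) = p - 1)"
  show "slice l H S = 0"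
  proof (cases "l \<in> S")
    case False
    have "\<not> (insert l S \<subseteq> {1..n} \<and> int (card (insert l S)) = p)"
    proof
      assume *: "insert l S \<subseteq> {1..n} \<and> int (card (insert l S)) = p"
      then have "finite S" by (meson finite_atLeastAtMost finite_insert finite_subset)
      then show False using * S False by simp
    qed
    then have "H (insert l S) = 0" by (rule koszul_eq_0[OF H])
    then show ?thesis by (simp add: slice_def)
  qed (simp add: slice_def)
qed

lemma ksign_remove_self [simp]: "ksign (T - {l}) l = ksign T l" "ksign (insert l T) l = ksign T l"
proof -
  have "{k \<in> T - {l}. k < l} = {k \<in> T. k < l}" "{k \<in> insert l T. k < l} = {k \<in> T. k < l}" by auto
  then show "ksign (T - {l}) l = ksign T l" "ksign (insert l T) l = ksign T l" by (simp_all add: ksign_def)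
qed

lemma ksign_square: "ksign T i * ksign T i = 1"
  using ksign_ksign[of T i 1] by simp

lemma ksign_insert:
  assumes "l \<notin> T" "i \<in> T"
  shows "ksign T i * ksign (T - {i}) l = - (ksign T l * ksign (insert l T) i :: 'k::field poly)"
proof -
  have ne: "i \<noteq> l" using assms by auto
  have rem: "insert l T - {l} = T" "insert l T - {i} = insert l (T - {i})" using assms ne by auto
  have "ksign (insert l T) i * ksign (T - {i}) l = - (ksign T l * ksign T i :: 'k poly)"
  proof (cases "i < l")
    case True
    then have "ksign T l * ksign T i = - (ksign (insert l T) i * ksign (T - {i}) l :: 'k poly)"
      using ksign_swap[of i "insert l T" l] assms by (simp add: rem)
    then show ?thesis by simp
  next
    case False
    then show ?thesis using ksign_swap[of l "insert l T" i] assms ne by (simp add: rem)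
  qed
  \<comment> \<open>Signs are their own inverses, so the factor \<open>ksign (insert l T) i\<close>
    can be moved to the other side.\<close>
  moreover have "a * b = - (c * e)" if "e * e = 1" "a * a = 1" "e * b = - (c * a)" for a b c e :: "'k poly"
  proof -
    have "a * b = a * (e * e) * b" using that(1) by simp
    also have "\<dots> = a * e * (e * b)" by (simp add: mult_ac)
    also have "\<dots> = - ((a * a) * (c * e))" by (simp only: that(3)) (simp add: mult_ac)
    finally show ?thesis by (simp add: that(2))
  qed
  ultimately show ?thesis using ksign_square by blast
qed

text \<open>Contraction anticommutes with the differential on cochains supported at positions
  containing \<open>l\<close>. The exponent at \<open>l\<close> may change, as the index
  \<open>l\<close> is removed on neither side.\<close>

lemma kdiff_slice:
  assumes "l \<notin> T" and F: "\<And>S. l \<notin> S \<Longrightarrow> F S = 0" and t: "\<And>i. i \<noteq> l \<Longrightarrow> t' i = t i"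
  shows "kdiff n t' (slice l F) T = - (ksign T l * kdiff n t F (insert l T))"
proof -
  let ?A = "T \<inter> {1..n}"
  have "kdiff n t F (insert l T) =
      (\<Sum>i\<in>?A. ksign (insert l T) i * (monom (single i (t i)) * F (insert l (T - {i}))))"
    unfolding kdiff_def
  proof (rule sum.mono_neutral_cong_right)
    show "\<forall>i\<in>insert l T \<inter> {1..n} - ?A.
        ksign (insert l T) i * (monom (single i (t i)) * F (insert l T - {i})) = 0"
      using F assms(1) by auto
    fix i assume "i \<in> ?A"
    then have "insert l T - {i} = insert l (T - {i})" using assms(1) by auto
    then show "ksign (insert l T) i * (monom (single i (t i)) * F (insert l T - {i})) =
        ksign (insert l T) i * (monom (single i (t i)) * F (insert l (T - {i})))" by simp
  qed auto
  then have "- (ksign T l * kdiff n t F (insert l T)) =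
     (\<Sum>i\<in>?A. - (ksign T l * ksign (insert l T) i) * (monom (single i (t i)) * F (insert l (T - {i}))))"
    by (simp add: sum_distrib_left sum_negf mult.assoc)
  also have "\<dots> = (\<Sum>i\<in>?A. ksign T i * (monom (single i (t' i)) * slice l F (T - {i})))"
  proof (rule sum.cong[OF refl])
    fix i assume i: "i \<in> ?A"
    then have "i \<noteq> l" using assms(1) by blast
    then have "t' i = t i" by (rule t)
    then show "- (ksign T l * ksign (insert l T) i) * (monom (single i (t i)) * F (insert l (T - {i}))) =
        ksign T i * (monom (single i (t' i)) * slice l F (T - {i}))"
      using i assms(1) by (simp add: slice_def ksign_insert[symmetric] mult_ac)
  qed
  finally show ?thesis by (simp add: kdiff_def)
qed

lemma kdiff_only_without:
  assumes "l \<in> T" "l \<in> {1..n}" "\<And>S. l \<in> S \<Longrightarrow> F S = 0"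
  shows "kdiff n t F T = ksign T l * (monom (single l (t l)) * F (T - {l}))"
proof -
  have "kdiff n t F T = (\<Sum>i\<in>T \<inter> {1..n}. if l = i then ksign T l * (monom (single l (t l)) * F (T - {l})) else 0)"
    unfolding kdiff_def using assms by (intro sum.cong) auto
  also have "\<dots> = (if l \<in> T \<inter> {1..n} then ksign T l * (monom (single l (t l)) * F (T - {l})) else 0)"
    by (rule sum.delta') simp
  finally show ?thesis using assms by simp
qed

lemma kdiff_cong_without:
  assumes "l \<notin> T" "\<And>S. l \<notin> S \<Longrightarrow> F S = G S" "\<And>i. i \<noteq> l \<Longrightarrow> t' i = t i"
  shows "kdiff n t' F T = kdiff n t G T"
  unfolding kdiff_def
proof (rule sum.cong[OF refl])
  fix i assume i: "i \<in> T \<inter> {1..n}"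
  then have "i \<noteq> l" using assms(1) by blast
  then have "t' i = t i" by (rule assms(3))
  moreover have "F (T - {i}) = G (T - {i})" using assms(1) by (intro assms(2)) simp
  ultimately show "ksign T i * (monom (single i (t' i)) * F (T - {i})) =
      ksign T i * (monom (single i (t i)) * G (T - {i}))" by simp
qed

lemma hom_monom_cancel:
  assumes "monom c * g \<in> homogeneous_polys n (e + int (expo_deg c))"
  shows "g \<in> homogeneous_polys n e"
  using assms by (auto simp: hom_iff polys_def keys_monom_mult monomials_add_iff expo_deg_add)

lemma monom_single_divides:
  assumes "\<And>a. a \<in> keys f \<Longrightarrow> k \<le> coef a l"
  shows "\<exists>g. f = monom (single l k) * g"
proof
  let ?c = "single l k"
  have *: "?c + (a - ?c) = a" if "a \<in> keys f" for a
    using assms[OF that] by (intro poly_mapping_eqI) (auto simp: lookup_add lookup_minus lookup_single when_def)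
  have "f = (\<Sum>a\<in>keys f. Const (coef f a) * monom a)" by (rule poly_eq_sum_monom)
  also have "\<dots> = (\<Sum>a\<in>keys f. Const (coef f a) * monom (?c + (a - ?c)))"
    using * by simp
  also have "\<dots> = monom ?c * (\<Sum>a\<in>keys f. Const (coef f a) * monom (a - ?c))"
    by (simp add: monom_add sum_distrib_left mult_ac)
  finally show "f = monom ?c * (\<Sum>a\<in>keys f. Const (coef f a) * monom (a - ?c))" .
qed

section \<open>Stabilization of monomial ideals along each variable\<close>

lemma nondecreasing_subsequence:
  fixes f :: "nat \<Rightarrow> nat"
  obtains g :: "nat \<Rightarrow> nat" where "strict_mono g" "\<And>i j. i \<le> j \<Longrightarrow> f (g i) \<le> f (g j)"
proof -
  \<comment> \<open>Indices whose value is minimal among all later values: one occurs beyond every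
    \<open>N\<close>, and along them \<open>f\<close> cannot decrease.\<close>
  define A where "A = {i. \<forall>j\<ge>i. f i \<le> f j}"
  have "\<exists>i\<ge>N. i \<in> A" for N
  proof -
    define i where "i = arg_min f (\<lambda>i. N \<le> i)"
    have "N \<le> i" unfolding i_def by (rule arg_min_natI[of _ N]) simp
    moreover have "f i \<le> f j" if "N \<le> j" for j unfolding i_def using that by (rule arg_min_nat_le)
    ultimately have "i \<in> A" unfolding A_def by (blast intro: le_trans)
    with \<open>N \<le> i\<close> show ?thesis by blast
  qed
  then have "infinite A" by (simp only: infinite_nat_iff_unbounded_le simp_thms)
  from infinite_enumerate[OF this] obtain g :: "nat \<Rightarrow> nat" where g: "strict_mono g" "\<forall>i. g i \<in> A"
    by blast
  have "f (g i) \<le> f (g j)" if "i \<le> j" for i j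
  proof -
    have "g i \<le> g j" using g(1) that by (simp only: strict_mono_less_eq)
    moreover have "g i \<in> A" using g(2) by blast
    ultimately show ?thesis unfolding A_def by blast
  qed
  then show ?thesis using that g(1) by blast
qed

lemma nondecreasing_subsequences:
  fixes f :: "nat \<Rightarrow> nat \<Rightarrow> nat"
  shows "\<exists>g :: nat \<Rightarrow> nat. strict_mono g \<and> (\<forall>l\<in>{1..n}. \<forall>i j. i \<le> j \<longrightarrow> f (g i) l \<le> f (g j) l)"
proof (induction n)
  case 0
  show ?case by (rule exI[of _ "id :: nat \<Rightarrow> nat"]) (simp add: strict_mono_def)
next
  case (Suc n)
  then obtain g :: "nat \<Rightarrow> nat" where g: "strict_mono g"
      "\<And>l i j. l \<in> {1..n} \<Longrightarrow> i \<le> j \<Longrightarrow> f (g i) l \<le> f (g j) l"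
    by blast
  obtain h :: "nat \<Rightarrow> nat" where h: "strict_mono h" "\<And>i j. i \<le> j \<Longrightarrow> f (g (h i)) (Suc n) \<le> f (g (h j)) (Suc n)"
    using nondecreasing_subsequence[of "\<lambda>i. f (g i) (Suc n)"] by blast
  have "f ((g \<circ> h) i) l \<le> f ((g \<circ> h) j) l" if "l \<in> {1..Suc n}" "i \<le> j" for l i j
  proof (cases "l = Suc n")
    case False
    then have "l \<in> {1..n}" using that by auto
    moreover have "h i \<le> h j" using h(1) that(2) by (simp add: strict_mono_less_eq)
    ultimately show ?thesis using g(2) by simp
  qed (use h that in simp)
  moreover have "strict_mono (g \<circ> h)" using g h by (auto simp: strict_mono_def)
  ultimately show ?case by blast
qed

text \<open>A form of Dickson's lemma.\<close>

lemma monomial_ideal_stable: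
  assumes N: "\<And>a c. a \<in> N \<Longrightarrow> c \<in> monomials n \<Longrightarrow> a + c \<in> N" "N \<subseteq> monomials n"
  shows "\<exists>D. \<forall>a\<in>monomials n. \<forall>l\<in>{1..n}. \<forall>k. D \<le> coef a l \<longrightarrow> a + single l k \<in> N \<longrightarrow> a \<in> N"
proof (rule ccontr)
  assume "\<not> ?thesis"
  then have "\<forall>D. \<exists>a l k. a \<in> monomials n \<and> l \<in> {1..n} \<and> D \<le> coef a l \<and>
      a + single l k \<in> N \<and> a \<notin> N" by blast
  then obtain a l k where a: "\<And>D. a D \<in> monomials n \<and> l D \<in> {1..n} \<and> D \<le> coef (a D) (l D) \<and>
      a D + single (l D) (k D) \<in> N \<and> a D \<notin> N" by metis
  define c where "c D = a D + single (l D) (k D)" for D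
  obtain g :: "nat \<Rightarrow> nat" where g: "strict_mono g" "\<And>l i j. l \<in> {1..n} \<Longrightarrow> i \<le> j \<Longrightarrow> coef (c (g i)) l \<le> coef (c (g j)) l"
    using nondecreasing_subsequences[of n "\<lambda>i. coef (c i)"] by blast
  \<comment> \<open>A strictly increasing \<open>g\<close> satisfies \<open>g m \<ge> m\<close>, so
    this counterexample comes late enough for \<open>D\<close> to bound every exponent of
    \<open>c (g 0)\<close>.\<close>
  define D where "D = g (expo_deg (c (g 0)))"
  have cN: "c (g 0) \<in> N" using a by (simp add: c_def)
  then have cM: "c (g 0) \<in> monomials n" using N by blast
  have bound: "coef (c (g 0)) m \<le> D" for m
  proof -
    have "coef (c (g 0)) m \<le> expo_deg (c (g 0))"
    proof (cases "m \<in> keys (c (g 0))")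
      case True
      then show ?thesis unfolding expo_deg_def by (intro member_le_sum) auto
    qed (simp add: in_keys_iff)
    also have "\<dots> \<le> D" unfolding D_def using g(1) by (rule strict_mono_imp_increasing)
    finally show ?thesis .
  qed
  \<comment> \<open>The monomial \<open>c (g 0)\<close> divides \<open>a D\<close>: at
    \<open>l D\<close> because the exponent there is at least \<open>D\<close>, elsewhere because
    \<open>a D\<close> agrees with \<open>c D\<close>, which dominates
    \<open>c (g 0)\<close>.\<close>
  have le: "coef (c (g 0)) m \<le> coef (a D) m" for m
  proof (cases "m \<in> {1..n}")
    case False
    then have "m \<notin> keys (c (g 0))" using cM by (auto simp: monomials_def)
    then show ?thesis by (simp add: in_keys_iff)
  next
    case True
    show ?thesis
    proof (cases "m = l D")
      case True
      then show ?thesis using bound[of m] a[of D] by simp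
    next
      case False
      then have "coef (a D) m = coef (c D) m" by (simp add: c_def lookup_add lookup_single when_def)
      then show ?thesis using g(2)[OF \<open>m \<in> {1..n}\<close>, of 0] by (simp add: D_def)
    qed
  qed
  have split: "a D = c (g 0) + (a D - c (g 0))"
    using le by (intro poly_mapping_eqI) (simp add: lookup_add lookup_minus)
  then have "a D - c (g 0) \<in> monomials n" using a[of D] monomials_add_iff by metis
  then have "a D \<in> N" using N(1)[OF cN] split by metis
  then show False using a by blast
qed

section \<open>Monomial ideals: contraction along a variable with large exponent\<close>

locale monomial_ideal = homog_ideal n J for n and J :: "'k::field poly set" +
  fixes N :: "expo set" and D :: nat
  assumes mem: "f \<in> J \<longleftrightarrow> f \<in> polys n \<and> keys f \<subseteq> N"
    and stable: "\<And>a l k. a \<in> monomials n \<Longrightarrow> l \<in> {1..n} \<Longrightarrow> D \<le> coef a l \<Longrightarrow>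
      a + single l k \<in> N \<Longrightarrow> a \<in> N"
begin

text \<open>The Laurent exponent of the variable \<open>l\<close> in the fraction represented by
  \<open>a\<close> at \<open>S\<close> is at least \<open>D\<close>.\<close>

definition large :: "(nat \<Rightarrow> nat) \<Rightarrow> nat \<Rightarrow> nat set \<Rightarrow> expo \<Rightarrow> bool" where
  "large t l S a \<longleftrightarrow> D + (if l \<in> S then t l else 0) \<le> coef a l"

text \<open>This is the purpose of \<open>D\<close>: on monomials whose exponent at \<open>l\<close>
  is at least \<open>D\<close>, powers of that variable are nonzerodivisors modulo
  \<open>J\<close>.\<close>

lemma monomial_cancel:
  assumes "monom (single l k) * g \<in> J" "g \<in> polys n" "l \<in> {1..n}"
    and "\<And>a. a \<in> keys g \<Longrightarrow> D \<le> coef a l"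
  shows "g \<in> J"
proof -
  have "a \<in> N" if "a \<in> keys g" for a
  proof (rule stable[of a l k])
    show "a + single l k \<in> N"
      using assms(1) that by (auto simp: mem keys_monom_mult add.commute)
  qed (use assms that in \<open>auto simp: polys_def\<close>)
  then show ?thesis using assms(2) by (auto simp: mem)
qed

text \<open>The contracting homotopy is contraction with \<open>l\<close> followed by division by
  \<open>?m\<close>, possible since at positions containing \<open>l\<close> the monomials of
  \<open>F\<close> are multiples of \<open>?m\<close>. At such positions \<open>kdiff n t u\<close>
  equals \<open>F\<close>. At the others the cycle condition at \<open>insert l T\<close> shows that
  \<open>?m\<close> times the error lies in \<open>J\<close>, and \<open>?m\<close> can be
  cancelled.\<close>

lemma kcycle_large:
  assumes F: "F \<in> kcycles n J p t d" and l: "l \<in> {1..n}"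
    and large: "\<And>S a. a \<in> keys (F S) \<Longrightarrow> large t l S a"
  shows "F \<in> kbounds n J p t d"
proof -
  let ?m = "monom (single l (t l)) :: 'k poly"
  have Fk: "F \<in> koszul n p t d" and FI: "\<And>T. kdiff n t F T \<in> J" using F by (auto simp: kcycles_def)
  have "\<exists>g. F (insert l S) = ?m * g" for S
    by (rule monom_single_divides) (use large[of _ "insert l S"] in \<open>fastforce simp: large_def\<close>)
  then obtain G where G: "\<And>S. F (insert l S) = ?m * G S" by metis
  define u where "u S = (if l \<in> S then 0 else ksign S l * G S)" for S
  define Fl where "Fl S = (if l \<in> S then F S else 0)" for S
  define F0 where "F0 S = (if l \<in> S then 0 else F S)" for S
  have mu: "?m * u S = slice l Fl S" for S
    by (simp add: u_def slice_def Fl_def G mult_ac)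
  have slk: "slice l Fl \<in> koszul n (p - 1) t (d + int (t l))"
    using koszul_slice[OF koszul_restrict[OF Fk, of "\<lambda>S. l \<in> S"], of l "t l"] by (simp add: Fl_def[abs_def])
  have uk: "u \<in> koszul n (p - 1) t d"
  proof (rule koszulI)
    fix S
    have "?m * u S \<in> homogeneous_polys n (d + int (sum t S) + int (expo_deg (single l (t l))))"
      using koszul_homogeneous[OF slk, of S] by (simp add: mu add_ac del: of_nat_sum)
    then show "u S \<in> homogeneous_polys n (d + int (sum t S))" by (rule hom_monom_cancel)
  next
    fix S assume "\<not> (S \<subseteq> {1..n} \<and> int (card S) = p - 1)"
    then have "?m * u S = 0" unfolding mu by (rule koszul_eq_0[OF slk])
    then show "u S = 0" using monom_mult_cancel[of _ "u S" 0] by simp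
  qed
  have "F T - kdiff n t u T \<in> J" for T
  proof (cases "l \<in> T")
    case True
    have "kdiff n t u T = ksign T l * (?m * u (T - {l}))"
      by (rule kdiff_only_without[OF True l]) (simp add: u_def)
    also have "\<dots> = ksign T l * slice l Fl (T - {l})" by (simp only: mu)
    also have "\<dots> = F T" using True by (simp add: slice_def Fl_def insert_absorb ksign_ksign)
    finally show ?thesis by simp
  next
    case False
    have "kdiff n t F (insert l T) = kdiff n t Fl (insert l T) + kdiff n t F0 (insert l T)"
    proof -
      have "F = (\<lambda>S. Fl S + F0 S)" by (auto simp: Fl_def F0_def)
      then show ?thesis by (metis kdiff_add)
    qed
    moreover have "kdiff n t F0 (insert l T) = ksign T l * (?m * F T)"
      using kdiff_only_without[of l "insert l T" n F0 t] l False by (simp add: F0_def)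
    ultimately have "ksign T l * kdiff n t Fl (insert l T) = ksign T l * kdiff n t F (insert l T) - ?m * F T"
      by (simp add: algebra_simps ksign_ksign)
    moreover have "?m * kdiff n t u T = - (ksign T l * kdiff n t Fl (insert l T))"
      using kdiff_slice[OF False, of Fl t t n] kdiff_mult[of n t ?m u] by (simp add: mu Fl_def)
    ultimately have "?m * (F T - kdiff n t u T) = ksign T l * kdiff n t F (insert l T)"
      by (simp add: right_diff_distrib)
    then have "?m * (F T - kdiff n t u T) \<in> J" using sign_in[OF FI] by (simp add: ksign_def)
    moreover have "F T - kdiff n t u T \<in> polys n"
      by (intro polys_diff cochains_polys[OF koszul_cochains[OF Fk]]
          cochains_polys[OF koszul_cochains[OF kdiff_in_koszul[OF uk]]])
    \<comment> \<open>Division by \<open>?m\<close> leaves exponents of at least \<open>D\<close>,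
      and multiplication by other variables does not lower them; so \<open>monomial_cancel\<close>
      applies.\<close>
    moreover have "D \<le> coef a l" if a: "a \<in> keys (F T - kdiff n t u T)" for a
    proof -
      have ukeys: "D \<le> coef a l" if "a \<in> keys (u S)" for S a
      proof -
        have nl: "l \<notin> S" using that by (auto simp: u_def)
        have "single l (t l) + a \<in> keys (?m * u S)"
          using that by (simp add: keys_monom_mult)
        then have "single l (t l) + a \<in> keys (F (insert l S))"
          using nl by (simp add: mu slice_def Fl_def keys_ksign_mult)
        then show ?thesis using large by (fastforce simp: large_def lookup_add)
      qed
      have "a \<in> keys (F T) \<or> a \<in> keys (kdiff n t u T)"
        using subsetD[OF keys_diff a] by simp
      then show ?thesis
      proof
        assume "a \<in> keys (F T)"
        then show ?thesis using large False by (fastforce simp: large_def)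
      next
        assume "a \<in> keys (kdiff n t u T)"
        then obtain i b where "b \<in> keys (u (T - {i}))" "a = single i (t i) + b" by (rule keys_kdiff)
        then show ?thesis using ukeys[of b] by (simp add: lookup_add trans_le_add2)
      qed
    qed
    ultimately show ?thesis using monomial_cancel[OF _ _ l] by blast
  qed
  then show ?thesis using Fk uk by (auto simp: kbounds_def)
qed

text \<open>The Laurent exponents of a monomial in degree \<open>d\<close> add up to
  \<open>d\<close>. Above \<open>n * D\<close> one of them is large, so \<open>F\<close> splits into
  pieces to which \<open>kcycle_large\<close> applies. The bound depends on neither \<open>p\<close>
  nor \<open>t\<close>.\<close>

lemma acyclic_in_high_degree:
  assumes d: "int (n * D) < d"
  shows "kcycles n J p t d = kbounds n J p t d"
proof
  show "kbounds n J p t d \<subseteq> kcycles n J p t d" by (rule kbounds_subset_kcycles)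
  show "kcycles n J p t d \<subseteq> kbounds n J p t d"
  proof
    fix F assume F: "F \<in> kcycles n J p t d"
    then have Fk: "F \<in> koszul n p t d" and FJ: "\<And>T. kdiff n t F T \<in> J" by (auto simp: kcycles_def)
    \<comment> \<open>Each monomial goes to its first large variable, which makes the pieces
      disjoint. Largeness depends only on the Laurent exponent, whence the invariance.\<close>
    define R where "R l S a \<longleftrightarrow> large t l S a \<and> (\<forall>k\<in>{1..n}. k < l \<longrightarrow> \<not> large t k S a)" for l S a
    have inv: "twist_invariant n t (R l)" for l
    proof -
      have "large t k T (single i (t i) + a) \<longleftrightarrow> large t k (T - {i}) a" if "i \<in> T" for k T i a
        using that by (cases "k = i") (simp_all add: large_def lookup_add lookup_single when_def)
      then show ?thesis by (simp add: twist_invariant_def R_def)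
    qed
    have "proj (R l) F \<in> kbounds n J p t d" if l: "l \<in> {1..n}" for l
    proof (rule kcycle_large[OF _ l])
      have "restr Q f \<in> J" if "f \<in> J" for Q f
        using that by (auto simp: mem polys_restr keys_restr)
      then have "kdiff n t (proj (R l) F) T \<in> J" for T
        using FJ by (simp add: kdiff_proj[OF inv koszul_cochains[OF Fk]] proj_def)
      then show "proj (R l) F \<in> kcycles n J p t d" using koszul_proj[OF Fk] by (simp add: kcycles_def)
    qed (simp add: proj_def keys_restr R_def)
    then have "(\<lambda>S. \<Sum>l\<in>{1..n}. proj (R l) F S) \<in> kbounds n J p t d" by (rule kbounds_sum)
    moreover have "(\<lambda>S. \<Sum>l\<in>{1..n}. proj (R l) F S) = F"
    proof (rule ext, rule poly_mapping_eqI)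
      fix S a
      show "coef (\<Sum>l\<in>{1..n}. proj (R l) F S) a = coef (F S) a"
      proof (cases "a \<in> keys (F S)")
        case True
        then have S: "S \<subseteq> {1..n}" using cochains_eq_0[OF koszul_cochains[OF Fk], of S] by fastforce
        have a: "a \<in> monomials n" "int (expo_deg a) = d + int (sum t S)"
          using koszul_homogeneous[OF Fk, of S] True by (auto simp: hom_iff polys_def)
        have "\<exists>l. l \<in> {1..n} \<and> large t l S a"
        proof (rule ccontr)
          assume "\<not> ?thesis"
          then have small: "coef a l \<le> D + (if l \<in> S then t l else 0)" if "l \<in> {1..n}" for l
            using that unfolding large_def by (meson nat_le_linear)
          have "expo_deg a = (\<Sum>l\<in>{1..n}. coef a l)"
            using a(1) by (intro expo_deg_superset) (auto simp: monomials_def)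
          also have "\<dots> \<le> (\<Sum>l\<in>{1..n}. D + (if l \<in> S then t l else 0))" by (rule sum_mono) (rule small)
          also have "\<dots> = n * D + sum t S"
            using S by (simp add: sum.distrib sum.If_cases Int_absorb1)
          finally show False using a(2) d by linarith
        qed
        then obtain l where l: "l \<in> {1..n} \<and> large t l S a" "\<And>k. k < l \<Longrightarrow> \<not> (k \<in> {1..n} \<and> large t k S a)"
          using exists_least_iff[of "\<lambda>l. l \<in> {1..n} \<and> large t l S a"] by blast
        have Riff: "R k S a \<longleftrightarrow> l = k" if "k \<in> {1..n}" for k
          unfolding R_def using l that by (metis linorder_neqE_nat)
        have "coef (\<Sum>l\<in>{1..n}. proj (R l) F S) a = (\<Sum>k\<in>{1..n}. if l = k then coef (F S) a else 0)"
          unfolding lookup_sum proj_def coef_restr using Riff by (intro sum.cong) auto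
        also have "\<dots> = (if l \<in> {1..n} then coef (F S) a else 0)"
          by (rule sum.delta') simp
        finally show ?thesis using l by simp
      qed (simp add: lookup_sum proj_def coef_restr in_keys_iff sum.neutral)
    qed
    ultimately show "F \<in> kbounds n J p t d" by simp
  qed
qed

end

section \<open>Vanishing in high degrees for arbitrary homogeneous ideals\<close>

lemma monomial_preorder_less: "monomial_preorder n (<)"
  unfolding monomial_preorder_def weak_order_on_def
proof (intro conjI ballI)
  have "{(a, b). a \<in> monomials n \<and> b \<in> monomials n \<and> \<not> a < b \<and> \<not> b < a} = Id_on (monomials n)"
    by (auto simp: Id_on_def)
  then show "equiv (monomials n) {(a, b). a \<in> monomials n \<and> b \<in> monomials n \<and> \<not> a < b \<and> \<not> b < a}"
    by (simp only: equiv_def) (auto simp: refl_on_def sym_def trans_def)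
qed (auto simp: irreflp_on_def transp_on_def)

context homog_ideal
begin

text \<open>The auxiliary order \<open><\<close> on exponent vectors is lexicographic. It has no
  ties between distinct monomials, so the leading ideal is a monomial ideal, and acyclicity passes
  back from it to \<open>I\<close>.\<close>

theorem koszul_acyclic_high_degree:
  "\<exists>d0. \<forall>p t d. d0 \<le> d \<longrightarrow> kcycles n I p t d = kbounds n I p t d"
proof -
  interpret P: preordered_ideal n "(<)" I
    by unfold_locales (rule monomial_preorder_less)
  let ?J = "leading_ideal n (<) I"
  have sim: "P.sim a b \<longleftrightarrow> a = b" for a b by (auto simp: P.sim_def)
  define N where "N = {a \<in> monomials n. monom a \<in> ?J}"
  \<comment> \<open>By \<open>lead_component\<close> the term of \<open>f\<close> at
    \<open>a\<close> is the top term of some \<open>g\<close> in \<open>I\<close>; it is therefore a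
    leading part, and rescaling gives the monomial itself.\<close>
  have keysN: "a \<in> N" if f: "f \<in> ?J" and a: "a \<in> keys f" for f a
  proof -
    have aM: "a \<in> monomials n" using P.polysD[OF P.L.in_polys[OF f] a] .
    let ?e = "int (expo_deg a)"
    have "homogeneous_part ?e f \<in> ?J" "homogeneous_part ?e f \<in> homogeneous_polys n ?e"
      using P.L.part_in[OF f] homogeneous_part_in[OF P.L.in_polys[OF f]] by auto
    from P.lead_component[OF this aM, of 0] obtain g where g: "g \<in> I"
        "restr (\<lambda>b. b = a) g = restr (\<lambda>b. b = a) (homogeneous_part ?e f)"
        "\<And>b. b \<in> keys g \<Longrightarrow> \<not> a < b"
      by (auto simp: sim)
    have "restr (\<lambda>b. b = a) (homogeneous_part ?e f) = Const (coef f a) * monom a"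
      by (rule poly_mapping_eqI)
        (auto simp: coef_restr homogeneous_part_eq Const_mult monom_def lookup_single when_def)
    moreover have "restr (\<lambda>b. b = a) g \<in> ?J"
      using P.restr_sim_cases[OF in_polys[OF g(1)] aM, of 0] g(3) P.leading_part_in_lead[OF g(1)] P.L.zero_in
      by (auto simp: sim)
    ultimately have "Const (coef f a) * monom a \<in> ?J" using g(2) by simp
    then have "Const (inverse (coef f a)) * (Const (coef f a) * monom a) \<in> ?J" by (rule P.L.Const_in)
    moreover have "Const (inverse (coef f a)) * (Const (coef f a) * monom a) = monom a"
      using a by (simp add: mult.assoc[symmetric] Const_times[symmetric] in_keys_iff)
    ultimately show "a \<in> N" using aM by (simp add: N_def)
  qed
  have memN: "f \<in> ?J \<longleftrightarrow> f \<in> polys n \<and> keys f \<subseteq> N" for f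
  proof
    assume "f \<in> polys n \<and> keys f \<subseteq> N"
    then have "(\<Sum>a\<in>keys f. Const (coef f a) * monom a) \<in> ?J"
      by (intro P.L.sum_in P.L.Const_in) (auto simp: N_def)
    then show "f \<in> ?J" by (simp only: poly_eq_sum_monom[symmetric])
  qed (use keysN P.L.in_polys in auto)
  have "a + c \<in> N" if "a \<in> N" "c \<in> monomials n" for a c
    using that P.L.monom_in[of c "monom a"] by (auto simp: N_def monomials_add_iff monom_add mult.commute)
  moreover have "N \<subseteq> monomials n" by (auto simp: N_def)
  ultimately obtain D where D: "\<And>a l k. a \<in> monomials n \<Longrightarrow> l \<in> {1..n} \<Longrightarrow> D \<le> coef a l \<Longrightarrow>
      a + single l k \<in> N \<Longrightarrow> a \<in> N"
    using monomial_ideal_stable[of N n] by blast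
  interpret M: monomial_ideal n ?J N D
    by unfold_locales (use memN D in blast)+
  have "kcycles n I p t d = kbounds n I p t d" if "int (n * D) + 1 \<le> d" for p t d
    using M.acyclic_in_high_degree[of d p t] that by (intro P.koszul_acyclic_semicontinuity) simp
  then show ?thesis by blast
qed

end

section \<open>Changing the exponents of the Koszul complex\<close>

text \<open>The transition map of the direct system: a fraction is rewritten over the larger
  denominator. The truncated subtraction is exact wherever \<open>t \<le> t'\<close>.\<close>

definition stretch :: "(nat \<Rightarrow> nat) \<Rightarrow> (nat \<Rightarrow> nat) \<Rightarrow> 'k::field cochain \<Rightarrow> 'k cochain" where
  "stretch t t' F S = monom (twist (\<lambda>i. t' i - t i) S) * F S"

lemma stretch_koszul:
  assumes F: "F \<in> koszul n p t d" and le: "\<And>i. i \<in> {1..n} \<Longrightarrow> t i \<le> t' i"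
  shows "stretch t t' F \<in> koszul n p t' d"
proof (rule koszulI)
  fix S assume S: "S \<subseteq> {1..n}" "int (card S) = p"
  have "sum t' S = sum t S + (\<Sum>i\<in>S. t' i - t i)"
    unfolding sum.distrib[symmetric] using S(1) le by (intro sum.cong) auto
  then show "stretch t t' F S \<in> homogeneous_polys n (d + int (sum t' S))"
    unfolding stretch_def
    by (intro hom_monom_mult[OF koszul_homogeneous[OF F]] twist_in_monomials S)
       (simp only: expo_deg_twist of_nat_add add.assoc)
qed (simp add: stretch_def koszul_eq_0[OF F])

lemma kdiff_stretch:
  assumes F: "F \<in> cochains n" and le: "\<And>i. i \<in> {1..n} \<Longrightarrow> t i \<le> t' i"
  shows "kdiff n t' (stretch t t' F) = stretch t t' (kdiff n t F)"
proof
  fix T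
  show "kdiff n t' (stretch t t' F) T = stretch t t' (kdiff n t F) T"
  proof (cases "T \<subseteq> {1..n}")
    case True
    let ?\<delta> = "\<lambda>i. t' i - t i"
    have "ksign T i * (monom (single i (t' i)) * stretch t t' F (T - {i})) =
        monom (twist ?\<delta> T) * (ksign T i * (monom (single i (t i)) * F (T - {i})))" if i: "i \<in> T" for i
    proof -
      have "t' i = t i + ?\<delta> i" using le i True by auto
      then have "single i (t' i) = single i (t i) + single i (?\<delta> i)"
        by (metis single_add)
      then have "single i (t' i) + twist ?\<delta> (T - {i}) = twist ?\<delta> T + single i (t i)"
        using twist_remove[OF finite_subset[OF True] i, of ?\<delta>] by (simp add: add_ac)
      then have "monom (single i (t' i)) * monom (twist ?\<delta> (T - {i})) =
          (monom (twist ?\<delta> T) * monom (single i (t i)) :: 'a poly)"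
        by (simp only: monom_add[symmetric])
      then show ?thesis by (simp add: stretch_def mult_ac)
    qed
    then show ?thesis unfolding stretch_def[of _ _ "kdiff n t F"] kdiff_def sum_distrib_left
      by (intro sum.cong) auto
  next
    case False
    have "F (T - {i}) = 0" if "i \<in> T \<inter> {1..n}" for i
      using that False by (intro cochains_eq_0[OF F]) auto
    then show ?thesis by (simp add: kdiff_def stretch_def)
  qed
qed

lemma stretch_stretch:
  assumes F: "F \<in> cochains n" and le: "\<And>i. i \<in> {1..n} \<Longrightarrow> t i \<le> t' i \<and> t' i \<le> t'' i"
  shows "stretch t' t'' (stretch t t' F) = stretch t t'' F"
proof
  fix S
  show "stretch t' t'' (stretch t t' F) S = stretch t t'' F S"
  proof (cases "S \<subseteq> {1..n}")
    case True
    have "twist (\<lambda>i. t'' i - t' i) S + twist (\<lambda>i. t' i - t i) S = twist (\<lambda>i. t'' i - t i) S"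
      unfolding twist_def sum.distrib[symmetric] single_add[symmetric]
      using True le by (intro sum.cong refl arg_cong[of _ _ "single _"]) fastforce
    then show ?thesis by (simp add: stretch_def mult.assoc[symmetric] monom_add[symmetric])
  qed (simp add: stretch_def cochains_eq_0[OF F])
qed

lemma kdiff_cong_exponents:
  "(\<And>i. i \<in> {1..n} \<Longrightarrow> t i = t' i) \<Longrightarrow> kdiff n t = kdiff n t'"
  by (intro ext) (auto simp: kdiff_def intro!: sum.cong)

lemma koszul_cong_exponents:
  assumes "\<And>i. i \<in> {1..n} \<Longrightarrow> t i = t' i"
  shows "(koszul n p t d :: 'k::field cochain set) = koszul n p t' d"
proof -
  have *: "(koszul n p t d :: 'k cochain set) \<subseteq> koszul n p t' d" if t: "\<And>i. i \<in> {1..n} \<Longrightarrow> t i = t' i" for t t'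
  proof
    fix F :: "'k cochain" assume F: "F \<in> koszul n p t d"
    show "F \<in> koszul n p t' d"
    proof (rule koszulI)
      fix S assume "S \<subseteq> {1..n}"
      then have "sum t S = sum t' S" using t by (intro sum.cong) auto
      then show "F S \<in> homogeneous_polys n (d + int (sum t' S))" using koszul_homogeneous[OF F, of S] by simp
    qed (simp add: koszul_eq_0[OF F])
  qed
  from *[of t t'] *[of t' t] show ?thesis using assms by auto
qed

context homog_ideal
begin

lemma stretch_kcycles:
  assumes F: "F \<in> kcycles n I p t d" and le: "\<And>i. i \<in> {1..n} \<Longrightarrow> t i \<le> t' i"
  shows "stretch t t' F \<in> kcycles n I p t' d"
proof -
  have Fk: "F \<in> koszul n p t d" using F by (simp add: kcycles_def)
  have "stretch t t' (kdiff n t F) T \<in> I" for T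
  proof (cases "T \<subseteq> {1..n}")
    case True
    then show ?thesis using F unfolding stretch_def by (intro monom_in twist_in_monomials) (auto simp: kcycles_def)
  next
    case False
    then show ?thesis using koszul_eq_0[OF kdiff_in_koszul[OF Fk], of T] by (auto simp: stretch_def)
  qed
  moreover have "kdiff n t' (stretch t t' F) = stretch t t' (kdiff n t F)"
    by (rule kdiff_stretch[OF koszul_cochains[OF Fk] le])
  ultimately show ?thesis
    using stretch_koszul[OF Fk le] by (simp add: kcycles_def)
qed

text \<open>
  The cone of the map that raises the exponent of \<open>x\<^sub>l\<close> by one is a shift by \<open>t l\<close> of the Koszul
  complex in which \<open>x\<^sub>l\<close> occurs with exponent one. The proof is the diagram chase in this cone.
\<close>

lemma stretch_one_inj:
  assumes acyclic: "\<And>p t d. d0 \<le> d \<Longrightarrow> kcycles n I p t d = kbounds n I p t d"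
    and l: "l \<in> {1..n}" and d: "d0 \<le> d + int (t l)" and t': "t' = t(l := Suc (t l))"
    and F: "F \<in> kcycles n I p t d" and B: "stretch t t' F \<in> kbounds n I p t' d"
  shows "F \<in> kbounds n I p t d"
proof -
  define s where "s = t(l := 1)"
  define e where "e = d + int (t l)"
  let ?x = "monom (single l 1) :: 'k poly"
  have tt': "t' i = t i" "s i = t i" if "i \<noteq> l" for i using that by (simp_all add: t' s_def)
  have sum_without: "sum t' S = sum t S" "sum s S = sum t S" if "l \<notin> S" for S
    using that by (auto simp: t' s_def intro!: sum.cong)
  have Fk: "F \<in> koszul n p t d" and FI: "\<And>T. kdiff n t F T \<in> I" using F by (auto simp: kcycles_def)
  obtain u where u: "u \<in> koszul n (p - 1) t' d" and uI: "\<And>S. stretch t t' F S - kdiff n t' u S \<in> I"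
    using B by (auto simp: kbounds_def)
  have stretch_eq: "stretch t t' F S = (if l \<in> S then ?x * F S else F S)" for S
  proof (cases "S \<subseteq> {1..n}")
    case True
    have "twist (\<lambda>i. t' i - t i) S = (\<Sum>i\<in>S. if l = i then single l 1 else 0)"
      unfolding twist_def by (rule sum.cong) (auto simp: t')
    also have "\<dots> = (if l \<in> S then single l 1 else 0)"
      using finite_subset[OF True] by (intro sum.delta') simp
    finally show ?thesis by (simp add: stretch_def)
  qed (simp add: stretch_def cochains_eq_0[OF koszul_cochains[OF Fk]])
  \<comment> \<open>The two components of a cochain of the cone. The denominators for
    \<open>t\<close> and \<open>t'\<close> differ only at positions containing \<open>l\<close>, so
    \<open>uA\<close> is also a cochain for \<open>t\<close>.\<close>
  define uA where "uA S = (if l \<in> S then 0 else u S)" for S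
  define uB where "uB S = (if l \<in> S then u S else 0)" for S
  have uA: "uA \<in> koszul n (p - 1) t d"
  proof (rule koszulI)
    fix S show "uA S \<in> homogeneous_polys n (d + int (sum t S))"
      using koszul_homogeneous[OF u, of S] sum_without[of S] by (cases "l \<in> S") (simp_all add: uA_def del: of_nat_sum)
  qed (simp add: uA_def koszul_eq_0[OF u])
  \<comment> \<open>Subtracting this boundary keeps the class of \<open>F\<close> and moves its
    values at positions without \<open>l\<close> into \<open>I\<close>.\<close>
  define G where "G S = F S - kdiff n t uA S" for S
  have Gk: "G \<in> koszul n p t d"
    unfolding G_def using koszul_diff[OF Fk, of "kdiff n t uA"] kdiff_in_koszul[OF uA] by simp
  have Gd: "kdiff n t G T = kdiff n t F T" for T
    unfolding G_def by (simp add: kdiff_diff kdiff_kdiff)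
  have G_without: "G T \<in> I" if "l \<notin> T" for T
  proof -
    have "kdiff n t' u T = kdiff n t uA T"
      by (rule kdiff_cong_without[OF that]) (use tt' in \<open>auto simp: uA_def\<close>)
    then show ?thesis using uI[of T] that by (simp add: G_def stretch_eq)
  qed
  define H where "H S = (if l \<in> S then G S else 0)" for S
  have Hk: "H \<in> koszul n p t d" unfolding H_def by (rule koszul_restrict[OF Gk])
  have GH: "G S - H S \<in> I" for S using G_without by (simp add: H_def)
  have Hd: "kdiff n t H T \<in> I" for T
  proof -
    have "kdiff n t (\<lambda>S. G S - H S) T \<in> I" using GH by (rule kdiff_in_ideal)
    then have "kdiff n t F T - (kdiff n t G T - kdiff n t H T) \<in> I"
      unfolding kdiff_diff using FI by (rule diff_in[rotated])
    then show ?thesis by (simp add: Gd)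
  qed
  have xH: "?x * H T - kdiff n t' uB T \<in> I" if lT: "l \<in> T" for T
  proof -
    have "u = (\<lambda>S. uA S + uB S)" by (auto simp: uA_def uB_def)
    then have "kdiff n t' u T = kdiff n t' uA T + kdiff n t' uB T" by (metis kdiff_add)
    moreover have "kdiff n t' uA T = ?x * kdiff n t uA T"
    proof -
      have "single l (t' l) = single l 1 + single l (t l)"
        by (simp add: t' flip: single_add)
      then have "kdiff n t' uA T = ksign T l * (?x * monom (single l (t l)) * uA (T - {l}))"
        using kdiff_only_without[OF lT l, of uA t'] by (simp add: uA_def monom_add)
      moreover have "kdiff n t uA T = ksign T l * (monom (single l (t l)) * uA (T - {l}))"
        by (rule kdiff_only_without[OF lT l]) (simp add: uA_def)
      ultimately show ?thesis by (simp add: mult_ac)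
    qed
    ultimately have "?x * H T - kdiff n t' uB T = stretch t t' F T - kdiff n t' u T"
      using lT by (simp add: H_def G_def stretch_eq right_diff_distrib)
    then show ?thesis using uI by simp
  qed
  \<comment> \<open>The cycle of the cone: at positions without \<open>l\<close> the contraction of
    \<open>H\<close>, at positions containing \<open>l\<close> the cochain \<open>- uB\<close>,
    where \<open>uB\<close> witnesses that \<open>?x * H\<close> is a boundary modulo
    \<open>I\<close>.\<close>
  define q where "q S = slice l H S - uB S" for S
  have "uB \<in> koszul n (p - 1) s e"
  proof (rule koszulI)
    fix S assume S: "S \<subseteq> {1..n}" "int (card S) = p - 1"
    show "uB S \<in> homogeneous_polys n (e + int (sum s S))"
    proof (cases "l \<in> S")
      case True
      have "sum t' S = Suc (t l) + sum t (S - {l})" "sum s S = 1 + sum t (S - {l})"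
        using finite_subset[OF S(1)] True sum_without[of "S - {l}"] by (simp_all add: sum.remove t' s_def)
      then have "d + int (sum t' S) = e + int (sum s S)" by (simp add: e_def)
      then show ?thesis using koszul_homogeneous[OF u, of S] True by (simp add: uB_def del: of_nat_sum)
    qed (simp add: uB_def)
  qed (simp add: uB_def koszul_eq_0[OF u])
  then have qk: "q \<in> koszul n (p - 1) s e"
    unfolding q_def using koszul_slice[OF Hk, of l 1] by (intro koszul_diff) (simp_all add: s_def e_def)
  have "kdiff n s q T \<in> I" for T
  proof (cases "l \<in> T")
    case False
    have "kdiff n s q T = kdiff n s (slice l H) T"
      by (rule kdiff_cong_without[OF False]) (simp_all add: q_def uB_def)
    also have "\<dots> = - (ksign T l * kdiff n t H (insert l T))"
      by (rule kdiff_slice[OF False]) (use tt' in \<open>simp_all add: H_def\<close>)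
    finally show ?thesis using Hd by (simp add: ksign_def sign_in uminus_in)
  next
    case True
    have "kdiff n s (slice l H) T = ksign T l * (?x * slice l H (T - {l}))"
      using kdiff_only_without[OF True l, of "slice l H" s] by (simp add: slice_def s_def)
    also have "\<dots> = ?x * H T"
    proof -
      have "ksign T l * (?x * slice l H (T - {l})) = ?x * (ksign T l * (ksign T l * H T))"
        using True by (simp add: slice_def insert_absorb mult_ac)
      then show ?thesis by (simp only: ksign_ksign)
    qed
    also have "kdiff n s uB T = kdiff n t' uB T"
      unfolding kdiff_def
    proof (rule sum.cong[OF refl])
      fix i show "ksign T i * (monom (single i (s i)) * uB (T - {i})) =
          ksign T i * (monom (single i (t' i)) * uB (T - {i}))"
        using tt'[of i] by (cases "i = l") (simp_all add: uB_def)
    qed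
    ultimately show ?thesis using xH[OF True] unfolding q_def kdiff_diff by simp
  qed
  then have "q \<in> kcycles n I (p - 1) s e" using qk by (simp add: kcycles_def)
  then have "q \<in> kbounds n I (p - 1) s e" using acyclic[of e] d by (simp add: e_def)
  then obtain v where v: "v \<in> koszul n (p - 1 - 1) s e" and vI: "\<And>S. q S - kdiff n s v S \<in> I"
    by (auto simp: kbounds_def)
  \<comment> \<open>The index \<open>l\<close> is put back into the part of \<open>v\<close> at
    positions without \<open>l\<close>. The minus sign compensates that contraction anticommutes
    with the differential.\<close>
  define y where "y S = (if l \<in> S then - (ksign S l * v (S - {l})) else 0)" for S
  have yk: "y \<in> koszul n (p - 1) t d"
  proof (rule koszulI)
    fix S assume S: "S \<subseteq> {1..n}" "int (card S) = p - 1"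
    show "y S \<in> homogeneous_polys n (d + int (sum t S))"
    proof (cases "l \<in> S")
      case True
      have "sum t S = t l + sum s (S - {l})"
        using finite_subset[OF S(1)] True sum_without[of "S - {l}"] by (simp add: sum.remove)
      then have "d + int (sum t S) = e + int (sum s (S - {l}))" by (simp add: e_def)
      then have "v (S - {l}) \<in> homogeneous_polys n (d + int (sum t S))"
        using koszul_homogeneous[OF v, of "S - {l}"] by simp
      then have "- (ksign S l * v (S - {l})) \<in> homogeneous_polys n (d + int (sum t S))"
        unfolding ksign_def by (intro hom_uminus hom_sign)
      then show ?thesis using True by (simp add: y_def del: of_nat_sum)
    qed (simp add: y_def)
  next
    fix S assume S: "\<not> (S \<subseteq> {1..n} \<and> int (card S) = p - 1)"
    show "y S = 0"
    proof (cases "l \<in> S")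
      case True
      have "\<not> (S - {l} \<subseteq> {1..n} \<and> int (card (S - {l})) = p - 1 - 1)"
      proof
        assume *: "S - {l} \<subseteq> {1..n} \<and> int (card (S - {l})) = p - 1 - 1"
        then have "S \<subseteq> {1..n}" using l by auto
        moreover have "card S = Suc (card (S - {l}))"
          using finite_subset[OF calculation] True by (metis card_Suc_Diff1 finite_atLeastAtMost)
        ultimately show False using * S by simp
      qed
      then have "v (S - {l}) = 0" by (rule koszul_eq_0[OF v])
      then show ?thesis by (simp add: y_def)
    qed (simp add: y_def)
  qed
  have Hy: "H T - kdiff n t y T \<in> I" for T
  proof (cases "l \<in> T")
    case False
    then have "kdiff n t y T = 0" unfolding kdiff_def by (intro sum.neutral) (auto simp: y_def)
    then show ?thesis using False by (simp add: H_def)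
  next
    case True
    let ?S = "T - {l}"
    have "kdiff n s v ?S = - kdiff n s (slice l y) ?S"
    proof -
      have "kdiff n s (slice l y) ?S = kdiff n s (\<lambda>S. - v S) ?S"
        by (rule kdiff_cong_without[where l = l]) (simp_all add: slice_def y_def ksign_ksign)
      then show ?thesis using kdiff_mult[of n s "-1" v] by simp
    qed
    also have "kdiff n s (slice l y) ?S = - (ksign ?S l * kdiff n t y (insert l ?S))"
      by (rule kdiff_slice) (use tt' in \<open>simp_all add: y_def\<close>)
    finally have "q ?S - kdiff n s v ?S = ksign T l * (H T - kdiff n t y T)"
      by (simp add: q_def slice_def uB_def insert_absorb[OF True] right_diff_distrib)
    then have "ksign T l * (ksign T l * (H T - kdiff n t y T)) \<in> I"
      using vI[of ?S] sign_in unfolding ksign_def by metis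
    then show ?thesis by (simp only: ksign_ksign)
  qed
  have "F S - kdiff n t (\<lambda>S. uA S + y S) S = (G S - H S) + (H S - kdiff n t y S)" for S
    by (simp add: kdiff_add G_def)
  then have "F S - kdiff n t (\<lambda>S. uA S + y S) S \<in> I" for S
    by (simp only: add_in[OF GH Hy])
  then show ?thesis
    unfolding kbounds_def using Fk koszul_add[OF uA yk] by blast
qed

text \<open>One exponent is raised by one at a time. Each step needs acyclicity in degree
  \<open>d + t l\<close>, and this degree remains at least \<open>d0\<close> because exponents only
  grow.\<close>

theorem stretch_inj:
  assumes acyclic: "\<And>p t d. d0 \<le> d \<Longrightarrow> kcycles n I p t d = kbounds n I p t d"
    and "\<And>i. i \<in> {1..n} \<Longrightarrow> t i \<le> t' i" "\<And>i. i \<in> {1..n} \<Longrightarrow> d0 \<le> d + int (t i)"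
    and "F \<in> kcycles n I p t d" "stretch t t' F \<in> kbounds n I p t' d"
  shows "F \<in> kbounds n I p t d"
  using assms(2-)
proof (induction "\<Sum>i\<in>{1..n}. t' i - t i" arbitrary: t F)
  case 0
  have Fk: "F \<in> koszul n p t d" using 0 by (simp add: kcycles_def)
  have eq: "t i = t' i" if "i \<in> {1..n}" for i
  proof -
    have "t' i - t i = 0" using 0(1) that by (simp add: sum_eq_0_iff)
    then show ?thesis using 0(2)[OF that] by simp
  qed
  have "twist (\<lambda>i. t' i - t i) S = 0" if "S \<subseteq> {1..n}" for S
    unfolding twist_def using eq that by (intro sum.neutral) auto
  then have "stretch t t' F S = F S" for S
    using cochains_eq_0[OF koszul_cochains[OF Fk], of S] by (cases "S \<subseteq> {1..n}") (simp_all add: stretch_def)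
  then have "stretch t t' F = F" by (rule ext)
  then show ?case using 0(5) unfolding kbounds_def
    by (simp only: koszul_cong_exponents[OF eq] kdiff_cong_exponents[OF eq])
next
  case (Suc m)
  have Fk: "F \<in> koszul n p t d" using Suc by (simp add: kcycles_def)
  have "\<exists>l\<in>{1..n}. t' l - t l \<noteq> 0"
  proof (rule ccontr)
    assume "\<not> ?thesis"
    then have "(\<Sum>i\<in>{1..n}. t' i - t i) = 0" by (intro sum.neutral) blast
    then show False using Suc.hyps(2) by simp
  qed
  then obtain l where l: "l \<in> {1..n}" "t l < t' l" by auto
  define s where "s = t(l := Suc (t l))"
  have s: "t i \<le> s i" "s i \<le> t' i" "d0 \<le> d + int (s i)" if "i \<in> {1..n}" for i
    using Suc.prems(1)[OF that] Suc.prems(2)[OF that] l by (auto simp: s_def)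
  have "(\<Sum>i\<in>{1..n}. t' i - t i) = (t' l - t l) + (\<Sum>i\<in>{1..n}-{l}. t' i - t i)"
    using l by (simp add: sum.remove)
  also have "(\<Sum>i\<in>{1..n}-{l}. t' i - t i) = (\<Sum>i\<in>{1..n}-{l}. t' i - s i)"
    by (rule sum.cong) (auto simp: s_def)
  finally have "(\<Sum>i\<in>{1..n}. t' i - t i) = Suc ((t' l - s l) + (\<Sum>i\<in>{1..n}-{l}. t' i - s i))"
    using l by (simp add: s_def)
  also have "(t' l - s l) + (\<Sum>i\<in>{1..n}-{l}. t' i - s i) = (\<Sum>i\<in>{1..n}. t' i - s i)"
    using l by (simp add: sum.remove)
  finally have m: "m = (\<Sum>i\<in>{1..n}. t' i - s i)" using Suc.hyps(2) by simp
  have cyc: "stretch t s F \<in> kcycles n I p s d" by (rule stretch_kcycles[OF Suc.prems(3)]) (rule s)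
  have comp: "stretch s t' (stretch t s F) = stretch t t' F"
    by (rule stretch_stretch[OF koszul_cochains[OF Fk]]) (use s in blast)
  have "stretch t s F \<in> kbounds n I p s d"
    by (rule Suc.hyps(1)[OF m _ _ cyc]) (use s comp Suc.prems(4) in auto)
  with acyclic l(1) Suc.prems(2)[OF l(1)] s_def Suc.prems(3) show ?case
    by (rule stretch_one_inj)
qed

end

section \<open>Localizations of the quotient ring\<close>

text \<open>Operations on cosets and fractions are unions over all representatives; independence of
  the representative enters through this lemma.\<close>

lemma UN_eq_const: "A \<noteq> {} \<Longrightarrow> (\<And>a. a \<in> A \<Longrightarrow> h a = c) \<Longrightarrow> (\<Union>a\<in>A. h a) = c"
  by auto

context homog_ideal
begin

abbreviation cl :: "'k poly \<Rightarrow> 'k poly set" where "cl f \<equiv> I +>\<^bsub>poly_ring n\<^esub> f"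
abbreviation Q :: "('k poly, 'k poly set) graded_module" where "Q \<equiv> quotient_module (poly_ring n) I"

lemma cl_def: "cl f = (\<lambda>h. h + f) ` I"
  by (auto simp: a_r_coset_def')

lemma cl_eq_iff: "cl f = cl g \<longleftrightarrow> f - g \<in> I"
proof
  assume "cl f = cl g"
  moreover have "f \<in> cl f" unfolding cl_def by (rule image_eqI[of _ _ 0]) auto
  ultimately obtain h where "h \<in> I" "f = h + g" by (auto simp: cl_def)
  then show "f - g \<in> I" by simp
next
  assume *: "f - g \<in> I"
  have "h + f \<in> cl g" if "h \<in> I" for h
    unfolding cl_def by (rule image_eqI[of _ _ "h + (f - g)"]) (use that * add_in in auto)
  moreover have "h + g \<in> cl f" if "h \<in> I" for h
    unfolding cl_def by (rule image_eqI[of _ _ "h - (f - g)"]) (use that * diff_in in auto)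
  ultimately show "cl f = cl g" by (auto simp: cl_def)
qed

lemma cl_add: "cl f <+>\<^bsub>poly_ring n\<^esub> cl g = cl (f + g)"
proof -
  have "h + (f + g) \<in> (\<Union>h\<in>(\<lambda>h. h + f) ` I. \<Union>k\<in>(\<lambda>h. h + g) ` I. {h + k})" if "h \<in> I" for h
    by (rule UN_I[of "h + f"], use that in blast, rule UN_I[of "0 + g"]) (use zero_in in \<open>auto simp: add.assoc\<close>)
  moreover have "(h + f) + (k + g) \<in> (\<lambda>h. h + (f + g)) ` I" if "h \<in> I" "k \<in> I" for h k
    by (rule image_eqI[of _ _ "h + k"]) (use that add_in in auto)
  ultimately show ?thesis unfolding set_add_def' cl_def by auto
qed

lemma cl_smult:
  assumes "r \<in> polys n"
  shows "r \<odot>\<^bsub>Q\<^esub> cl f = cl (r * f)"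
proof -
  have "r \<odot>\<^bsub>Q\<^esub> cl f = (\<Union>m\<in>cl f. cl (r * m))" by (simp add: quotient_module_def)
  also have "\<dots> = cl (r * f)"
  proof (rule UN_eq_const)
    show "cl f \<noteq> {}" unfolding cl_def image_is_empty using zero_in by blast
    fix m assume "m \<in> cl f"
    then obtain h where "h \<in> I" "m = h + f" by (auto simp: cl_def)
    then show "cl (r * m) = cl (r * f)"
      using mult_in[OF assms] by (simp add: cl_eq_iff algebra_simps)
  qed
  finally show ?thesis .
qed

lemma Q_simps:
  "carrier Q = cl ` polys n" "cl f \<oplus>\<^bsub>Q\<^esub> cl g = cl (f + g)" "\<zero>\<^bsub>Q\<^esub> = cl 0"
  "component Q d = cl ` homogeneous_polys n d"
proof -
  show "carrier Q = cl ` polys n"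
    by (auto simp: quotient_module_def A_RCOSETS_def' )
  show "cl f \<oplus>\<^bsub>Q\<^esub> cl g = cl (f + g)" using cl_add by (simp add: quotient_module_def)
  show "\<zero>\<^bsub>Q\<^esub> = cl 0" by (simp add: quotient_module_def cl_def)
  show "component Q d = cl ` homogeneous_polys n d" by (auto simp: quotient_module_def)
qed

section \<open>Fractions with polynomial representatives\<close>

definition fr :: "'k poly \<Rightarrow> 'k poly \<Rightarrow> nat \<Rightarrow> ('k poly set \<times> nat) set" where
  "fr x f s = fraction Q x (cl f) s"

lemma fraction_rel_iff:
  assumes "x \<in> polys n" "f \<in> polys n" "g \<in> polys n"
  shows "((cl f, s), (cl g, s')) \<in> fraction_rel Q x \<longleftrightarrow> (\<exists>u. x ^ (u + s') * f - x ^ (u + s) * g \<in> I)"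
  using assms by (simp add: fraction_rel_def Q_simps cl_smult polys_power cl_eq_iff imageI)

lemma equiv_fraction_rel:
  assumes x: "x \<in> polys n"
  shows "equiv (carrier Q \<times> UNIV) (fraction_rel Q x)"
proof (rule equivI)
  show "fraction_rel Q x \<subseteq> (carrier Q \<times> UNIV) \<times> carrier Q \<times> UNIV" by (auto simp: fraction_rel_def)
  show "refl_on (carrier Q \<times> UNIV) (fraction_rel Q x)"
    by (auto simp: refl_on_def fraction_rel_def)
  show "sym (fraction_rel Q x)" unfolding sym_def fraction_rel_def by fastforce
  show "trans (fraction_rel Q x)"
  proof (rule transI)
    fix a b c assume ab: "(a, b) \<in> fraction_rel Q x" and bc: "(b, c) \<in> fraction_rel Q x"
    then obtain f g h s s' s'' where p: "a = (cl f, s)" "b = (cl g, s')" "c = (cl h, s'')"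
      "f \<in> polys n" "g \<in> polys n" "h \<in> polys n"
      by (auto simp: fraction_rel_def Q_simps)
    obtain u where u: "x ^ (u + s') * f - x ^ (u + s) * g \<in> I"
      using ab x p fraction_rel_iff by auto
    obtain v where v: "x ^ (v + s'') * g - x ^ (v + s') * h \<in> I"
      using bc x p fraction_rel_iff by auto
    \<comment> \<open>Each relation is multiplied so that the two terms in \<open>g\<close> cancel;
      the remaining terms share the exponent \<open>u + v + s'\<close>.\<close>
    have "x ^ (v + s'') * (x ^ (u + s') * f - x ^ (u + s) * g) + x ^ (u + s) * (x ^ (v + s'') * g - x ^ (v + s') * h) \<in> I"
      by (intro add_in mult_in u v polys_power x)
    also have "x ^ (v + s'') * (x ^ (u + s') * f - x ^ (u + s) * g) + x ^ (u + s) * (x ^ (v + s'') * g - x ^ (v + s') * h) =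
        x ^ ((u + v + s') + s'') * f - x ^ ((u + v + s') + s) * h"
      by (simp add: power_add algebra_simps)
    finally show "(a, c) \<in> fraction_rel Q x" unfolding p(1,3) fraction_rel_iff[OF x p(4,6)] by blast
  qed
qed

lemma fr_eq_iff:
  assumes "x \<in> polys n" "f \<in> polys n" "g \<in> polys n"
  shows "fr x f s = fr x g s' \<longleftrightarrow> (\<exists>u. x ^ (u + s') * f - x ^ (u + s) * g \<in> I)"
proof -
  have "fr x f s = fr x g s' \<longleftrightarrow> ((cl f, s), (cl g, s')) \<in> fraction_rel Q x"
    unfolding fr_def fraction_def
    by (rule eq_equiv_class_iff[OF equiv_fraction_rel]) (use assms in \<open>auto simp: Q_simps\<close>)
  then show ?thesis using fraction_rel_iff[OF assms] by simp
qed

lemma fr_self: "x \<in> polys n \<Longrightarrow> f \<in> polys n \<Longrightarrow> (cl f, s) \<in> fr x f s"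
  unfolding fr_def fraction_def using fraction_rel_iff[of x f f s s] by auto

lemma fr_elem:
  assumes "x \<in> polys n" "f \<in> polys n" "a \<in> fr x f s"
  obtains g s' where "g \<in> polys n" "a = (cl g, s')" "fr x g s' = fr x f s"
proof -
  have a: "((cl f, s), a) \<in> fraction_rel Q x" using assms by (simp add: fr_def fraction_def)
  then obtain g s' where g: "g \<in> polys n" "a = (cl g, s')" by (auto simp: fraction_rel_def Q_simps)
  have "fr x f s = fr x g s'"
    unfolding fr_def fraction_def using a equiv_class_eq[OF equiv_fraction_rel[OF assms(1)]] g by blast
  then show ?thesis using that g by metis
qed

lemma fr_expand:
  assumes "x \<in> polys n" "f \<in> polys n"
  shows "fr x (x ^ u * f) (s + u) = fr x f s"
  using assms by (subst fr_eq_iff) (auto simp: polys_mult polys_power power_add algebra_simps intro!: exI[of _ 0])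

lemma fr_common:
  assumes "x \<in> polys n" "f \<in> polys n" "s \<le> s'"
  shows "fr x f s = fr x (x ^ (s' - s) * f) s'"
  using fr_expand[OF assms(1,2), of "s' - s" s] assms(3) by simp

lemma fr_cong: "x \<in> polys n \<Longrightarrow> f \<in> polys n \<Longrightarrow> g \<in> polys n \<Longrightarrow> f - g \<in> I \<Longrightarrow> fr x f s = fr x g s"
  by (subst fr_eq_iff) (auto simp: right_diff_distrib[symmetric] intro!: exI[of _ 0] mult_in polys_power)

lemma fr_zero: "x \<in> polys n \<Longrightarrow> fr x 0 s = fr x 0 s'"
  by (subst fr_eq_iff) auto

abbreviation loc :: "'k poly \<Rightarrow> nat \<Rightarrow> ('k poly, ('k poly set \<times> nat) set) graded_module" where
  "loc x d \<equiv> localization Q x d"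

lemma loc_carrier: "carrier (loc x d) = {fr x f s | f s. f \<in> polys n}"
  by (auto simp: localization_def Q_simps fr_def)

lemma loc_zero: "x \<in> polys n \<Longrightarrow> \<zero>\<^bsub>loc x d\<^esub> = fr x 0 s"
  using fr_zero[of x 0 s] by (simp add: localization_def Q_simps fr_def)

lemma loc_component: "component (loc x d) j = {fr x f s | f s. f \<in> homogeneous_polys n (j + int s * int d)}"
  by (auto simp: localization_def Q_simps fr_def)

lemma loc_add':
  assumes x: "x \<in> polys n" and f: "f \<in> polys n" and g: "g \<in> polys n"
  shows "fr x f s \<oplus>\<^bsub>loc x d\<^esub> fr x g s' = fr x (x ^ s' * f + x ^ s * g) (s + s')"
proof -
  let ?e = "\<lambda>a b. fraction Q x (x ^ snd b \<odot>\<^bsub>Q\<^esub> fst a \<oplus>\<^bsub>Q\<^esub> x ^ snd a \<odot>\<^bsub>Q\<^esub> fst b) (snd a + snd b)"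
  have "fr x f s \<oplus>\<^bsub>loc x d\<^esub> fr x g s' = (\<Union>a\<in>fr x f s. \<Union>b\<in>fr x g s'. ?e a b)"
    by (simp add: localization_def case_prod_unfold)
  also have "\<dots> = fr x (x ^ s' * f + x ^ s * g) (s + s')"
  proof (rule UN_eq_const)
    fix a assume "a \<in> fr x f s"
    then obtain f' t where a: "f' \<in> polys n" "a = (cl f', t)" "fr x f' t = fr x f s" using fr_elem x f by metis
    obtain u where u: "x ^ (u + s) * f' - x ^ (u + t) * f \<in> I"
      using a(3) fr_eq_iff[OF x a(1) f] by blast
    show "(\<Union>b\<in>fr x g s'. ?e a b) =
        fr x (x ^ s' * f + x ^ s * g) (s + s')"
    proof (rule UN_eq_const)
      fix b assume "b \<in> fr x g s'"
      then obtain g' t' where b: "g' \<in> polys n" "b = (cl g', t')" "fr x g' t' = fr x g s'" using fr_elem x g by metis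
      obtain v where v: "x ^ (v + s') * g' - x ^ (v + t') * g \<in> I"
        using b(3) fr_eq_iff[OF x b(1) g] by blast
      have "?e a b =
          fr x (x ^ t' * f' + x ^ t * g') (t + t')"
        using a b x by (simp add: cl_smult polys_power Q_simps fr_def)
      also have "\<dots> = fr x (x ^ s' * f + x ^ s * g) (s + s')"
      proof (subst fr_eq_iff)
        have "x ^ (v + s' + t') * (x ^ (u + s) * f' - x ^ (u + t) * f) +
            x ^ (u + s + t) * (x ^ (v + s') * g' - x ^ (v + t') * g) \<in> I"
          by (intro add_in mult_in polys_power x u v)
        also have "x ^ (v + s' + t') * (x ^ (u + s) * f' - x ^ (u + t) * f) +
            x ^ (u + s + t) * (x ^ (v + s') * g' - x ^ (v + t') * g) =
          x ^ ((u + v) + (s + s')) * (x ^ t' * f' + x ^ t * g') - x ^ ((u + v) + (t + t')) * (x ^ s' * f + x ^ s * g)"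
          by (simp add: power_add algebra_simps)
        finally show "\<exists>w. x ^ (w + (s + s')) * (x ^ t' * f' + x ^ t * g') - x ^ (w + (t + t')) * (x ^ s' * f + x ^ s * g) \<in> I"
          by blast
      qed (use x f g a b in \<open>auto simp: polys_add polys_mult polys_power\<close>)
      finally show "?e a b =
          fr x (x ^ s' * f + x ^ s * g) (s + s')" .
    qed (use fr_self x g in blast)
  qed (use fr_self x f in blast)
  finally show ?thesis .
qed

lemma loc_add:
  assumes x: "x \<in> polys n" and f: "f \<in> polys n" and g: "g \<in> polys n"
  shows "fr x f s \<oplus>\<^bsub>loc x d\<^esub> fr x g s = fr x (f + g) s"
proof -
  have "x ^ s * f + x ^ s * g = x ^ s * (f + g)" by (simp add: distrib_left)
  then show ?thesis using loc_add'[OF x f g, where s = s and s' = s] fr_expand[OF x, of "f + g" s s] f g by (simp add: polys_add)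
qed

lemma loc_smult:
  assumes x: "x \<in> polys n" and f: "f \<in> polys n" and r: "r \<in> polys n"
  shows "r \<odot>\<^bsub>loc x d\<^esub> fr x f s = fr x (r * f) s"
proof -
  have "r \<odot>\<^bsub>loc x d\<^esub> fr x f s = (\<Union>a\<in>fr x f s. fraction Q x (r \<odot>\<^bsub>Q\<^esub> fst a) (snd a))"
    by (simp add: localization_def case_prod_unfold)
  also have "\<dots> = fr x (r * f) s"
  proof (rule UN_eq_const)
    fix a assume "a \<in> fr x f s"
    then obtain f' t where a: "f' \<in> polys n" "a = (cl f', t)" "fr x f' t = fr x f s" using fr_elem x f by metis
    obtain u where "x ^ (u + s) * f' - x ^ (u + t) * f \<in> I"
      using a(3) fr_eq_iff[OF x a(1) f] by blast
    then have "r * (x ^ (u + s) * f' - x ^ (u + t) * f) \<in> I" by (rule mult_in[OF r])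
    then have "x ^ (u + s) * (r * f') - x ^ (u + t) * (r * f) \<in> I" by (simp add: algebra_simps)
    then have "fr x (r * f') t = fr x (r * f) s" using fr_eq_iff[OF x] polys_mult r f a(1) by blast
    then show "fraction Q x (r \<odot>\<^bsub>Q\<^esub> fst a) (snd a) = fr x (r * f) s"
      using a r by (simp add: cl_smult fr_def)
  qed (use fr_self x f in blast)
  finally show ?thesis .
qed

lemma loc_map:
  assumes x: "x \<in> polys n" and y: "y \<in> polys n" and f: "f \<in> polys n"
  shows "localization_map Q x y (fr x f s) = fr (x * y) (y ^ s * f) s"
proof -
  have "localization_map Q x y (fr x f s) = (\<Union>a\<in>fr x f s. fraction Q (x * y) (y ^ snd a \<odot>\<^bsub>Q\<^esub> fst a) (snd a))"
    by (simp add: localization_map_def case_prod_unfold)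
  also have "\<dots> = fr (x * y) (y ^ s * f) s"
  proof (rule UN_eq_const)
    fix a assume "a \<in> fr x f s"
    then obtain f' t where a: "f' \<in> polys n" "a = (cl f', t)" "fr x f' t = fr x f s" using fr_elem x f by metis
    obtain u where "x ^ (u + s) * f' - x ^ (u + t) * f \<in> I"
      using a(3) fr_eq_iff[OF x a(1) f] by blast
    then have "y ^ (u + s + t) * (x ^ (u + s) * f' - x ^ (u + t) * f) \<in> I"
      by (intro mult_in polys_power y)
    then have "(x * y) ^ (u + s) * (y ^ t * f') - (x * y) ^ (u + t) * (y ^ s * f) \<in> I"
      by (simp add: power_mult_distrib power_add algebra_simps)
    then have "fr (x * y) (y ^ t * f') t = fr (x * y) (y ^ s * f) s"
      using fr_eq_iff[of "x * y" "y ^ t * f'" "y ^ s * f" t s] x y f a(1) by (auto simp: polys_mult polys_power)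
    then show "fraction Q (x * y) (y ^ snd a \<odot>\<^bsub>Q\<^esub> fst a) (snd a) = fr (x * y) (y ^ s * f) s"
      using a y by (simp add: cl_smult polys_power fr_def)
  qed (use fr_self x f in blast)
  finally show ?thesis .
qed

text \<open>Expansion is possible to every larger exponent, so finitely many fractions have a common
  denominator and identities between them reduce to identities of polynomials.\<close>

lemma loc_carrierE:
  assumes x: "x \<in> polys n" and A: "A \<in> carrier (loc x d)"
  obtains s where "\<And>s'. s \<le> s' \<Longrightarrow> \<exists>f\<in>polys n. A = fr x f s'"
proof -
  obtain f s where f: "f \<in> polys n" "A = fr x f s" using A by (auto simp: loc_carrier)
  have "\<exists>f\<in>polys n. A = fr x f s'" if "s \<le> s'" for s'
    using fr_common[OF x f(1) that] f x by (auto intro!: bexI polys_mult polys_power)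
  then show ?thesis using that by blast
qed

lemma loc_abelian_group:
  assumes x: "x \<in> polys n"
  shows "abelian_group (loc x d)"
proof -
  have common: "\<exists>s. \<forall>A\<in>S. \<exists>f\<in>polys n. A = fr x f s" if "finite S" "S \<subseteq> carrier (loc x d)" for S
  proof -
    have "\<forall>A\<in>S. \<exists>s. \<forall>s'\<ge>s. \<exists>f\<in>polys n. A = fr x f s'"
    proof
      fix A assume "A \<in> S"
      then have "A \<in> carrier (loc x d)" using that by blast
      then obtain s where "\<And>s'. s \<le> s' \<Longrightarrow> \<exists>f\<in>polys n. A = fr x f s'" by (rule loc_carrierE[OF x]) blast
      then show "\<exists>s. \<forall>s'\<ge>s. \<exists>f\<in>polys n. A = fr x f s'" by blast
    qed
    then obtain s where s: "\<And>A s'. A \<in> S \<Longrightarrow> s A \<le> s' \<Longrightarrow> \<exists>f\<in>polys n. A = fr x f s'" by metis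
    \<comment> \<open>The sum of the individual exponents serves as a common one.\<close>
    have "s A \<le> sum s S" if "A \<in> S" for A using that \<open>finite S\<close> by (intro member_le_sum) auto
    then show ?thesis using s by blast
  qed
  show ?thesis
  proof (rule abelian_groupI)
    show "\<zero>\<^bsub>loc x d\<^esub> \<in> carrier (loc x d)"
      unfolding loc_zero[OF x, where s = 0] loc_carrier using polys_0 by blast
  next
    fix A B assume "A \<in> carrier (loc x d)" "B \<in> carrier (loc x d)"
    then obtain s f g where *: "f \<in> polys n" "A = fr x f s" "g \<in> polys n" "B = fr x g s"
      using common[of "{A, B}"] by auto
    show "A \<oplus>\<^bsub>loc x d\<^esub> B \<in> carrier (loc x d)" using * polys_add by (auto simp: loc_add[OF x] loc_carrier)
    show "A \<oplus>\<^bsub>loc x d\<^esub> B = B \<oplus>\<^bsub>loc x d\<^esub> A" using * by (simp add: loc_add[OF x] add.commute)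
  next
    fix A B C assume "A \<in> carrier (loc x d)" "B \<in> carrier (loc x d)" "C \<in> carrier (loc x d)"
    then obtain s f g h where *: "f \<in> polys n" "A = fr x f s" "g \<in> polys n" "B = fr x g s"
      "h \<in> polys n" "C = fr x h s"
      using common[of "{A, B, C}"] by auto
    show "A \<oplus>\<^bsub>loc x d\<^esub> B \<oplus>\<^bsub>loc x d\<^esub> C = A \<oplus>\<^bsub>loc x d\<^esub> (B \<oplus>\<^bsub>loc x d\<^esub> C)"
      using * by (simp add: loc_add[OF x] polys_add add.assoc)
  next
    fix A assume "A \<in> carrier (loc x d)"
    then obtain s f where *: "f \<in> polys n" "A = fr x f s" by (auto simp: loc_carrier)
    show "\<zero>\<^bsub>loc x d\<^esub> \<oplus>\<^bsub>loc x d\<^esub> A = A" using * loc_zero[OF x, of d s] by (simp add: loc_add[OF x])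
    have "fr x (- f) s \<oplus>\<^bsub>loc x d\<^esub> A = \<zero>\<^bsub>loc x d\<^esub>"
      using * loc_zero[OF x, of d s] by (simp add: loc_add[OF x] polys_uminus)
    moreover have "fr x (- f) s \<in> carrier (loc x d)"
      unfolding loc_carrier using polys_uminus[OF *(1)] by blast
    ultimately show "\<exists>B\<in>carrier (loc x d). B \<oplus>\<^bsub>loc x d\<^esub> A = \<zero>\<^bsub>loc x d\<^esub>" by blast
  qed
qed

lemma loc_finsum:
  assumes x: "x \<in> polys n" and "finite A" and "\<And>i. i \<in> A \<Longrightarrow> f i \<in> polys n"
  shows "(\<Oplus>\<^bsub>loc x d\<^esub>i\<in>A. fr x (f i) s) = fr x (\<Sum>i\<in>A. f i) s"
  using assms(2,3)
proof (induction A rule: finite_induct)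
  interpret L: abelian_group "loc x d" by (rule loc_abelian_group[OF x])
  case empty
  show ?case using loc_zero[OF x] by simp
next
  interpret L: abelian_group "loc x d" by (rule loc_abelian_group[OF x])
  case (insert i A)
  have "(\<Oplus>\<^bsub>loc x d\<^esub>i\<in>insert i A. fr x (f i) s) = fr x (f i) s \<oplus>\<^bsub>loc x d\<^esub> (\<Oplus>\<^bsub>loc x d\<^esub>i\<in>A. fr x (f i) s)"
    using insert by (intro L.finsum_insert) (auto simp: loc_carrier)
  also have "\<dots> = fr x (\<Sum>i\<in>insert i A. f i) s"
    using insert by (simp add: loc_add[OF x] polys_sum)
  finally show ?case .
qed

end

section \<open>The Cech complex of the quotient ring\<close>

lemma var_prod_power: "finite S \<Longrightarrow> (var_prod S :: 'k::field poly) ^ k = monom (twist (\<lambda>_. k) S)"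
proof (induction S rule: finite_induct)
  case empty
  show ?case by (simp add: var_prod_def twist_def)
next
  case (insert i S)
  have "(var_prod (insert i S) :: 'k poly) = Var i * var_prod S" using insert.hyps by (simp add: var_prod_def)
  then have "(var_prod (insert i S) :: 'k poly) ^ k = Var i ^ k * var_prod S ^ k" by (simp add: power_mult_distrib)
  also have "\<dots> = monom (twist (\<lambda>_. k) (insert i S))"
    using insert by (simp add: Var_power twist_insert monom_add)
  finally show ?case .
qed

lemma var_prod_polys: "S \<subseteq> {1..n} \<Longrightarrow> var_prod S \<in> polys n"
  unfolding var_prod_def by (rule polys_prod, rule polys_Var) blast

lemma cech_index_iff: "S \<in> cech_index n p \<longleftrightarrow> S \<subseteq> {1..n} \<and> card S = p"
  by (simp add: cech_index_def)

lemma finite_cech_index: "finite (cech_index n p)"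
  by (rule finite_subset[of _ "Pow {1..n}"]) (auto simp: cech_index_def)

lemma cech_index_polys: "S \<in> cech_index n p \<Longrightarrow> var_prod S \<in> polys n"
  by (simp add: cech_index_iff var_prod_polys)

lemma cech_index_finite: "S \<in> cech_index n p \<Longrightarrow> finite S"
  using finite_subset by (auto simp: cech_index_def)

section \<open>Statements that hold for all large exponents, and cochains of mixed degree\<close>

lemma eventually_obtain: "\<forall>\<^sub>F s in at_top. P s \<Longrightarrow> \<exists>s::nat. P s"
  by (auto simp: eventually_at_top_linorder)

lemma eventually_choice:
  assumes "finite A" "\<And>S. S \<in> A \<Longrightarrow> \<forall>\<^sub>F s :: nat in at_top. \<exists>f. P S s f"
  shows "\<forall>\<^sub>F s in at_top. \<exists>F. \<forall>S\<in>A. P S s (F S)"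
proof -
  have "\<forall>\<^sub>F s in at_top. \<forall>S\<in>A. \<exists>f. P S s f"
    using assms by (intro eventually_ball_finite) auto
  then show ?thesis by (rule eventually_mono) metis
qed

lemma cochainsI:
  "(\<And>S. F S \<in> polys n) \<Longrightarrow> (\<And>S. \<not> S \<subseteq> {1..n} \<Longrightarrow> F S = 0) \<Longrightarrow> F \<in> cochains n"
  unfolding cochains_def by blast

lemma cochains_0: "(\<lambda>_. 0) \<in> cochains n"
  by (simp add: cochains_def)

lemma cochains_add: "F \<in> cochains n \<Longrightarrow> G \<in> cochains n \<Longrightarrow> (\<lambda>S. F S + G S) \<in> cochains n"
  by (rule cochainsI) (simp_all add: polys_add cochains_polys cochains_eq_0)

lemma cochains_mult: "F \<in> cochains n \<Longrightarrow> r \<in> polys n \<Longrightarrow> (\<lambda>S. r * F S) \<in> cochains n"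
  by (rule cochainsI) (simp_all add: polys_mult cochains_polys cochains_eq_0)

lemma cochains_uminus: "F \<in> cochains n \<Longrightarrow> (\<lambda>S. - F S) \<in> cochains n"
  by (rule cochainsI) (simp_all add: polys_uminus cochains_polys cochains_eq_0)

lemma cochains_kdiff:
  assumes F: "F \<in> cochains n"
  shows "kdiff n t F \<in> cochains n"
proof (rule cochainsI)
  fix T
  have "monom (single i (t i)) * F (T - {i}) \<in> polys n" if "i \<in> {1..n}" for i
    using that by (intro polys_mult polys_monom single_in_monomials cochains_polys[OF F])
  then have "ksign T i * (monom (single i (t i)) * F (T - {i})) \<in> polys n" if "i \<in> {1..n}" for i
    unfolding ksign_def using that by (intro polys_mult[OF polys_power[OF polys_uminus[OF polys_1]]])
  then show "kdiff n t F T \<in> polys n"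
    unfolding kdiff_def by (intro polys_sum) blast
next
  fix T assume T: "\<not> T \<subseteq> {1..n}"
  have "F (T - {i}) = 0" if "i \<in> T \<inter> {1..n}" for i
    using that T by (intro cochains_eq_0[OF F]) auto
  then show "kdiff n t F T = 0" unfolding kdiff_def by (intro sum.neutral) simp
qed

lemma cochains_stretch:
  assumes F: "F \<in> cochains n"
  shows "stretch t t' F \<in> cochains n"
proof (rule cochainsI)
  fix S show "stretch t t' F S \<in> polys n"
    unfolding stretch_def
  proof (cases "S \<subseteq> {1..n}")
    case True
    then show "monom (twist (\<lambda>i. t' i - t i) S) * F S \<in> polys n"
      by (intro polys_mult polys_monom twist_in_monomials cochains_polys[OF F])
  qed (simp add: cochains_eq_0[OF F])
qed (simp add: stretch_def cochains_eq_0[OF F])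

text \<open>Cochains concentrated in cohomological degree \<open>p - 1\<close>. Written with a
  successor, the condition leaves only zero for \<open>p = 0\<close>, in agreement with
  \<open>cech_coboundaries\<close>.\<close>

definition preboundary :: "nat \<Rightarrow> nat \<Rightarrow> 'k::field cochain set" where
  "preboundary n p = {U \<in> cochains n. \<forall>S. U S \<noteq> 0 \<longrightarrow> Suc (card S) = p}"

lemma preboundary_cochains: "U \<in> preboundary n p \<Longrightarrow> U \<in> cochains n"
  by (simp add: preboundary_def)

context homog_ideal
begin

abbreviation "C p \<equiv> cech_module n Q p"
abbreviation "cst (s::nat) \<equiv> (\<lambda>_::nat. s)"

text \<open>The canonical map from stage \<open>s\<close> of the direct system to the Cech complex.
  That this complex is the direct limit is the content of \<open>phi_stretch\<close>,
  \<open>phi_surj\<close> and \<open>phi_eqD\<close>.\<close>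

definition phi :: "nat \<Rightarrow> nat \<Rightarrow> 'k cochain \<Rightarrow> nat set \<Rightarrow> ('k poly set \<times> nat) set" where
  "phi p s F = (\<lambda>S\<in>cech_index n p. fr (var_prod S) (F S) s)"

lemma C_simps:
  "carrier (C p) = (\<Pi>\<^sub>E S\<in>cech_index n p. carrier (loc (var_prod S) (card S)))"
  "c \<oplus>\<^bsub>C p\<^esub> c' = (\<lambda>S\<in>cech_index n p. c S \<oplus>\<^bsub>loc (var_prod S) (card S)\<^esub> c' S)"
  "r \<odot>\<^bsub>C p\<^esub> c = (\<lambda>S\<in>cech_index n p. r \<odot>\<^bsub>loc (var_prod S) (card S)\<^esub> c S)"
  "\<zero>\<^bsub>C p\<^esub> = (\<lambda>S\<in>cech_index n p. \<zero>\<^bsub>loc (var_prod S) (card S)\<^esub>)"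
  "component (C p) j = (\<Pi>\<^sub>E S\<in>cech_index n p. component (loc (var_prod S) (card S)) j)"
  by (simp_all add: cech_module_def)

lemma phi_carrier: "F \<in> cochains n \<Longrightarrow> phi p s F \<in> carrier (C p)"
  unfolding C_simps phi_def by (auto simp: loc_carrier cochains_polys)

lemma phi_add:
  assumes "F \<in> cochains n" "G \<in> cochains n"
  shows "phi p s F \<oplus>\<^bsub>C p\<^esub> phi p s G = phi p s (\<lambda>S. F S + G S)"
  unfolding C_simps phi_def using assms
  by (intro restrict_ext) (simp add: loc_add cech_index_polys cochains_polys)

lemma phi_smult:
  assumes "F \<in> cochains n" "r \<in> polys n"
  shows "r \<odot>\<^bsub>C p\<^esub> phi p s F = phi p s (\<lambda>S. r * F S)"
  unfolding C_simps phi_def using assms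
  by (intro restrict_ext) (simp add: loc_smult cech_index_polys cochains_polys)

lemma phi_zero: "\<zero>\<^bsub>C p\<^esub> = phi p s (\<lambda>_. 0)"
  unfolding C_simps phi_def by (intro restrict_ext) (simp add: loc_zero cech_index_polys)

lemma phi_cong:
  assumes "F \<in> cochains n" "G \<in> cochains n" "\<And>S. S \<in> cech_index n p \<Longrightarrow> F S - G S \<in> I"
  shows "phi p s F = phi p s G"
  unfolding phi_def using assms
  by (intro restrict_ext fr_cong cech_index_polys cochains_polys) auto

lemma stretch_cst: "S \<in> cech_index n p \<Longrightarrow> stretch (cst s) (cst s') F S = var_prod S ^ (s' - s) * F S"
  by (simp add: stretch_def var_prod_power cech_index_finite)

lemma phi_stretch:
  assumes "F \<in> cochains n" "s \<le> s'"
  shows "phi p s' (stretch (cst s) (cst s') F) = phi p s F"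
  unfolding phi_def using assms
  by (intro restrict_ext) (simp add: stretch_cst fr_common[symmetric] cech_index_polys cochains_polys)

text \<open>Equality of fractions comes with an exponent after which the numerators agree modulo
  \<open>I\<close>. There are finitely many positions, so one bound serves them all.\<close>

lemma phi_eqD:
  assumes F: "F \<in> cochains n" and G: "G \<in> cochains n" and eq: "phi p s F = phi p s G"
  shows "\<forall>\<^sub>F s' in at_top. \<forall>S\<in>cech_index n p. stretch (cst s) (cst s') F S - stretch (cst s) (cst s') G S \<in> I"
proof (rule eventually_ball_finite[OF finite_cech_index], rule ballI)
  fix S assume S: "S \<in> cech_index n p"
  have x: "var_prod S \<in> polys n" by (rule cech_index_polys[OF S])
  have "fr (var_prod S) (F S) s = fr (var_prod S) (G S) s"
    using fun_cong[OF eq, of S] S by (simp add: phi_def)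
  then obtain u where u: "var_prod S ^ (u + s) * F S - var_prod S ^ (u + s) * G S \<in> I"
    using fr_eq_iff[OF x cochains_polys[OF F] cochains_polys[OF G]] by blast
  have "stretch (cst s) (cst s') F S - stretch (cst s) (cst s') G S \<in> I" if "s + (u + s) \<le> s'" for s'
  proof -
    define k where "k = s' - s - (u + s)"
    have s': "s' - s = k + (u + s)" using that by (simp add: k_def)
    have "var_prod S ^ k * (var_prod S ^ (u + s) * F S - var_prod S ^ (u + s) * G S) \<in> I"
      by (rule mult_in[OF polys_power[OF x] u])
    then show ?thesis unfolding stretch_cst[OF S] s' by (simp add: power_add right_diff_distrib mult.assoc)
  qed
  then show "\<forall>\<^sub>F s' in at_top. stretch (cst s) (cst s') F S - stretch (cst s) (cst s') G S \<in> I"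
    unfolding eventually_at_top_linorder by blast
qed

text \<open>Over the denominator exponent \<open>s\<close>, the localization map at \<open>i\<close>
  multiplies the numerator by the \<open>s\<close>-th power of \<open>Var i\<close>, as the Koszul
  differential with constant exponents does.\<close>

lemma cech_diff_phi:
  assumes F: "F \<in> cochains n"
  shows "cech_diff n Q p (phi p s F) = phi (Suc p) s (kdiff n (cst s) F)"
  unfolding cech_diff_def phi_def[of "Suc p"]
proof (rule restrict_ext)
  fix T assume T: "T \<in> cech_index n (Suc p)"
  have TF: "T \<subseteq> {1..n}" "finite T" using T cech_index_finite by (auto simp: cech_index_iff)
  have xT: "var_prod T \<in> polys n" by (rule cech_index_polys[OF T])
  let ?L = "loc (var_prod T) (card T)"
  let ?g = "\<lambda>i. ((-1) ^ card {l\<in>T. l < i}) \<odot>\<^bsub>?L\<^esub>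
      localization_map Q (var_prod (T - {i})) (Var i) (phi p s F (T - {i}))"
  let ?f = "\<lambda>i. ksign T i * (monom (single i s) * F (T - {i}))"
  have fi: "?f i \<in> polys n" if "i \<in> T" for i
    unfolding ksign_def using that TF
    by (intro polys_mult polys_power polys_uminus polys_1 polys_monom single_in_monomials cochains_polys[OF F]) auto
  have summand: "?g i = fr (var_prod T) (?f i) s" if i: "i \<in> T" for i
  proof -
    have idx: "T - {i} \<in> cech_index n p" using T i TF by (auto simp: cech_index_iff)
    have prod: "var_prod (T - {i}) * Var i = (var_prod T :: 'k poly)"
      using TF i by (simp add: var_prod_def prod.remove mult.commute)
    have v: "(Var i :: 'k poly) \<in> polys n" using i TF by (intro polys_Var) blast
    have "localization_map Q (var_prod (T - {i})) (Var i) (phi p s F (T - {i})) =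
        fr (var_prod T) (Var i ^ s * F (T - {i})) s"
      using loc_map[OF cech_index_polys[OF idx] v cochains_polys[OF F]] idx by (simp add: phi_def prod)
    then show ?thesis
      using v by (simp add: loc_smult[OF xT] polys_mult polys_power polys_uminus cochains_polys[OF F] ksign_def Var_power[symmetric])
  qed
  interpret L: abelian_group "loc (var_prod T) (card T)" by (rule loc_abelian_group[OF xT])
  have "(\<Oplus>\<^bsub>?L\<^esub>i\<in>T. ?g i) =
    (\<Oplus>\<^bsub>?L\<^esub>i\<in>T. fr (var_prod T) (?f i) s)"
    using fi by (intro L.finsum_cong' summand) (auto simp: loc_carrier)
  also have "\<dots> = fr (var_prod T) (\<Sum>i\<in>T. ?f i) s"
    by (rule loc_finsum[OF xT TF(2) fi])
  also have "(\<Sum>i\<in>T. ?f i) = kdiff n (cst s) F T"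
    using TF by (simp add: kdiff_def Int_absorb2)
  finally show "(\<Oplus>\<^bsub>?L\<^esub>i\<in>T. ?g i) = fr (var_prod T) (kdiff n (cst s) F T) s" .
qed

text \<open>The representative vanishes off cardinality \<open>p\<close>, so that it qualifies as a
  member of \<open>preboundary n (Suc p)\<close>.\<close>

lemma phi_surj:
  assumes c: "c \<in> carrier (C p)"
  shows "\<forall>\<^sub>F s in at_top. \<exists>F. F \<in> cochains n \<and> (\<forall>S. F S \<noteq> 0 \<longrightarrow> card S = p) \<and> c = phi p s F"
proof -
  have "\<forall>\<^sub>F s in at_top. \<exists>f. f \<in> polys n \<and> c S = fr (var_prod S) f s" if S: "S \<in> cech_index n p" for S
  proof -
    have "c S \<in> carrier (loc (var_prod S) (card S))" using c S by (auto simp: C_simps)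
    then show ?thesis using loc_carrierE[OF cech_index_polys[OF S]] unfolding eventually_at_top_linorder by metis
  qed
  from eventually_choice[OF finite_cech_index this]
  show ?thesis
  proof (rule eventually_mono)
    fix s assume "\<exists>F. \<forall>S\<in>cech_index n p. F S \<in> polys n \<and> c S = fr (var_prod S) (F S) s"
    then obtain F where F: "\<And>S. S \<in> cech_index n p \<Longrightarrow> F S \<in> polys n \<and> c S = fr (var_prod S) (F S) s" by blast
    define F' where "F' S = (if S \<in> cech_index n p then F S else 0)" for S
    have "F' \<in> cochains n" using F by (auto simp: F'_def cochains_def cech_index_iff)
    moreover have "\<forall>S. F' S \<noteq> 0 \<longrightarrow> card S = p" by (auto simp: F'_def cech_index_iff)
    moreover have "c = phi p s F'"
    proof (rule extensionalityI)
      show "c \<in> extensional (cech_index n p)" using c unfolding C_simps PiE_def by blast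
    qed (simp_all add: phi_def F F'_def)
    ultimately show "\<exists>F. F \<in> cochains n \<and> (\<forall>S. F S \<noteq> 0 \<longrightarrow> card S = p) \<and> c = phi p s F" by blast
  qed
qed

lemma phi_component:
  assumes F: "F \<in> koszul n (int p) (cst s) j"
  shows "phi p s F \<in> component (C p) j"
  unfolding C_simps phi_def
proof (rule restrict_PiE_iff[THEN iffD2], rule ballI)
  fix S assume "S \<in> cech_index n p"
  have "F S \<in> homogeneous_polys n (j + int s * int (card S))"
    using koszul_homogeneous[OF F, of S] by (simp add: mult.commute)
  then show "fr (var_prod S) (F S) s \<in> component (loc (var_prod S) (card S)) j" by (auto simp: loc_component)
qed

lemma phi_surj_component:
  assumes c: "c \<in> component (C p) j"
  shows "\<forall>\<^sub>F s in at_top. \<exists>F. F \<in> koszul n (int p) (cst s) j \<and> c = phi p s F"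
proof -
  have "\<forall>\<^sub>F s in at_top. \<exists>f. f \<in> homogeneous_polys n (j + int s * int (card S)) \<and> c S = fr (var_prod S) f s"
    if S: "S \<in> cech_index n p" for S
  proof -
    have "c S \<in> component (loc (var_prod S) (card S)) j" using c S by (auto simp: C_simps)
    then obtain f s where f: "f \<in> homogeneous_polys n (j + int s * int (card S))" "c S = fr (var_prod S) f s"
      by (auto simp: loc_component)
    have "var_prod S ^ (s' - s) * f \<in> homogeneous_polys n (j + int s' * int (card S)) \<and>
        c S = fr (var_prod S) (var_prod S ^ (s' - s) * f) s'" if "s \<le> s'" for s'
    proof
      have "var_prod S ^ (s' - s) = (monom (twist (cst (s' - s)) S) :: 'k poly)"
        by (rule var_prod_power[OF cech_index_finite[OF S]])
      moreover have "int (expo_deg (twist (cst (s' - s)) S)) = (int s' - int s) * int (card S)"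
        using that by (simp add: expo_deg_twist of_nat_diff mult.commute)
      moreover have "twist (cst (s' - s)) S \<in> monomials n" using S by (simp add: cech_index_iff twist_in_monomials)
      moreover have "j + int s' * int (card S) = j + int s * int (card S) + (int s' - int s) * int (card S)"
        by (simp add: algebra_simps)
      ultimately show "var_prod S ^ (s' - s) * f \<in> homogeneous_polys n (j + int s' * int (card S))"
        using hom_monom_mult[OF f(1)] by metis
      show "c S = fr (var_prod S) (var_prod S ^ (s' - s) * f) s'"
        using fr_common[OF cech_index_polys[OF S] _ that] f by (simp add: hom_iff)
    qed
    then show ?thesis unfolding eventually_at_top_linorder by blast
  qed
  from eventually_choice[OF finite_cech_index this]
  show ?thesis
  proof (rule eventually_mono)
    fix s assume "\<exists>F. \<forall>S\<in>cech_index n p. F S \<in> homogeneous_polys n (j + int s * int (card S)) \<and> c S = fr (var_prod S) (F S) s"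
    then obtain F where F: "\<And>S. S \<in> cech_index n p \<Longrightarrow>
        F S \<in> homogeneous_polys n (j + int s * int (card S)) \<and> c S = fr (var_prod S) (F S) s" by blast
    define F' where "F' S = (if S \<in> cech_index n p then F S else 0)" for S
    have "F' \<in> koszul n (int p) (cst s) j"
      by (rule koszulI) (use F in \<open>auto simp: F'_def cech_index_iff mult.commute\<close>)
    moreover have "c = phi p s F'"
    proof (rule extensionalityI)
      show "c \<in> extensional (cech_index n p)" using c unfolding C_simps PiE_def by blast
    qed (simp_all add: phi_def F F'_def)
    ultimately show "\<exists>F. F \<in> koszul n (int p) (cst s) j \<and> c = phi p s F" by blast
  qed
qed

section \<open>Cocycles and coboundaries of the Cech complex\<close>

abbreviation "Zc p \<equiv> cech_cocycles n Q p"
abbreviation "Bc p \<equiv> cech_coboundaries n Q p"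
abbreviation "K p \<equiv> cech_cocycle_module n Q p"

lemma phi_cocycle_iff:
  assumes "F \<in> cochains n"
  shows "phi p s F \<in> Zc p \<longleftrightarrow> phi (Suc p) s (kdiff n (cst s) F) = phi (Suc p) s (\<lambda>_. 0)"
  using assms by (simp add: cech_cocycles_def phi_carrier cech_diff_phi phi_zero[of "Suc p" s])

lemma K_simps:
  "carrier (K p) = Zc p" "add (K p) = add (C p)" "smult (K p) = smult (C p)" "zero (K p) = zero (C p)"
  "component (K p) j = component (C p) j \<inter> Zc p"
  by (simp_all add: cech_cocycle_module_def)

lemma cocycle_surj:
  assumes "c \<in> Zc p"
  shows "\<forall>\<^sub>F s in at_top. \<exists>F. F \<in> cochains n \<and> c = phi p s F"
proof -
  have "c \<in> carrier (C p)" using assms by (simp add: cech_cocycles_def)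
  from phi_surj[OF this] show ?thesis by (rule eventually_mono) blast
qed

lemma phi_cocycle_comb:
  assumes "F \<in> cochains n" "G \<in> cochains n" "phi p s F \<in> Zc p" "phi p s G \<in> Zc p" "r \<in> polys n"
  shows "phi p s (\<lambda>S. F S + r * G S) \<in> Zc p"
proof -
  have rG: "(\<lambda>S. r * G S) \<in> cochains n" using assms by (intro cochains_mult)
  have "phi (Suc p) s (kdiff n (cst s) (\<lambda>S. F S + r * G S)) =
      phi (Suc p) s (kdiff n (cst s) F) \<oplus>\<^bsub>C (Suc p)\<^esub> (r \<odot>\<^bsub>C (Suc p)\<^esub> phi (Suc p) s (kdiff n (cst s) G))"
    using assms rG by (simp add: phi_add phi_smult kdiff_add kdiff_mult cochains_kdiff cochains_mult)
  also have "\<dots> = phi (Suc p) s (\<lambda>_. 0) \<oplus>\<^bsub>C (Suc p)\<^esub> (r \<odot>\<^bsub>C (Suc p)\<^esub> phi (Suc p) s (\<lambda>_. 0))"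
    using assms phi_cocycle_iff by simp
  also have "\<dots> = phi (Suc p) s (\<lambda>_. 0)"
    using assms(5) by (simp add: phi_smult phi_add cochains_0)
  finally show ?thesis using phi_cocycle_iff cochains_add[OF assms(1) rG] by simp
qed

lemma phi_zero_cocycle: "phi p s (\<lambda>_. 0) \<in> Zc p"
  by (simp add: phi_cocycle_iff cochains_0 kdiff_0)

lemma K_abelian_group: "abelian_group (K p)"
proof -
  have common: "\<exists>s. \<forall>c\<in>S. \<exists>F. F \<in> cochains n \<and> c = phi p s F" if "finite S" "S \<subseteq> Zc p" for S
    using that by (intro eventually_obtain eventually_ball_finite ballI cocycle_surj) auto
  show ?thesis
  proof (rule abelian_groupI; unfold K_simps)
    show "\<zero>\<^bsub>C p\<^esub> \<in> Zc p" using phi_zero_cocycle phi_zero by simp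
  next
    fix c c' assume *: "c \<in> Zc p" "c' \<in> Zc p"
    then obtain s F F' where F: "F \<in> cochains n" "c = phi p s F" "F' \<in> cochains n" "c' = phi p s F'"
      using common[of "{c, c'}"] by auto
    show "c \<oplus>\<^bsub>C p\<^esub> c' \<in> Zc p" using F * phi_cocycle_comb[of F F' p s 1] by (simp add: phi_add)
    show "c \<oplus>\<^bsub>C p\<^esub> c' = c' \<oplus>\<^bsub>C p\<^esub> c" using F by (simp add: phi_add add.commute)
  next
    fix c c' c'' assume "c \<in> Zc p" "c' \<in> Zc p" "c'' \<in> Zc p"
    then obtain s F F' F'' where "F \<in> cochains n" "c = phi p s F" "F' \<in> cochains n" "c' = phi p s F'"
      "F'' \<in> cochains n" "c'' = phi p s F''"
      using common[of "{c, c', c''}"] by auto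
    then show "c \<oplus>\<^bsub>C p\<^esub> c' \<oplus>\<^bsub>C p\<^esub> c'' = c \<oplus>\<^bsub>C p\<^esub> (c' \<oplus>\<^bsub>C p\<^esub> c'')"
      by (simp add: phi_add cochains_add add.assoc)
  next
    fix c assume c: "c \<in> Zc p"
    then obtain s F where F: "F \<in> cochains n" "c = phi p s F"
      using common[of "{c}"] by auto
    show "\<zero>\<^bsub>C p\<^esub> \<oplus>\<^bsub>C p\<^esub> c = c" using F by (simp add: phi_zero[of p s] phi_add cochains_0)
    have "phi p s (\<lambda>S. - F S) \<in> Zc p"
      using phi_cocycle_comb[of "\<lambda>_. 0" F p s "-1"] F c phi_zero_cocycle cochains_0[of n] polys_uminus[OF polys_1, of n] by (simp add: polys_uminus)
    moreover have "phi p s (\<lambda>S. - F S) \<oplus>\<^bsub>C p\<^esub> c = \<zero>\<^bsub>C p\<^esub>"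
      using F by (simp add: phi_zero[of p s] phi_add cochains_uminus)
    ultimately show "\<exists>b\<in>Zc p. b \<oplus>\<^bsub>C p\<^esub> c = \<zero>\<^bsub>C p\<^esub>" by blast
  qed
qed

lemma coboundaryI:
  assumes U: "U \<in> preboundary n p"
  shows "phi p s (kdiff n (cst s) U) \<in> Bc p"
proof (cases p)
  case 0
  then have "U S = 0" for S using U by (auto simp: preboundary_def)
  then have "U = (\<lambda>_. 0)" by blast
  then show ?thesis using 0 by (simp add: cech_coboundaries_def kdiff_0 phi_zero[of 0 s])
next
  case (Suc q)
  then show ?thesis
    using cech_diff_phi[of U q s] phi_carrier[of U q s] preboundary_cochains[OF U] by (force simp: cech_coboundaries_def)
qed

lemma coboundaryD:
  assumes b: "b \<in> Bc p"
  shows "\<forall>\<^sub>F s in at_top. \<exists>U. U \<in> preboundary n p \<and> b = phi p s (kdiff n (cst s) U)"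
proof (cases p)
  case 0
  have "(\<lambda>_. 0) \<in> preboundary n 0 \<and> b = phi p s (kdiff n (cst s) (\<lambda>_. 0))" for s
    using b 0 by (simp add: cech_coboundaries_def kdiff_0 phi_zero[of 0 s] preboundary_def cochains_0)
  then show ?thesis using 0 by (intro always_eventually) blast
next
  case (Suc q)
  then obtain c where c: "c \<in> carrier (C q)" "b = cech_diff n Q q c" using b by (auto simp: cech_coboundaries_def)
  from phi_surj[OF c(1)] show ?thesis
  proof (rule eventually_mono)
    fix s assume "\<exists>F. F \<in> cochains n \<and> (\<forall>S. F S \<noteq> 0 \<longrightarrow> card S = q) \<and> c = phi q s F"
    then obtain U where "U \<in> cochains n" "\<forall>S. U S \<noteq> 0 \<longrightarrow> card S = q" "c = phi q s U" by blast
    then show "\<exists>U. U \<in> preboundary n p \<and> b = phi p s (kdiff n (cst s) U)"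
      using c(2) Suc by (auto simp: preboundary_def cech_diff_phi)
  qed
qed

lemma preboundary_comb:
  "U \<in> preboundary n p \<Longrightarrow> V \<in> preboundary n p \<Longrightarrow> r \<in> polys n \<Longrightarrow> (\<lambda>S. U S + r * V S) \<in> preboundary n p"
  unfolding preboundary_def by (simp add: cochains_add cochains_mult) (metis add_cancel_right_left mult_zero_right)

lemma coboundary_subset: "Bc p \<subseteq> Zc p"
proof
  fix b assume "b \<in> Bc p"
  then obtain s U where U: "U \<in> preboundary n p" "b = phi p s (kdiff n (cst s) U)"
    using eventually_obtain[OF coboundaryD] by blast
  have "kdiff n (cst s) (kdiff n (cst s) U) = (\<lambda>_. 0)" by (rule ext) (rule kdiff_kdiff)
  then show "b \<in> Zc p" using U preboundary_cochains[OF U(1)] by (simp add: phi_cocycle_iff cochains_kdiff)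
qed

lemma coboundary_comb:
  assumes "b \<in> Bc p" "b' \<in> Bc p" "r \<in> polys n"
  shows "b \<oplus>\<^bsub>C p\<^esub> r \<odot>\<^bsub>C p\<^esub> b' \<in> Bc p"
proof -
  obtain s where s: "\<exists>U. U \<in> preboundary n p \<and> b = phi p s (kdiff n (cst s) U)"
      "\<exists>U. U \<in> preboundary n p \<and> b' = phi p s (kdiff n (cst s) U)"
    using eventually_obtain[OF eventually_conj[OF coboundaryD[OF assms(1)] coboundaryD[OF assms(2)]]] by blast
  then obtain U V where U: "U \<in> preboundary n p" "b = phi p s (kdiff n (cst s) U)"
    and V: "V \<in> preboundary n p" "b' = phi p s (kdiff n (cst s) V)" by blast
  have "b \<oplus>\<^bsub>C p\<^esub> r \<odot>\<^bsub>C p\<^esub> b' = phi p s (kdiff n (cst s) (\<lambda>S. U S + r * V S))"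
    using U V assms(3) preboundary_cochains[OF U(1)] preboundary_cochains[OF V(1)]
    by (simp add: phi_add phi_smult kdiff_add kdiff_mult cochains_kdiff cochains_mult)
  then show ?thesis using coboundaryI[OF preboundary_comb[OF U(1) V(1) assms(3)], of s] by simp
qed

lemma zero_coboundary: "phi p s (\<lambda>_. 0) \<in> Bc p"
  using coboundaryI[of "\<lambda>_. 0" p s] by (simp add: preboundary_def cochains_0 kdiff_0)

lemma coboundary_subgroup: "abelian_subgroup (Bc p) (K p)"
proof -
  interpret G: abelian_group "K p" by (rule K_abelian_group)
  have "subgroup (Bc p) (add_monoid (K p))"
  proof (rule subgroup.intro)
    show "Bc p \<subseteq> carrier (add_monoid (K p))" using coboundary_subset by (simp add: K_simps)
  next
    fix b b' assume bb: "b \<in> Bc p" "b' \<in> Bc p"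
    have "1 \<odot>\<^bsub>C p\<^esub> b' = b'"
    proof -
      obtain s U where U: "U \<in> preboundary n p" "b' = phi p s (kdiff n (cst s) U)"
        using eventually_obtain[OF coboundaryD[OF bb(2)]] by blast
      then show ?thesis using preboundary_cochains[OF U(1)] by (simp add: phi_smult cochains_kdiff)
    qed
    then show "b \<otimes>\<^bsub>add_monoid (K p)\<^esub> b' \<in> Bc p" using coboundary_comb[OF bb polys_1] by (simp add: K_simps)
  next
    show "\<one>\<^bsub>add_monoid (K p)\<^esub> \<in> Bc p" using zero_coboundary phi_zero by (simp add: K_simps)
  next
    fix b assume b: "b \<in> Bc p"
    obtain s U where U: "U \<in> preboundary n p" "b = phi p s (kdiff n (cst s) U)"
      using eventually_obtain[OF coboundaryD[OF b]] by blast
    let ?b = "phi p s (kdiff n (cst s) (\<lambda>S. 0 + (-1) * U S))"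
    have "(\<lambda>_. 0) \<in> preboundary n p" by (simp add: preboundary_def cochains_0)
    then have b': "?b \<in> Bc p" using U(1) polys_uminus[OF polys_1] by (intro coboundaryI preboundary_comb)
    have "?b \<oplus>\<^bsub>C p\<^esub> b = \<zero>\<^bsub>C p\<^esub>"
      using U preboundary_cochains[OF U(1)] kdiff_mult[of n "cst s" "-1" U]
      by (simp add: phi_zero[of p s] phi_add cochains_kdiff cochains_uminus)
    then have "\<ominus>\<^bsub>K p\<^esub> b = ?b"
      using b b' coboundary_subset by (intro G.minus_equality) (auto simp: K_simps)
    then show "inv\<^bsub>add_monoid (K p)\<^esub> b \<in> Bc p" using b' by (simp add: a_inv_def)
  qed
  then show ?thesis by (intro abelian_subgroupI3 additive_subgroupI K_abelian_group)
qed

end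

section \<open>Local cohomology and the Koszul complexes\<close>

lemma quotient_module_simps:
  "carrier (quotient_module M N) = {N +>\<^bsub>M\<^esub> m | m. m \<in> carrier M}"
  "\<zero>\<^bsub>quotient_module M N\<^esub> = N"
  "A \<oplus>\<^bsub>quotient_module M N\<^esub> B = A <+>\<^bsub>M\<^esub> B"
  "r \<odot>\<^bsub>quotient_module M N\<^esub> A = (\<Union>m\<in>A. N +>\<^bsub>M\<^esub> (r \<odot>\<^bsub>M\<^esub> m))"
  "component (quotient_module M N) j = {N +>\<^bsub>M\<^esub> m | m. m \<in> component M j}"
  by (auto simp: quotient_module_def A_RCOSETS_def' a_r_coset_def')

context homog_ideal
begin

abbreviation "H p \<equiv> local_cohomology n p Q"

definition hc :: "nat \<Rightarrow> (nat set \<Rightarrow> ('k poly set \<times> nat) set) \<Rightarrow> (nat set \<Rightarrow> ('k poly set \<times> nat) set) set" where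
  "hc p c = Bc p +>\<^bsub>K p\<^esub> c"

lemma H_simps:
  "carrier (H p) = hc p ` Zc p" "\<zero>\<^bsub>H p\<^esub> = Bc p" "A \<oplus>\<^bsub>H p\<^esub> A' = A <+>\<^bsub>K p\<^esub> A'"
  "r \<odot>\<^bsub>H p\<^esub> A = (\<Union>m\<in>A. hc p (r \<odot>\<^bsub>C p\<^esub> m))"
  "component (H p) j = hc p ` (component (C p) j \<inter> Zc p)"
  unfolding local_cohomology_def quotient_module_simps[of "K p"] hc_def K_simps by blast+

text \<open>The factor group of cocycles by coboundaries has the same carrier, unit and operation;
  its laws make finite sums in \<open>H p\<close> computable.\<close>

lemma H_abelian_monoid: "abelian_monoid (H p)"
proof -
  interpret A: abelian_subgroup "Bc p" "K p" by (rule coboundary_subgroup)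
  interpret F: comm_group "K p A_Mod Bc p" by (rule A.a_factorgroup_is_comm_group)
  have eq: "carrier (K p A_Mod Bc p) = carrier (H p)" "\<one>\<^bsub>K p A_Mod Bc p\<^esub> = \<zero>\<^bsub>H p\<^esub>"
      "x \<otimes>\<^bsub>K p A_Mod Bc p\<^esub> y = x \<oplus>\<^bsub>H p\<^esub> y" for x y
    unfolding H_simps by (auto simp: A_FactGroup_def' A_RCOSETS_def' hc_def a_r_coset_def' K_simps)
  show ?thesis
    using F.m_closed F.one_closed F.m_assoc F.m_comm F.l_one unfolding eq by (intro abelian_monoidI)
qed

lemma hc_add:
  assumes "c \<in> Zc p" "c' \<in> Zc p"
  shows "hc p c \<oplus>\<^bsub>H p\<^esub> hc p c' = hc p (c \<oplus>\<^bsub>C p\<^esub> c')"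
proof -
  interpret A: abelian_subgroup "Bc p" "K p" by (rule coboundary_subgroup)
  show ?thesis using A.a_rcos_sum[of c c'] assms by (simp add: H_simps hc_def K_simps)
qed

lemma hc_eq_zero_iff:
  assumes "c \<in> Zc p"
  shows "hc p c = \<zero>\<^bsub>H p\<^esub> \<longleftrightarrow> c \<in> Bc p"
proof -
  interpret A: abelian_subgroup "Bc p" "K p" by (rule coboundary_subgroup)
  show ?thesis
    using A.a_rcos_const[of c] A.a_rcos_self[of c] assms by (auto simp: H_simps hc_def K_simps)
qed

lemma hc_memE:
  assumes "m \<in> hc p c"
  obtains b where "b \<in> Bc p" "m = b \<oplus>\<^bsub>C p\<^esub> c"
  using assms by (auto simp: hc_def a_r_coset_def' K_simps)

lemma hc_self: "c \<in> Zc p \<Longrightarrow> c \<in> hc p c"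
proof -
  interpret A: abelian_subgroup "Bc p" "K p" by (rule coboundary_subgroup)
  show "c \<in> Zc p \<Longrightarrow> c \<in> hc p c" using A.a_rcos_self[of c] by (simp add: hc_def K_simps)
qed

lemma hc_shift:
  assumes "c \<in> Zc p" "b \<in> Bc p"
  shows "hc p (b \<oplus>\<^bsub>C p\<^esub> c) = hc p c"
proof -
  interpret A: abelian_subgroup "Bc p" "K p" by (rule coboundary_subgroup)
  have "b \<oplus>\<^bsub>C p\<^esub> c \<in> Bc p +>\<^bsub>K p\<^esub> c" using assms(2) by (auto simp: a_r_coset_def' K_simps)
  from A.a_repr_independence'[OF this] show ?thesis using assms(1) by (simp add: hc_def K_simps)
qed

text \<open>The scalar multiple is a union over a coset. It is a single coset because
  \<open>r\<close> maps coboundaries to coboundaries.\<close>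

lemma hc_smult:
  assumes F: "F \<in> cochains n" "phi p s F \<in> Zc p" and r: "r \<in> polys n"
  shows "r \<odot>\<^bsub>H p\<^esub> hc p (phi p s F) = hc p (phi p s (\<lambda>S. r * F S))"
proof -
  have rc: "phi p s (\<lambda>S. r * F S) \<in> Zc p"
    using phi_cocycle_comb[OF cochains_0 F(1) phi_zero_cocycle F(2) r] by simp
  have "r \<odot>\<^bsub>H p\<^esub> hc p (phi p s F) = (\<Union>m\<in>hc p (phi p s F). hc p (r \<odot>\<^bsub>C p\<^esub> m))" by (simp add: H_simps)
  also have "\<dots> = hc p (phi p s (\<lambda>S. r * F S))"
  proof (rule UN_eq_const)
    show "hc p (phi p s F) \<noteq> {}" using hc_self[OF F(2)] by blast
    fix m assume "m \<in> hc p (phi p s F)"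
    then obtain b where b: "b \<in> Bc p" "m = b \<oplus>\<^bsub>C p\<^esub> phi p s F" by (rule hc_memE)
    obtain s' U where s': "s \<le> s'" and U: "U \<in> preboundary n p" "b = phi p s' (kdiff n (cst s') U)"
      using eventually_obtain[OF eventually_conj[OF eventually_ge_at_top[of s] coboundaryD[OF b(1)]]] by blast
    note Uc = preboundary_cochains[OF U(1)]
    define F' where "F' = stretch (cst s) (cst s') F"
    have F': "F' \<in> cochains n" "phi p s F = phi p s' F'"
      using cochains_stretch[OF F(1)] phi_stretch[OF F(1) s'] by (simp_all add: F'_def)
    have rF: "phi p s (\<lambda>S. r * F S) = r \<odot>\<^bsub>C p\<^esub> phi p s' F'"
      using phi_smult[OF F(1) r, of p s] F'(2) by simp
    have "r \<odot>\<^bsub>C p\<^esub> m = (r \<odot>\<^bsub>C p\<^esub> b) \<oplus>\<^bsub>C p\<^esub> (r \<odot>\<^bsub>C p\<^esub> phi p s' F')"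
      using b(2) U F' Uc r
      by (simp add: phi_add phi_smult cochains_kdiff cochains_add cochains_mult distrib_left)
    moreover have "r \<odot>\<^bsub>C p\<^esub> b \<in> Bc p"
      using coboundary_comb[OF zero_coboundary[of p s'] b(1) r] U Uc r
      by (simp add: phi_add phi_smult cochains_kdiff cochains_mult cochains_0)
    ultimately show "hc p (r \<odot>\<^bsub>C p\<^esub> m) = hc p (phi p s (\<lambda>S. r * F S))"
      using hc_shift rc rF by simp
  qed
  finally show ?thesis .
qed

lemma H_lincomb:
  assumes "finite A" and z: "\<And>v. v \<in> A \<Longrightarrow> z v \<in> cochains n \<and> phi p s (z v) \<in> Zc p \<and> g v = hc p (phi p s (z v))"
  shows "(\<lambda>S. \<Sum>v\<in>A. Const (c v) * z v S) \<in> cochains n \<and>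
    phi p s (\<lambda>S. \<Sum>v\<in>A. Const (c v) * z v S) \<in> Zc p \<and>
    (\<Oplus>\<^bsub>H p\<^esub>v\<in>A. Const (c v) \<odot>\<^bsub>H p\<^esub> g v) = hc p (phi p s (\<lambda>S. \<Sum>v\<in>A. Const (c v) * z v S))"
  using assms
proof (induction A rule: finite_induct)
  interpret abelian_monoid "H p" by (rule H_abelian_monoid)
  case empty
  have "hc p (phi p s (\<lambda>_. 0)) = \<zero>\<^bsub>H p\<^esub>" using hc_eq_zero_iff[OF phi_zero_cocycle] zero_coboundary by blast
  then show ?case by (simp add: cochains_0 phi_zero_cocycle)
next
  interpret abelian_monoid "H p" by (rule H_abelian_monoid)
  case (insert v A)
  let ?W = "\<lambda>S. \<Sum>v\<in>A. Const (c v) * z v S"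
  let ?V = "\<lambda>S. Const (c v) * z v S"
  have IH: "?W \<in> cochains n" "phi p s ?W \<in> Zc p" "(\<Oplus>\<^bsub>H p\<^esub>v\<in>A. Const (c v) \<odot>\<^bsub>H p\<^esub> g v) = hc p (phi p s ?W)"
    using insert by blast+
  have cls: "Const (c w) \<odot>\<^bsub>H p\<^esub> g w = hc p (phi p s (\<lambda>S. Const (c w) * z w S)) \<and>
      phi p s (\<lambda>S. Const (c w) * z w S) \<in> Zc p" if "w \<in> insert v A" for w
  proof -
    have w: "z w \<in> cochains n" "phi p s (z w) \<in> Zc p" "g w = hc p (phi p s (z w))" using insert.prems that by blast+
    show ?thesis
      using hc_smult[OF w(1,2) polys_Const[of "c w"]] phi_cocycle_comb[OF cochains_0 w(1) phi_zero_cocycle w(2) polys_Const[of "c w"]] w(3)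
      by simp
  qed
  have V: "?V \<in> cochains n" using insert.prems by (intro cochains_mult polys_Const) blast
  have eq: "(\<lambda>S. \<Sum>v\<in>insert v A. Const (c v) * z v S) = (\<lambda>S. ?V S + ?W S)" using insert.hyps by auto
  have "(\<Oplus>\<^bsub>H p\<^esub>w\<in>insert v A. Const (c w) \<odot>\<^bsub>H p\<^esub> g w) =
      Const (c v) \<odot>\<^bsub>H p\<^esub> g v \<oplus>\<^bsub>H p\<^esub> (\<Oplus>\<^bsub>H p\<^esub>w\<in>A. Const (c w) \<odot>\<^bsub>H p\<^esub> g w)"
    using insert.hyps cls by (intro finsum_insert) (auto simp: H_simps(1))
  also have "\<dots> = hc p (phi p s (\<lambda>S. ?V S + ?W S))"
    using cls[of v] IH V by (simp add: hc_add phi_add)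
  finally show ?case unfolding eq
    using cochains_add[OF V IH(1)] phi_cocycle_comb[OF V IH(1) _ IH(2) polys_1] cls[of v] by simp
qed

section \<open>Comparison of Koszul cohomology at a finite stage with local cohomology\<close>

lemma kcycle_cocycle:
  assumes "F \<in> kcycles n I (int p) (cst s) j"
  shows "F \<in> cochains n" "phi p s F \<in> Zc p"
proof -
  show F: "F \<in> cochains n" using assms koszul_cochains by (auto simp: kcycles_def)
  have "phi (Suc p) s (kdiff n (cst s) F) = phi (Suc p) s (\<lambda>_. 0)"
    by (rule phi_cong) (use assms F in \<open>auto simp: kcycles_def cochains_kdiff cochains_0\<close>)
  then show "phi p s F \<in> Zc p" using phi_cocycle_iff[OF F] by simp
qed

lemma kbound_coboundary:
  assumes "W \<in> kbounds n I (int p) (cst s) j"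
  shows "phi p s W \<in> Bc p"
proof -
  obtain u where W: "W \<in> koszul n (int p) (cst s) j" and u: "u \<in> koszul n (int p - 1) (cst s) j"
    and uI: "\<And>S. W S - kdiff n (cst s) u S \<in> I"
    using assms by (auto simp: kbounds_def)
  have "u \<in> preboundary n p"
    unfolding preboundary_def
  proof (intro CollectI conjI allI impI)
    show "u \<in> cochains n" by (rule koszul_cochains[OF u])
    fix S assume "u S \<noteq> 0"
    then have "int (card S) = int p - 1" using koszul_eq_0[OF u, of S] by blast
    then show "Suc (card S) = p" by linarith
  qed
  then have "phi p s (kdiff n (cst s) u) \<in> Bc p" by (rule coboundaryI)
  moreover have "phi p s W = phi p s (kdiff n (cst s) u)"
    by (rule phi_cong) (use uI W u in \<open>auto simp: koszul_cochains cochains_kdiff\<close>)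
  ultimately show ?thesis by simp
qed

text \<open>A preimage \<open>U\<close> over some denominator need be neither homogeneous nor exact
  modulo \<open>I\<close>. Stretching makes the equation hold modulo \<open>I\<close>, and the part
  of \<open>U\<close> in degree \<open>j\<close> still satisfies it because \<open>I\<close> is
  homogeneous.\<close>

lemma coboundary_kbound:
  assumes W: "W \<in> koszul n (int p) (cst s) j" and b: "phi p s W \<in> Bc p"
  shows "\<exists>s'\<ge>s. stretch (cst s) (cst s') W \<in> kbounds n I (int p) (cst s') j"
proof -
  note Wc = koszul_cochains[OF W]
  obtain s0 U where s0: "s \<le> s0" and U: "U \<in> preboundary n p" "phi p s W = phi p s0 (kdiff n (cst s0) U)"
    using eventually_obtain[OF eventually_conj[OF eventually_ge_at_top[of s] coboundaryD[OF b]]] by blast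
  note Uc = preboundary_cochains[OF U(1)]
  have "phi p s0 (stretch (cst s) (cst s0) W) = phi p s0 (kdiff n (cst s0) U)"
    using U(2) phi_stretch[OF Wc s0] by simp
  from phi_eqD[OF cochains_stretch[OF Wc] cochains_kdiff[OF Uc] this]
  obtain s' where s': "s0 \<le> s'" and eq: "\<And>S. S \<in> cech_index n p \<Longrightarrow>
      stretch (cst s0) (cst s') (stretch (cst s) (cst s0) W) S - stretch (cst s0) (cst s') (kdiff n (cst s0) U) S \<in> I"
    using eventually_obtain[OF eventually_conj[OF eventually_ge_at_top[of s0]]] by blast
  define W' where "W' = stretch (cst s) (cst s') W"
  define U' where "U' = stretch (cst s0) (cst s') U"
  have W': "W' \<in> koszul n (int p) (cst s') j" unfolding W'_def using s0 s' by (intro stretch_koszul[OF W]) simp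
  have U': "U' \<in> cochains n" unfolding U'_def by (rule cochains_stretch[OF Uc])
  have diff: "W' S - kdiff n (cst s') U' S \<in> I" if "S \<in> cech_index n p" for S
  proof -
    have "stretch (cst s0) (cst s') (stretch (cst s) (cst s0) W) = W'"
      unfolding W'_def using s0 s' by (intro stretch_stretch[OF Wc]) simp
    moreover have "kdiff n (cst s') U' = stretch (cst s0) (cst s') (kdiff n (cst s0) U)"
      unfolding U'_def using s' by (intro kdiff_stretch[OF Uc]) simp
    ultimately show ?thesis using eq[OF that] by simp
  qed
  \<comment> \<open>Selects degree \<open>j\<close> of fractions, that is, degree \<open>j\<close>
    plus that of the denominator for numerators; the differential preserves it.\<close>
  define R where "R S a \<longleftrightarrow> int (expo_deg a) = j + int (sum (cst s') S)" for S a
  have part: "restr (R S) f = homogeneous_part (j + int (sum (cst s') S)) f" for S f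
    unfolding homogeneous_part_eq by (rule restr_cong) (simp only: R_def)
  define V where "V = proj R U'"
  have inv: "twist_invariant n (cst s') R"
    unfolding twist_invariant_def
  proof (intro allI impI ballI)
    fix T i and a :: expo assume "T \<subseteq> {1..n}" "i \<in> T"
    then have "sum (cst s') T = s' + sum (cst s') (T - {i})" using finite_subset by (intro sum.remove) auto
    then show "R T (single i s' + a) = R (T - {i}) a"
      unfolding R_def expo_deg_add expo_deg_single by linarith
  qed
  have Vk: "V \<in> koszul n (int p - 1) (cst s') j"
  proof (rule koszulI)
    fix S
    have "V S = homogeneous_part (j + int (sum (cst s') S)) (U' S)"
      by (simp only: V_def proj_def part)
    then show "V S \<in> homogeneous_polys n (j + int (sum (cst s') S))"
      using homogeneous_part_in[OF cochains_polys[OF U']] by simp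
  next
    fix S assume S: "\<not> (S \<subseteq> {1..n} \<and> int (card S) = int p - 1)"
    have "U S = 0"
    proof (rule ccontr)
      assume "U S \<noteq> 0"
      then have "S \<subseteq> {1..n}" "Suc (card S) = p" using U(1) cochains_eq_0[OF Uc] unfolding preboundary_def by blast+
      then show False using S by auto
    qed
    then show "V S = 0" by (simp add: V_def U'_def stretch_def proj_def)
  qed
  have "W' S - kdiff n (cst s') V S \<in> I" for S
  proof (cases "S \<in> cech_index n p")
    case True
    have "restr (R S) (W' S) = W' S"
      using koszul_homogeneous[OF W', of S] by (intro restr_eq_self) (auto simp: hom_iff R_def)
    then have "W' S - kdiff n (cst s') V S = restr (R S) (W' S - kdiff n (cst s') U' S)"
      by (simp add: V_def kdiff_proj[OF inv U'] proj_def restr_diff)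
    also have "\<dots> = homogeneous_part (j + int (sum (cst s') S)) (W' S - kdiff n (cst s') U' S)"
      by (rule part)
    also have "\<dots> \<in> I" by (rule part_in[OF diff[OF True]])
    finally show ?thesis .
  next
    case False
    then have S: "\<not> (S \<subseteq> {1..n} \<and> int (card S) = int p)" by (simp add: cech_index_iff)
    have "kdiff n (cst s') V \<in> koszul n (int p) (cst s') j" using kdiff_in_koszul[OF Vk] by simp
    then have "kdiff n (cst s') V S = 0" using S by (rule koszul_eq_0)
    moreover have "W' S = 0" using W' S by (rule koszul_eq_0)
    ultimately show ?thesis by simp
  qed
  then have "W' \<in> kbounds n I (int p) (cst s') j" unfolding kbounds_def using W' Vk by blast
  then show ?thesis using s0 s' unfolding W'_def by (intro exI[of _ s']) simp
qed

text \<open>The differential of a representative vanishes only as a fraction. Stretching moves it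
  into \<open>I\<close>, at all positions simultaneously.\<close>

lemma cohomology_class_kcycle:
  assumes "v \<in> component (H p) j"
  shows "\<forall>\<^sub>F s in at_top. \<exists>F. F \<in> kcycles n I (int p) (cst s) j \<and> v = hc p (phi p s F)"
proof -
  obtain m where m: "m \<in> component (C p) j" "m \<in> Zc p" "v = hc p m" using assms by (auto simp: H_simps)
  obtain s0 F where F: "F \<in> koszul n (int p) (cst s0) j" "m = phi p s0 F"
    using eventually_obtain[OF phi_surj_component[OF m(1)]] by blast
  note Fc = koszul_cochains[OF F(1)]
  have "phi (Suc p) s0 (kdiff n (cst s0) F) = phi (Suc p) s0 (\<lambda>_. 0)"
    using m(2) F(2) phi_cocycle_iff[OF Fc] by simp
  from phi_eqD[OF cochains_kdiff[OF Fc] cochains_0 this]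
  have "\<forall>\<^sub>F s in at_top. s0 \<le> s \<and> (\<forall>S\<in>cech_index n (Suc p). stretch (cst s0) (cst s) (kdiff n (cst s0) F) S \<in> I)"
    by (intro eventually_conj eventually_ge_at_top) (simp add: stretch_def)
  then show ?thesis
  proof (rule eventually_mono, elim conjE)
    fix s assume s: "s0 \<le> s" and cyc: "\<forall>S\<in>cech_index n (Suc p). stretch (cst s0) (cst s) (kdiff n (cst s0) F) S \<in> I"
    let ?F = "stretch (cst s0) (cst s) F"
    have Fk: "?F \<in> koszul n (int p) (cst s) j" using s by (intro stretch_koszul[OF F(1)]) simp
    have dF: "kdiff n (cst s) ?F = stretch (cst s0) (cst s) (kdiff n (cst s0) F)"
      using s by (intro kdiff_stretch[OF Fc]) simp
    have "kdiff n (cst s) ?F T \<in> I" for T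
    proof (cases "T \<in> cech_index n (Suc p)")
      case True
      then show ?thesis using cyc dF by simp
    next
      case False
      then have "\<not> (T \<subseteq> {1..n} \<and> int (card T) = int p + 1)" by (auto simp: cech_index_iff)
      then have "kdiff n (cst s) ?F T = 0" by (rule koszul_eq_0[OF kdiff_in_koszul[OF Fk]])
      then show ?thesis by simp
    qed
    then have "?F \<in> kcycles n I (int p) (cst s) j" using Fk by (simp add: kcycles_def)
    moreover have "v = hc p (phi p s ?F)" using m(3) F(2) phi_stretch[OF Fc s] by simp
    ultimately show "\<exists>F. F \<in> kcycles n I (int p) (cst s) j \<and> v = hc p (phi p s F)" by blast
  qed
qed

text \<open>A relation at stage \<open>s\<close> persists in the limit, so independence in the limit
  forces independence at every stage where all classes are represented by cycles.\<close>

theorem koszul_indep_of_cohomology: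
  assumes X: "finite X" "X \<subseteq> component (H p) j" "lin_independent (H p) X"
  shows "\<forall>\<^sub>F s in at_top. \<exists>z. koszul_indep n I (int p) (cst s) j X z"
proof -
  have "\<forall>\<^sub>F s in at_top. \<exists>z. \<forall>v\<in>X. z v \<in> kcycles n I (int p) (cst s) j \<and> v = hc p (phi p s (z v))"
    using X by (intro eventually_choice cohomology_class_kcycle) auto
  then show ?thesis
  proof (rule eventually_mono)
    fix s assume "\<exists>z. \<forall>v\<in>X. z v \<in> kcycles n I (int p) (cst s) j \<and> v = hc p (phi p s (z v))"
    then obtain z where z: "\<And>v. v \<in> X \<Longrightarrow> z v \<in> kcycles n I (int p) (cst s) j"
        "\<And>v. v \<in> X \<Longrightarrow> v = hc p (phi p s (z v))" by blast
    have "\<forall>v\<in>X. c v = 0" if B: "(\<lambda>S. \<Sum>v\<in>X. Const (c v) * z v S) \<in> kbounds n I (int p) (cst s) j" for c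
    proof -
      let ?W = "\<lambda>S. \<Sum>v\<in>X. Const (c v) * z v S"
      have "?W \<in> cochains n \<and> phi p s ?W \<in> Zc p \<and> (\<Oplus>\<^bsub>H p\<^esub>v\<in>X. Const (c v) \<odot>\<^bsub>H p\<^esub> v) = hc p (phi p s ?W)"
        by (rule H_lincomb[OF X(1)]) (intro conjI kcycle_cocycle[OF z(1)] z(2))
      then have "(\<Oplus>\<^bsub>H p\<^esub>v\<in>X. Const (c v) \<odot>\<^bsub>H p\<^esub> v) = \<zero>\<^bsub>H p\<^esub>"
        using kbound_coboundary[OF B] hc_eq_zero_iff by simp
      then show ?thesis using X(3) unfolding lin_independent_def by blast
    qed
    then have "koszul_indep n I (int p) (cst s) j X z" using X(1) z(1) unfolding koszul_indep_def by blast
    then show "\<exists>z. koszul_indep n I (int p) (cst s) j X z" by blast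
  qed
qed

text \<open>A relation in the limit holds at some later stage \<open>s'\<close>, and
  \<open>stretch_inj\<close> brings it back to stage \<open>s\<close>. The bound on \<open>s\<close>
  puts the cones in between into the range of vanishing.\<close>

theorem cohomology_indep_of_koszul:
  assumes z: "koszul_indep n I (int p) (cst s) j A z"
    and acyclic: "\<And>p t d. d0 \<le> d \<Longrightarrow> kcycles n I p t d = kbounds n I p t d" and s: "d0 \<le> j + int s"
  obtains X where "finite X" "X \<subseteq> component (H p) j" "lin_independent (H p) X" "card X = card A"
proof -
  have fA: "finite A" and zk: "\<And>v. v \<in> A \<Longrightarrow> z v \<in> kcycles n I (int p) (cst s) j"
    and ind: "\<And>c. (\<lambda>S. \<Sum>v\<in>A. Const (c v) * z v S) \<in> kbounds n I (int p) (cst s) j \<Longrightarrow> \<forall>v\<in>A. c v = 0"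
    using z unfolding koszul_indep_def by blast+
  have ind': "\<forall>v\<in>A. c v = 0" if cob: "phi p s (\<lambda>S. \<Sum>v\<in>A. Const (c v) * z v S) \<in> Bc p" for c
  proof (rule ind)
    let ?W = "\<lambda>S. \<Sum>v\<in>A. Const (c v) * z v S"
    have W: "?W \<in> kcycles n I (int p) (cst s) j" by (rule kcycles_sum) (rule zk)
    obtain s' where s': "s \<le> s'" "stretch (cst s) (cst s') ?W \<in> kbounds n I (int p) (cst s') j"
      using coboundary_kbound[OF _ cob, of j] W unfolding kcycles_def by blast
    show "?W \<in> kbounds n I (int p) (cst s) j"
      by (rule stretch_inj[OF acyclic _ _ W s'(2)]) (use s s' in auto)
  qed
  define g where "g v = hc p (phi p s (z v))" for v
  note zc = kcycle_cocycle[OF zk]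
  \<comment> \<open>\<open>lin_independent\<close> speaks of a set of classes, so distinct indices
    must give distinct classes. Otherwise the combination with coefficients 1 and -1 would be a
    coboundary.\<close>
  have inj: "inj_on g A"
  proof (rule inj_onI, rule ccontr)
    fix v w assume vw: "v \<in> A" "w \<in> A" "g v = g w" "v \<noteq> w"
    have "phi p s (z v) \<in> hc p (phi p s (z w))"
      using hc_self[OF zc(2)[OF vw(1)]] vw(3) by (simp add: g_def)
    then obtain b where b: "b \<in> Bc p" "phi p s (z v) = b \<oplus>\<^bsub>C p\<^esub> phi p s (z w)" by (rule hc_memE)
    obtain s' U where s': "s \<le> s'" and U: "U \<in> preboundary n p" "b = phi p s' (kdiff n (cst s') U)"
      using eventually_obtain[OF eventually_conj[OF eventually_ge_at_top[of s] coboundaryD[OF b(1)]]] by blast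
    note Uc = preboundary_cochains[OF U(1)]
    let ?c = "\<lambda>x. if x = v then 1 else if x = w then - 1 else 0 :: 'k"
    let ?st = "stretch (cst s) (cst s')"
    have sum: "(\<Sum>x\<in>A. Const (?c x) * z x S) = z v S + (- 1) * z w S" for S
    proof -
      have "(\<Sum>x\<in>A. Const (?c x) * z x S) = (\<Sum>x\<in>{v, w}. Const (?c x) * z x S)"
        using vw fA by (intro sum.mono_neutral_right) auto
      also have "\<dots> = z v S + (- 1) * z w S"
        using vw(4) by (simp add: Const_def single_uminus)
      finally show ?thesis .
    qed
    have m1: "(- 1 :: 'k poly) \<in> polys n" by (rule polys_uminus[OF polys_1])
    have cw: "(\<lambda>S. (- 1) * z w S) \<in> cochains n" by (rule cochains_mult[OF zc(1)[OF vw(2)] m1])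
    have stc: "?st (z v) \<in> cochains n" "?st (z w) \<in> cochains n" using zc(1) vw by (auto intro: cochains_stretch)
    have "phi p s (\<lambda>S. z v S + (- 1) * z w S) = phi p s (z v) \<oplus>\<^bsub>C p\<^esub> phi p s (\<lambda>S. (- 1) * z w S)"
      using phi_add[OF zc(1)[OF vw(1)] cw] by simp
    also have "phi p s (\<lambda>S. (- 1) * z w S) = (- 1) \<odot>\<^bsub>C p\<^esub> phi p s' (?st (z w))"
      using phi_smult[OF zc(1)[OF vw(2)] m1, of p s] phi_stretch[OF zc(1)[OF vw(2)] s', of p] by simp
    also have "phi p s (z v) = b \<oplus>\<^bsub>C p\<^esub> phi p s' (?st (z w))"
      using b(2) phi_stretch[OF zc(1)[OF vw(2)] s', of p] by simp
    also have "b \<oplus>\<^bsub>C p\<^esub> phi p s' (?st (z w)) \<oplus>\<^bsub>C p\<^esub> (- 1) \<odot>\<^bsub>C p\<^esub> phi p s' (?st (z w)) = b"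
      using U Uc stc m1 by (simp add: phi_add phi_smult cochains_kdiff cochains_add cochains_uminus)
    finally have "phi p s (\<lambda>S. \<Sum>x\<in>A. Const (?c x) * z x S) \<in> Bc p" using b(1) sum by simp
    then have "\<forall>x\<in>A. ?c x = 0" by (rule ind')
    then show False using vw(1) by auto
  qed
  define X where "X = g ` A"
  have fX: "finite X" "card X = card A" using fA inj by (simp_all add: X_def card_image)
  have "g v \<in> component (H p) j" if "v \<in> A" for v
  proof -
    have "phi p s (z v) \<in> component (C p) j" using zk[OF that] by (intro phi_component) (simp add: kcycles_def)
    then show ?thesis using zc(2)[OF that] by (simp add: H_simps g_def)
  qed
  then have XH: "X \<subseteq> component (H p) j" by (auto simp: X_def)
  have "lin_independent (H p) X"
    unfolding lin_independent_def
  proof (intro allI impI)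
    fix a :: "_ \<Rightarrow> 'k" assume a: "(\<Oplus>\<^bsub>H p\<^esub>v\<in>X. Const (a v) \<odot>\<^bsub>H p\<^esub> v) = \<zero>\<^bsub>H p\<^esub>"
    define y where "y x = z (inv_into A g x)" for x
    have yg: "y (g v) = z v" if "v \<in> A" for v using inj that by (simp add: y_def)
    let ?W = "\<lambda>S. \<Sum>x\<in>X. Const (a x) * y x S"
    have W: "?W \<in> cochains n \<and> phi p s ?W \<in> Zc p \<and> (\<Oplus>\<^bsub>H p\<^esub>v\<in>X. Const (a v) \<odot>\<^bsub>H p\<^esub> v) = hc p (phi p s ?W)"
      by (rule H_lincomb[OF fX(1)]) (use zc yg in \<open>auto simp: X_def g_def\<close>)
    then have "hc p (phi p s ?W) = \<zero>\<^bsub>H p\<^esub>" using a by (elim conjE) (rule trans[OF sym])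
    then have "phi p s ?W \<in> Bc p" using W hc_eq_zero_iff[of "phi p s ?W" p] by blast
    moreover have "?W = (\<lambda>S. \<Sum>v\<in>A. Const (a (g v)) * z v S)"
      unfolding X_def using inj yg by (simp add: sum.reindex)
    ultimately have "\<forall>v\<in>A. a (g v) = 0" using ind'[of "\<lambda>v. a (g v)"] by simp
    then show "\<forall>x\<in>X. a x = 0" by (auto simp: X_def)
  qed
  then show ?thesis using that fX XH by blast
qed

end

theorem proposition4p14:
  fixes n :: nat
    and lt :: "expo \<Rightarrow> expo \<Rightarrow> bool"
    and I :: "'k::field poly set"
    and i :: nat
    and j :: int
  assumes "monomial_preorder n lt"
    and "homogeneous_ideal n I"
  shows "component_dim (local_cohomology n i (quotient_module (poly_ring n) I)) j
       \<le> component_dim (local_cohomology n i (quotient_module (poly_ring n) (leading_ideal n lt I))) j"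
proof -
  interpret preordered_ideal n lt I
    by unfold_locales (use assms in auto)
  \<comment> \<open>The bound concerns the leading ideal, whose Koszul cohomology must embed into
    the limit. It holds for all \<open>p\<close> and \<open>t\<close>, so the stage can be chosen
    afterwards.\<close>
  obtain d0 where d0: "\<And>p t d. d0 \<le> d \<Longrightarrow>
      kcycles n (leading_ideal n lt I) p t d = kbounds n (leading_ideal n lt I) p t d"
    using L.koszul_acyclic_high_degree by blast
  show ?thesis
    unfolding component_dim_def
  proof (rule SUP_least)
    fix X assume "X \<in> {X. finite X \<and> X \<subseteq> component (H i) j \<and> lin_independent (H i) X}"
    then have "\<forall>\<^sub>F s in at_top. \<exists>z. koszul_indep n I (int i) (cst s) j X z"
      by (intro koszul_indep_of_cohomology) auto
    \<comment> \<open>One stage has to do both: represent the classes in \<open>X\<close> by cycles,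
      and be high enough for the cohomology of the leading ideal to inject into the limit.\<close>
    then obtain s z where s: "nat (d0 - j) \<le> s" and z: "koszul_indep n I (int i) (cst s) j X z"
      using eventually_obtain[OF eventually_conj[OF eventually_ge_at_top[of "nat (d0 - j)"]]] by blast
    obtain A :: "(nat set \<times> expo) set" and z' where A: "card A = card X"
        "koszul_indep n (leading_ideal n lt I) (int i) (cst s) j A z'"
      using koszul_semicontinuity[OF z] by blast
    have "d0 \<le> j + int s" using s by linarith
    from L.cohomology_indep_of_koszul[OF A(2) d0 this]
    obtain Y where Y: "finite Y" "Y \<subseteq> component (L.H i) j" "lin_independent (L.H i) Y" "card Y = card A" by blast
    show "enat (card X) \<le> (SUP X\<in>{X. finite X \<and> X \<subseteq> component (L.H i) j \<and> lin_independent (L.H i) X}. enat (card X))"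
      by (rule SUP_upper2[of Y]) (use Y A in auto)
  qed
qed

end
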